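(* Let $n_1,n_2,n_3,n_4\ge 0$ with $n_1+n_2+n_3+n_4\geq 1$, and let $\chi_{n_1,n_2,n_3,n_4}(A)=\sum_{\langle\lambda\rangle\vdash(n_1,n_2,n_3,n_4)}m_{\langle\lambda\rangle}\,\chi_{\lambda(1)}\otimes\chi_{\lambda(2)}\otimes\chi_{\lambda(3)}\otimes\chi_{\lambda(4)}$ be the $(n_1,n_2,n_3,n_4)$-th cocharacter of $A$. Then: (1) $m_{\langle\lambda\rangle}=1$ if $\langle\lambda\rangle=((n_1),\emptyset,\emptyset,\emptyset)$ or $\langle\lambda\rangle=(\emptyset,\emptyset,(n_3),(n_4))$, where $n_1>0$ and $0<n_3+n_4\le 2$; (2) $m_{\langle\lambda\rangle}=q+1$ if $\langle\lambda\rangle=((p+q,p),\emptyset,(n_3),(n_4))$, where $p,q\ge0$ and $n_3+n_4=1$; (3) $m_{\langle\lambda\rangle}=q+1$ if $\langle\lambda\rangle=((p+q,p),\emptyset,(n_3),(n_4))$, where $p,q\ge0$ and $n_3+n_4=2$. In all remaining cases $m_{\langle\lambda\rangle}=0$.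
   Context: $K$ is a field of characteristic zero, $e_{i,j}$ are the matrix units of $M_3(K)$, and $A = K(e_{1,1}+e_{3,3})\oplus Ke_{2,2}\oplus Ke_{1,2}\oplus Ke_{2,3}\oplus Ke_{1,3}$, with the $\mathbb{Z}_2$-grading $A_0=\mathrm{Span}(e_{1,1}+e_{3,3},e_{2,2},e_{1,3})$, $A_1=\mathrm{Span}(e_{1,2},e_{2,3})$ and the graded involution $*$ given by reflection along the secondary diagonal, $\begin{pmatrix} d&a&c\\0&g&b\\0&0&d\end{pmatrix}^*=\begin{pmatrix} d&b&c\\0&g&a\\0&0&d\end{pmatrix}$. $A_i^{+}$, $A_i^-$ denote the symmetric and skew-symmetric elements of $A_i$. The free unital $\mathbb{Z}_2$-graded algebra with graded involution is freely generated by variables $y_i^+$ (symmetric, even), $y_i^-$ (skew, even), $z_i^+$ (symmetric, odd), $z_i^-$ (skew, odd), $i\ge1$. $\mathrm{Id}^*_{\mathbb{Z}_2}(A)$ is the ideal of polynomials vanishing whenever $y_i^+,y_i^-,z_i^+,z_i^-$ are replaced by elements of $A_0^+,A_0^-,A_1^+,A_1^-$ respectively. $P_{n_1,n_2,n_3,n_4}$ is the space of multilinear polynomials in $y_1^+,\dots,y_{n_1}^+,y_1^-,\dots,y_{n_2}^-,z_1^+,\dots,z_{n_3}^+,z_1^-,\dots,z_{n_4}^-$; the group $S_{n_1}\times S_{n_2}\times S_{n_3}\times S_{n_4}$ acts on it, each factor permuting the indices of the variables of the corresponding type, and $\chi_{n_1,n_2,n_3,n_4}(A)$ is the character of the module $P_{n_1,n_2,n_3,n_4}/(P_{n_1,n_2,n_3,n_4}\cap\mathrm{Id}^*_{\mathbb{Z}_2}(A))$.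 The sum runs over multipartitions $\langle\lambda\rangle=(\lambda(1),\lambda(2),\lambda(3),\lambda(4))$ with $\lambda(i)\vdash n_i$; $\chi_{\lambda(i)}$ is the irreducible character of $S_{n_i}$ corresponding to $\lambda(i)$, $\otimes$ is the outer tensor product and $m_{\langle\lambda\rangle}$ is the multiplicity. Zero parts of partitions are ignored, and $\emptyset=(0)$ is the partition of $0$. *)

theory Defs
  imports
    "HOL-Analysis.Finite_Cartesian_Product"
    "HOL-Library.Poly_Mapping"
    "HOL-Combinatorics.Permutations"
begin

section \<open>The algebra and its graded involution\<close>

definition munit :: "3 \<Rightarrow> 3 \<Rightarrow> 'k::field ^ 3 ^ 3"
  where "munit i j = axis i (axis j 1)"

definition mscale :: "'k::field \<Rightarrow> 'k ^ 3 ^ 3 \<Rightarrow> 'k ^ 3 ^ 3"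
  where "mscale c X = mat c ** X"

definition A_even :: "('k::field ^ 3 ^ 3) set"
  where "A_even = {mscale d (munit 1 1 + munit 3 3) + mscale g (munit 2 2) + mscale c (munit 1 3)
                   | d g c. True}"

definition A_odd :: "('k::field ^ 3 ^ 3) set"
  where "A_odd = {mscale a (munit 1 2) + mscale b (munit 2 3) | a b. True}"

definition A_alg :: "('k::field ^ 3 ^ 3) set"
  where "A_alg = {X + Y | X Y. X \<in> A_even \<and> Y \<in> A_odd}"

text \<open>In the index type \<^typ>\<open>3\<close> (arithmetic modulo 3), the map sending \<open>i\<close> to \<open>4 - i\<close>
  swaps 1 and 3 and fixes 2.\<close>

definition invol :: "'k::field ^ 3 ^ 3 \<Rightarrow> 'k ^ 3 ^ 3"
  where "invol X = (\<chi> i j. X $ (4 - j) $ (4 - i))"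

lemma invol_entries:
  fixes X :: "'k::field ^ 3 ^ 3"
  shows "invol X $ 1 $ 1 = X $ 3 $ 3" "invol X $ 1 $ 2 = X $ 2 $ 3" "invol X $ 1 $ 3 = X $ 1 $ 3"
    "invol X $ 2 $ 1 = X $ 3 $ 2" "invol X $ 2 $ 2 = X $ 2 $ 2" "invol X $ 2 $ 3 = X $ 1 $ 2"
    "invol X $ 3 $ 1 = X $ 3 $ 1" "invol X $ 3 $ 2 = X $ 2 $ 1" "invol X $ 3 $ 3 = X $ 1 $ 1"
  by (simp_all add: invol_def)

definition sym_part :: "('k::field ^ 3 ^ 3) set \<Rightarrow> ('k ^ 3 ^ 3) set"
  where "sym_part S = {X \<in> S. invol X = X}"

definition skew_part :: "('k::field ^ 3 ^ 3) set \<Rightarrow> ('k ^ 3 ^ 3) set"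
  where "skew_part S = {X \<in> S. invol X = - X}"


section \<open>The free algebra and the identities\<close>

text \<open>The index \<open>i\<close> of a variable starts at 0, so that \<open>YP i\<close> is $y_{i+1}^+$ and the
  symmetric group $S_n$ is realised by the permutations of \<open>{..<n}\<close>. \<open>P\<close> stands for symmetric
  and \<open>M\<close> for skew.\<close>

datatype var = YP nat | YM nat | ZP nat | ZM nat

text \<open>With concatenation as the additive monoid structure on words, the type
  \<open>var list \<Rightarrow>\<^sub>0 'k\<close> is the monoid ring of the free monoid, that is, the free unital
  associative algebra. Its grading and involution are the ones that the parity and
  the symmetry of the variables prescribe; the identities depend on them only through the
  admissible substitutions.\<close>

instantiation list :: (type) monoid_add
begin

definition zero_list :: "'a list"
  where "zero_list = []"

definition plus_list :: "'a list \<Rightarrow> 'a list \<Rightarrow> 'a list"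
  where "plus_list u v = u @ v"

instance
  by standard (simp_all add: zero_list_def plus_list_def)

end

type_synonym 'k free_alg = "var list \<Rightarrow>\<^sub>0 'k"

definition admissible :: "(var \<Rightarrow> 'k::field ^ 3 ^ 3) \<Rightarrow> bool"
  where "admissible \<rho> \<longleftrightarrow> (\<forall>i. \<rho> (YP i) \<in> sym_part A_even \<and> \<rho> (YM i) \<in> skew_part A_even \<and>
                               \<rho> (ZP i) \<in> sym_part A_odd \<and> \<rho> (ZM i) \<in> skew_part A_odd)"

definition eval_word :: "(var \<Rightarrow> 'k::field ^ 3 ^ 3) \<Rightarrow> var list \<Rightarrow> 'k ^ 3 ^ 3"
  where "eval_word \<rho> w = foldr (\<lambda>v X. \<rho> v ** X) w (mat 1)"

definition eval_free :: "(var \<Rightarrow> 'k::field ^ 3 ^ 3) \<Rightarrow> 'k free_alg \<Rightarrow> 'k ^ 3 ^ 3"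
  where "eval_free \<rho> f = (\<Sum>w\<in>Poly_Mapping.keys f. mscale (Poly_Mapping.lookup f w) (eval_word \<rho> w))"

definition Id_A :: "'k::field free_alg set"
  where "Id_A = {f. \<forall>\<rho>. admissible \<rho> \<longrightarrow> eval_free \<rho> f = 0}"

definition vars_upto :: "nat \<Rightarrow> nat \<Rightarrow> nat \<Rightarrow> nat \<Rightarrow> var set"
  where "vars_upto n1 n2 n3 n4 = YP ` {..<n1} \<union> YM ` {..<n2} \<union> ZP ` {..<n3} \<union> ZM ` {..<n4}"

definition multilin :: "nat \<Rightarrow> nat \<Rightarrow> nat \<Rightarrow> nat \<Rightarrow> 'k::field free_alg set"
  where "multilin n1 n2 n3 n4 =
    {f. \<forall>w\<in>Poly_Mapping.keys f. distinct w \<and> set w = vars_upto n1 n2 n3 n4}"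


section \<open>Traces on quotients\<close>

definition pscale :: "'k::field \<Rightarrow> ('a \<Rightarrow>\<^sub>0 'k) \<Rightarrow> ('a \<Rightarrow>\<^sub>0 'k)"
  where "pscale c f = Poly_Mapping.map ((*) c) f"

text \<open>Let \<open>W \<subseteq> U\<close> be subspaces with \<open>U/W\<close> finite-dimensional. A finite subset \<open>B\<close> of \<open>U\<close>
  represents a basis of \<open>U/W\<close> if every element of \<open>U\<close> is congruent modulo \<open>W\<close> to exactly one
  linear combination of \<open>B\<close>. The trace on \<open>U/W\<close> of the map induced by \<open>T\<close> (which must
  preserve \<open>U\<close> and \<open>W\<close>) does not depend on the choice of \<open>B\<close>.\<close>

definition is_coords :: "('a \<Rightarrow>\<^sub>0 'k::field) set \<Rightarrow> ('a \<Rightarrow>\<^sub>0 'k) set \<Rightarrow> ('a \<Rightarrow>\<^sub>0 'k)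
    \<Rightarrow> (('a \<Rightarrow>\<^sub>0 'k) \<Rightarrow> 'k) \<Rightarrow> bool"
  where "is_coords W B u c \<longleftrightarrow> (\<forall>b. b \<notin> B \<longrightarrow> c b = 0) \<and> u - (\<Sum>b\<in>B. pscale (c b) b) \<in> W"

definition quot_basis :: "('a \<Rightarrow>\<^sub>0 'k::field) set \<Rightarrow> ('a \<Rightarrow>\<^sub>0 'k) set \<Rightarrow> ('a \<Rightarrow>\<^sub>0 'k) set \<Rightarrow> bool"
  where "quot_basis U W B \<longleftrightarrow> finite B \<and> B \<subseteq> U \<and> (\<forall>u\<in>U. \<exists>!c. is_coords W B u c)"

definition quot_trace :: "('a \<Rightarrow>\<^sub>0 'k::field) set \<Rightarrow> ('a \<Rightarrow>\<^sub>0 'k) set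
    \<Rightarrow> (('a \<Rightarrow>\<^sub>0 'k) \<Rightarrow> ('a \<Rightarrow>\<^sub>0 'k)) \<Rightarrow> 'k"
  where "quot_trace U W T =
    (let B = (SOME B. quot_basis U W B) in \<Sum>b\<in>B. (THE c. is_coords W B (T b) c) b)"


section \<open>The cocharacter\<close>

type_synonym perm4 = "(nat \<Rightarrow> nat) \<times> (nat \<Rightarrow> nat) \<times> (nat \<Rightarrow> nat) \<times> (nat \<Rightarrow> nat)"

definition Sym :: "nat \<Rightarrow> (nat \<Rightarrow> nat) set"
  where "Sym n = {\<sigma>. \<sigma> permutes {..<n}}"

fun rename_var :: "perm4 \<Rightarrow> var \<Rightarrow> var"
  where
    "rename_var (g1, g2, g3, g4) (YP i) = YP (g1 i)"
  | "rename_var (g1, g2, g3, g4) (YM i) = YM (g2 i)"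
  | "rename_var (g1, g2, g3, g4) (ZP i) = ZP (g3 i)"
  | "rename_var (g1, g2, g3, g4) (ZM i) = ZM (g4 i)"

definition act_free :: "perm4 \<Rightarrow> 'k::field free_alg \<Rightarrow> 'k free_alg"
  where "act_free g f = (\<Sum>w\<in>Poly_Mapping.keys f.
    Poly_Mapping.single (map (rename_var g) w) (Poly_Mapping.lookup f w))"

definition cochar :: "nat \<Rightarrow> nat \<Rightarrow> nat \<Rightarrow> nat \<Rightarrow> perm4 \<Rightarrow> 'k::field"
  where "cochar n1 n2 n3 n4 g =
    quot_trace (multilin n1 n2 n3 n4) (multilin n1 n2 n3 n4 \<inter> Id_A) (act_free g)"


section \<open>Irreducible characters of the symmetric group\<close>

definition partitions :: "nat \<Rightarrow> nat list set"
  where "partitions n = {l. sorted_wrt (\<ge>) l \<and> 0 \<notin> set l \<and> sum_list l = n}"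

text \<open>The partition with the given parts, zero parts being dropped.\<close>

definition part :: "nat list \<Rightarrow> nat list"
  where "part l = filter (\<lambda>x. x \<noteq> 0) l"

text \<open>Positions of the entries in the tableau of shape \<open>l\<close> that is filled with
  \<open>0, 1, 2, \<dots>\<close> row by row.\<close>

definition row_of :: "nat list \<Rightarrow> nat \<Rightarrow> nat"
  where "row_of l k = (LEAST r. k < sum_list (take (Suc r) l))"

definition col_of :: "nat list \<Rightarrow> nat \<Rightarrow> nat"
  where "col_of l k = k - sum_list (take (row_of l k) l)"

definition row_stab :: "nat list \<Rightarrow> (nat \<Rightarrow> nat) set"
  where "row_stab l = {\<sigma> \<in> Sym (sum_list l). \<forall>k<sum_list l. row_of l (\<sigma> k) = row_of l k}"

definition col_stab :: "nat list \<Rightarrow> (nat \<Rightarrow> nat) set"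
  where "col_stab l = {\<sigma> \<in> Sym (sum_list l). \<forall>k<sum_list l. col_of l (\<sigma> k) = col_of l k}"

text \<open>The group algebra of \<open>Sym n\<close> consists of the finitely supported functions with support
  in \<open>Sym n\<close>; its product extends the composition of permutations bilinearly.\<close>

definition grp_alg :: "nat \<Rightarrow> ((nat \<Rightarrow> nat) \<Rightarrow>\<^sub>0 'k::field) set"
  where "grp_alg n = {a. Poly_Mapping.keys a \<subseteq> Sym n}"

definition grp_mult :: "((nat \<Rightarrow> nat) \<Rightarrow>\<^sub>0 'k::field) \<Rightarrow> ((nat \<Rightarrow> nat) \<Rightarrow>\<^sub>0 'k)
    \<Rightarrow> ((nat \<Rightarrow> nat) \<Rightarrow>\<^sub>0 'k)"
  where "grp_mult a b = (\<Sum>\<sigma>\<in>Poly_Mapping.keys a. \<Sum>\<tau>\<in>Poly_Mapping.keys b.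
    Poly_Mapping.single (\<sigma> \<circ> \<tau>) (Poly_Mapping.lookup a \<sigma> * Poly_Mapping.lookup b \<tau>))"

definition young_symmetrizer :: "nat list \<Rightarrow> ((nat \<Rightarrow> nat) \<Rightarrow>\<^sub>0 'k::field)"
  where "young_symmetrizer l = (\<Sum>\<sigma>\<in>row_stab l. \<Sum>\<tau>\<in>col_stab l.
    Poly_Mapping.single (\<sigma> \<circ> \<tau>) (of_int (sign \<tau>)))"

text \<open>The irreducible module of a partition is the minimal left ideal of the group algebra
  generated by the Young symmetrizer, with the group acting by left multiplication.\<close>

definition irr_module :: "nat list \<Rightarrow> ((nat \<Rightarrow> nat) \<Rightarrow>\<^sub>0 'k::field) set"
  where "irr_module l = {grp_mult a (young_symmetrizer l) | a. a \<in> grp_alg (sum_list l)}"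

definition irr_char :: "nat list \<Rightarrow> (nat \<Rightarrow> nat) \<Rightarrow> 'k::field"
  where "irr_char l \<sigma> = quot_trace (irr_module l) {0} (grp_mult (Poly_Mapping.single \<sigma> 1))"


section \<open>Multiplicities\<close>

type_synonym multipart = "nat list \<times> nat list \<times> nat list \<times> nat list"

definition multipartitions :: "nat \<Rightarrow> nat \<Rightarrow> nat \<Rightarrow> nat \<Rightarrow> multipart set"
  where "multipartitions n1 n2 n3 n4 =
    partitions n1 \<times> partitions n2 \<times> partitions n3 \<times> partitions n4"

fun outer_char :: "multipart \<Rightarrow> perm4 \<Rightarrow> 'k::field"
  where "outer_char (l1, l2, l3, l4) (g1, g2, g3, g4) =
    irr_char l1 g1 * irr_char l2 g2 * irr_char l3 g3 * irr_char l4 g4"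

definition cochar_mults :: "'k::field itself \<Rightarrow> nat \<Rightarrow> nat \<Rightarrow> nat \<Rightarrow> nat \<Rightarrow> (multipart \<Rightarrow> nat) \<Rightarrow> bool"
  where "cochar_mults K n1 n2 n3 n4 m \<longleftrightarrow>
    (\<forall>g \<in> Sym n1 \<times> Sym n2 \<times> Sym n3 \<times> Sym n4.
      (cochar n1 n2 n3 n4 g :: 'k) =
      (\<Sum>\<Lambda>\<in>multipartitions n1 n2 n3 n4. of_nat (m \<Lambda>) * outer_char \<Lambda> g))"

end

theory Submission
  imports Defs "HOL-Analysis.Cartesian_Space"
begin

text \<open>Up to a sign, the value of a multilinear word in \<open>m \<le> 2\<close> odd and \<open>n\<close> symmetric even
  variables depends only on the set of even variables that are preceded by an even number of odd ones. For
  \<open>m > 0\<close> every subset of the \<open>n\<close> variables occurs and the values for different subsets are linearly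
  independent, so the cocharacter is the permutation character on all subsets, with the odd variables permuted
  trivially; for \<open>m = 0\<close> it is trivial, and for \<open>m \<ge> 3\<close> or in the presence of skew even variables it
  vanishes.

  Left multiplication on the left ideal generated by the Young symmetrizer of \<open>(n - j, j)\<close> has the same
  trace as the action on the functions on \<open>j\<close>-subsets whose sums over the supersets of every
  \<open>(j - 1)\<close>-subset vanish. Since the inclusion matrix
  between \<open>(j - 1)\<close>-subsets and \<open>j\<close>-subsets has full rank, the irreducible character is the difference of the
  two permutation characters, and summation by parts gives the multiplicities \<open>n - 2 j + 1\<close>. They are unique
  because summing characters over row stabilisers gives a matrix that is triangular for
  the dominance order.\<close>

subsection \<open>Traces on quotients\<close>

text \<open>\<open>quot_trace\<close> refers to a basis picked by choice, so no computation can name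
  its elements. Traces are therefore found by factoring the operator through an explicit finite set
  \<open>I\<close>, as the sum over \<open>x\<close> of \<open>i x u\<close> times
  \<open>p x\<close>; \<open>quot_trace_factor\<close> then returns the sum of
  \<open>i x (p x)\<close>. For the free algebra \<open>I\<close> consists of sets of even
  variables. For a two-row ideal it consists of all \<open>j\<close>-subsets, in general more than
  the dimension, so the \<open>p x\<close> are dependent. What replaces independence is that the
  square matrix \<open>E\<close> of coefficients fixes harmonic functions and has harmonic columns;
  comparing it with a second matrix, built from a right inverse of the inclusion matrix, evaluates
  its trace.

  The scalar that normalises \<open>E\<close> comes from averaging over the row stabiliser:
  exchanging \<open>s\<close> points of the second row multiplies the average of a harmonic function
  by (-1)^s / binom(m, s). This sign is also the sign of the column permutation that exchanges them,
  so all contributions are positive and cannot cancel.\<close>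

lemma lookup_pscale [simp]: "Poly_Mapping.lookup (pscale c f) x = c * Poly_Mapping.lookup f x"
  by (simp add: pscale_def Poly_Mapping.map.rep_eq when_def)

lemma pscale_single [simp]:
  "pscale c (Poly_Mapping.single x k) = Poly_Mapping.single x (c * k)"
  by (rule poly_mapping_eqI) (simp add: lookup_single when_def)

interpretation pm: vector_space "pscale :: 'k::field \<Rightarrow> ('a \<Rightarrow>\<^sub>0 'k) \<Rightarrow> ('a \<Rightarrow>\<^sub>0 'k)"
  by standard (rule poly_mapping_eqI, simp add: lookup_add algebra_simps)+

lemma is_coords_unique:
  assumes "quot_basis U W B" "u \<in> U" "is_coords W B u c"
  shows "(THE c. is_coords W B u c) = c"
  using assms unfolding quot_basis_def by (metis the1_equality)

lemma coords_exist:
  assumes "quot_basis U W B" "u \<in> U"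
  shows "is_coords W B u (THE c. is_coords W B u c)"
  using assms theI'[of "is_coords W B u"] unfolding quot_basis_def by blast

text \<open>A finite set of least cardinality that spans \<open>U\<close> together with
  \<open>W\<close> is independent modulo \<open>W\<close>: a relation with a nonzero coefficient at
  \<open>b\<close> would allow \<open>b\<close> to be dropped.\<close>

lemma quot_basis_exists:
  assumes U: "pm.subspace U" and W: "pm.subspace W" and "W \<subseteq> U"
    and F: "finite F" "F \<subseteq> U" "U \<subseteq> pm.span (F \<union> W)"
  shows "\<exists>B. quot_basis U W B"
proof -
  let ?P = "\<lambda>B. finite B \<and> B \<subseteq> U \<and> U \<subseteq> pm.span (B \<union> W)"
  obtain B where B: "?P B" and min: "\<And>B'. ?P B' \<Longrightarrow> card B \<le> card B'"
    using F ex_has_least_nat[of ?P F card] by blast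
  have fin: "finite B" and BU: "B \<subseteq> U" and Bsp: "U \<subseteq> pm.span (B \<union> W)" using B by auto
  have ex: "\<exists>c. is_coords W B u c" if "u \<in> U" for u
  proof -
    have "u \<in> pm.span (B \<union> W)" using that Bsp by auto
    then obtain x w where "u = x + w" "x \<in> pm.span B" "w \<in> W"
      using pm.span_Un[of B W] pm.span_eq_iff[THEN iffD2, OF W] by auto
    moreover obtain c where "x = (\<Sum>b\<in>B. pscale (c b) b)"
      using \<open>x \<in> pm.span B\<close> pm.span_finite[OF fin] by auto
    moreover define d where "d b = (if b \<in> B then c b else 0)" for b
    ultimately have "is_coords W B u d"
      unfolding is_coords_def by (simp add: d_def cong: sum.cong)
    then show ?thesis by blast
  qed
  have uniq: "c = d" if c: "is_coords W B u c" and d: "is_coords W B u d" for u c d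
  proof (rule ccontr)
    assume "c \<noteq> d"
    then obtain b where b: "c b \<noteq> d b" by auto
    then have bB: "b \<in> B" using c d unfolding is_coords_def by metis
    let ?S = "pm.span ((B - {b}) \<union> W)"
    have "(u - (\<Sum>b\<in>B. pscale (c b) b)) - (u - (\<Sum>b\<in>B. pscale (d b) b)) \<in> W"
      using c d W unfolding is_coords_def by (blast intro: pm.subspace_diff)
    moreover have "(u - (\<Sum>b\<in>B. pscale (c b) b)) - (u - (\<Sum>b\<in>B. pscale (d b) b)) =
        (\<Sum>b\<in>B. pscale (d b - c b) b)"
      by (simp add: pm.scale_left_diff_distrib sum_subtractf)
    also have "\<dots> = pscale (d b - c b) b + (\<Sum>b\<in>B - {b}. pscale (d b - c b) b)"
      using fin bB by (simp add: sum.remove)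
    finally have "pscale (d b - c b) b + (\<Sum>b\<in>B - {b}. pscale (d b - c b) b) \<in> ?S"
      using pm.span_superset by fastforce
    moreover have "(\<Sum>b\<in>B - {b}. pscale (d b - c b) b) \<in> ?S"
      by (intro pm.span_sum pm.span_scale pm.span_base) auto
    ultimately have "pscale (d b - c b) b \<in> ?S"
      using pm.span_add_eq2 by blast
    then have "pscale (inverse (d b - c b)) (pscale (d b - c b) b) \<in> ?S"
      by (rule pm.span_scale)
    then have "b \<in> ?S" using b by simp
    then have "B \<union> W \<subseteq> ?S" by (auto intro: pm.span_base)
    then have "pm.span (B \<union> W) \<subseteq> ?S" by (simp add: pm.span_minimal)
    then have "?P (B - {b})" using B by auto
    then have "card B \<le> card (B - {b})" by (rule min)
    then show False using bB fin by (metis card_Diff1_less linorder_not_less)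
  qed
  have "quot_basis U W B"
    unfolding quot_basis_def using fin BU ex uniq by blast
  then show ?thesis ..
qed

text \<open>The trace of \<open>p \<circ> i\<close> equals that of \<open>i \<circ> p\<close>.\<close>

lemma quot_trace_factor:
  assumes ex: "\<exists>B. quot_basis U W B" and W: "pm.subspace W" and U: "pm.subspace U"
    and TU: "\<And>u. u \<in> U \<Longrightarrow> T u \<in> U"
    and p: "\<And>x. x \<in> I \<Longrightarrow> p x \<in> U"
    and add: "\<And>x u v. x \<in> I \<Longrightarrow> u \<in> U \<Longrightarrow> v \<in> U \<Longrightarrow> i x (u + v) = i x u + i x v"
    and scale: "\<And>x k u. x \<in> I \<Longrightarrow> u \<in> U \<Longrightarrow> i x (pscale k u) = k * i x u"
    and van: "\<And>x w. x \<in> I \<Longrightarrow> w \<in> U \<Longrightarrow> w \<in> W \<Longrightarrow> i x w = 0"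
    and T: "\<And>u. u \<in> U \<Longrightarrow> T u - (\<Sum>x\<in>I. pscale (i x u) (p x)) \<in> W"
  shows "quot_trace U W T = (\<Sum>x\<in>I. i x (p x))"
proof -
  define B where "B = (SOME B. quot_basis U W B)"
  define co where "co u = (THE c. is_coords W B u c)" for u
  have B: "quot_basis U W B" unfolding B_def using ex by (rule someI_ex)
  then have fin: "finite B" and BU: "B \<subseteq> U" unfolding quot_basis_def by auto
  have co: "is_coords W B u (co u)" if "u \<in> U" for u
    unfolding co_def using B that by (rule coords_exist)
  have rest: "u - (\<Sum>b\<in>B. pscale (co u b) b) \<in> W" if "u \<in> U" for u
    using co[OF that] unfolding is_coords_def by auto
  have sumU: "(\<Sum>b\<in>B'. pscale (c b) b) \<in> U" if "B' \<subseteq> U" for c B'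
    using that U by (intro pm.subspace_sum pm.subspace_scale) auto
  have isum: "i x (\<Sum>b\<in>B'. pscale (c b) b) = (\<Sum>b\<in>B'. c b * i x b)"
    if x: "x \<in> I" and "finite B'" and "B' \<subseteq> U" for x B' c
    using that(2,3)
  proof (induction B')
    case empty
    then show ?case using scale[OF x, of 0 0] pm.subspace_0[OF U] by simp
  next
    case (insert b B')
    then have "pscale (c b) b \<in> U" "(\<Sum>b\<in>B'. pscale (c b) b) \<in> U"
      using sumU U by (auto intro: pm.subspace_scale)
    then show ?case using insert add[OF x] scale[OF x] by simp
  qed
  \<comment> \<open>\<open>T u\<close> and the combination of the \<open>p x\<close> differ by an
    element of \<open>W\<close>, so they have the same coordinates.\<close>
  have coT: "co (T u) b = (\<Sum>x\<in>I. i x u * co (p x) b)" if u: "u \<in> U" for u b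
  proof -
    let ?d = "\<lambda>b. \<Sum>x\<in>I. i x u * co (p x) b"
    have "(T u - (\<Sum>x\<in>I. pscale (i x u) (p x))) +
        (\<Sum>x\<in>I. pscale (i x u) (p x - (\<Sum>b\<in>B. pscale (co (p x) b) b))) \<in> W"
      using T[OF u] rest p W
      by (intro pm.subspace_add[OF W] pm.subspace_sum[OF W] pm.subspace_scale[OF W]) auto
    also have "(T u - (\<Sum>x\<in>I. pscale (i x u) (p x))) +
        (\<Sum>x\<in>I. pscale (i x u) (p x - (\<Sum>b\<in>B. pscale (co (p x) b) b))) =
        T u - (\<Sum>x\<in>I. \<Sum>b\<in>B. pscale (i x u * co (p x) b) b)"
      by (simp add: pm.scale_right_diff_distrib sum_subtractf pm.scale_sum_right)
    also have "(\<Sum>x\<in>I. \<Sum>b\<in>B. pscale (i x u * co (p x) b) b) =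
        (\<Sum>b\<in>B. pscale (?d b) b)"
      by (subst sum.swap) (simp add: pm.scale_sum_left)
    finally have "is_coords W B (T u) ?d"
      using co p unfolding is_coords_def by auto
    then show ?thesis
      using is_coords_unique[OF B TU[OF u]] unfolding co_def by simp
  qed
  have "quot_trace U W T = (\<Sum>b\<in>B. co (T b) b)"
    by (simp add: quot_trace_def Let_def B_def co_def)
  also have "\<dots> = (\<Sum>b\<in>B. \<Sum>x\<in>I. i x b * co (p x) b)"
    using BU coT by (intro sum.cong) auto
  also have "\<dots> = (\<Sum>x\<in>I. \<Sum>b\<in>B. co (p x) b * i x b)"
    by (subst sum.swap) (simp add: mult.commute)
  also have "\<dots> = (\<Sum>x\<in>I. i x (p x))"
  proof (rule sum.cong[OF refl])
    fix x assume x: "x \<in> I"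
    let ?s = "\<Sum>b\<in>B. pscale (co (p x) b) b"
    \<comment> \<open>Split \<open>p x\<close> into its expansion in \<open>B\<close> and a
      remainder in \<open>W\<close>, which the functional kills.\<close>
    have "i x (p x) = i x (?s + (p x - ?s))" by simp
    also have "\<dots> = i x ?s + i x (p x - ?s)"
      using x p sumU[OF BU] U by (intro add) (auto intro: pm.subspace_diff)
    also have "i x (p x - ?s) = 0"
      using x p rest sumU[OF BU] U by (intro van) (auto intro: pm.subspace_diff)
    finally show "(\<Sum>b\<in>B. co (p x) b * i x b) = i x (p x)"
      using isum[OF x fin BU] by simp
  qed
  finally show ?thesis .
qed

lemma coords_sum:
  assumes B: "quot_basis U W B" and W: "pm.subspace W" and U: "pm.subspace U"
    and u: "\<And>r. r \<in> R \<Longrightarrow> u r \<in> U"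
  shows "(THE c. is_coords W B (\<Sum>r\<in>R. u r) c) b = (\<Sum>r\<in>R. (THE c. is_coords W B (u r) c) b)"
proof -
  define co where "co u = (THE c. is_coords W B u c)" for u
  have co: "is_coords W B (u r) (co (u r))" if "r \<in> R" for r
    unfolding co_def using B u[OF that] by (rule coords_exist)
  have "(\<Sum>r\<in>R. u r - (\<Sum>b\<in>B. pscale (co (u r) b) b)) \<in> W"
    using co unfolding is_coords_def by (intro pm.subspace_sum[OF W]) auto
  also have "(\<Sum>r\<in>R. u r - (\<Sum>b\<in>B. pscale (co (u r) b) b)) =
      (\<Sum>r\<in>R. u r) - (\<Sum>b\<in>B. pscale (\<Sum>r\<in>R. co (u r) b) b)"
    by (simp add: sum_subtractf pm.scale_sum_left sum.swap[of _ B])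
  finally have "is_coords W B (\<Sum>r\<in>R. u r) (\<lambda>b. \<Sum>r\<in>R. co (u r) b)"
    using co unfolding is_coords_def by auto
  moreover have "(\<Sum>r\<in>R. u r) \<in> U" using u U by (intro pm.subspace_sum) auto
  ultimately show ?thesis
    using is_coords_unique[OF B] unfolding co_def by metis
qed

text \<open>The chosen basis depends on \<open>U\<close> and \<open>W\<close> only, so one basis
  serves all the operators.\<close>

lemma quot_trace_sum:
  assumes ex: "\<exists>B. quot_basis U W B" and W: "pm.subspace W" and U: "pm.subspace U"
    and TU: "\<And>r u. r \<in> R \<Longrightarrow> u \<in> U \<Longrightarrow> T r u \<in> U"
  shows "(\<Sum>r\<in>R. quot_trace U W (T r)) = quot_trace U W (\<lambda>u. \<Sum>r\<in>R. T r u)"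
proof -
  define B where "B = (SOME B. quot_basis U W B)"
  have B: "quot_basis U W B" unfolding B_def using ex by (rule someI_ex)
  then have BU: "B \<subseteq> U" unfolding quot_basis_def by auto
  have "(\<Sum>b\<in>B. (THE c. is_coords W B (\<Sum>r\<in>R. T r b) c) b) =
      (\<Sum>b\<in>B. \<Sum>r\<in>R. (THE c. is_coords W B (T r b) c) b)"
    using TU BU by (intro sum.cong[OF refl] coords_sum[OF B W U]) auto
  then show ?thesis
    unfolding quot_trace_def Let_def B_def[symmetric] by (simp add: sum.swap[of _ B])
qed

text \<open>On its image \<open>T\<close> is multiplication by \<kappa>, so the trace is \<kappa>
  times the dimension of the image, a positive integer and hence nonzero in characteristic
  zero.\<close>

lemma quot_trace_quasi_idempotent:
  fixes T :: "('a \<Rightarrow>\<^sub>0 'k::field_char_0) \<Rightarrow> ('a \<Rightarrow>\<^sub>0 'k)"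
  assumes U: "pm.subspace U" and F: "finite F" "F \<subseteq> U" "U \<subseteq> pm.span F"
    and T: "Vector_Spaces.linear pscale pscale T" and TU: "\<And>u. u \<in> U \<Longrightarrow> T u \<in> U"
    and idem: "\<And>u. u \<in> U \<Longrightarrow> T (T u) = pscale \<kappa> (T u)" and "\<kappa> \<noteq> 0"
    and nz: "v \<in> U" "T v \<noteq> 0"
  shows "quot_trace U {0} T \<noteq> 0"
proof -
  interpret T: Vector_Spaces.linear pscale pscale T by fact
  let ?V = "T ` U"
  have V: "pm.subspace ?V" using U by (rule T.subspace_image)
  have "?V \<subseteq> T ` pm.span F" using F by auto
  also have "\<dots> = pm.span (T ` F)" by (rule T.span_image[symmetric])
  finally have VF: "?V \<subseteq> pm.span (T ` F \<union> {0})" by simp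
  have z: "pm.subspace {0 :: 'a \<Rightarrow>\<^sub>0 'k}" by simp
  obtain B where B: "quot_basis ?V {0} B"
    using quot_basis_exists[OF V z _ _ _ VF] F pm.subspace_0[OF V] by auto
  obtain B' where B': "quot_basis U {0} B'"
    using quot_basis_exists[OF U z _ F(1,2)] F(3) pm.subspace_0[OF U] by auto
  define co where "co u = (THE c. is_coords {0} B u c)" for u
  have co: "is_coords {0} B u (co u)" if "u \<in> ?V" for u
    unfolding co_def using B that by (rule coords_exist)
  have coI: "co u = c" if "u \<in> ?V" "is_coords {0} B u c" for u c
    unfolding co_def using B that by (rule is_coords_unique)
  have BV: "B \<subseteq> ?V" and fin: "finite B" using B unfolding quot_basis_def by auto
  have addV: "co (u + w) = (\<lambda>b. co u b + co w b)" if "u \<in> ?V" "w \<in> ?V" for u w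
    using co[OF that(1)] co[OF that(2)] that
    by (intro coI pm.subspace_add[OF V])
       (auto simp: is_coords_def pm.scale_left_distrib sum.distrib)
  have scaleV: "co (pscale k u) = (\<lambda>b. k * co u b)" if "u \<in> ?V" for u k
  proof (intro coI pm.subspace_scale[OF V] that)
    have u: "u = (\<Sum>b\<in>B. pscale (co u b) b)" using co[OF that] by (simp add: is_coords_def)
    have "pscale k u = pscale k (\<Sum>b\<in>B. pscale (co u b) b)" using u by simp
    also have "\<dots> = (\<Sum>b\<in>B. pscale (k * co u b) b)" by (simp add: pm.scale_sum_right)
    finally show "is_coords {0} B (pscale k u) (\<lambda>b. k * co u b)"
      using co[OF that] by (simp add: is_coords_def)
  qed
  have diag: "co b b = 1" if "b \<in> B" for b
  proof -
    have "(\<Sum>c\<in>B. pscale (if c = b then 1 else 0) c) = (\<Sum>c\<in>B. if c = b then c else 0)"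
      by (intro sum.cong) auto
    then have "is_coords {0} B b (\<lambda>c. if c = b then 1 else 0)"
      using that fin by (auto simp: is_coords_def)
    then show ?thesis using coI[of b] that BV by auto
  qed
  have "quot_trace U {0} T = (\<Sum>b\<in>B. co (T b) b)"
  \<comment> \<open>Factor \<open>T\<close> through a basis of its image: \<open>p\<close> is the
    inclusion and \<open>i\<close> takes the coordinates of \<open>T u\<close>.\<close>
  proof (rule quot_trace_factor[where p = "\<lambda>b. b" and i = "\<lambda>b u. co (T u) b"])
    show "T u - (\<Sum>b\<in>B. pscale (co (T u) b) b) \<in> {0}" if "u \<in> U" for u
      using co[of "T u"] that by (simp add: is_coords_def)
    show "co (T w) b = 0" if "w \<in> {0}" for b w
    proof -
      have "co 0 = (\<lambda>b. 0 * co 0 b)" using scaleV[of 0 0] pm.subspace_0[OF V] by simp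
      then show ?thesis using that T.zero by (metis mult_zero_left singletonD)
    qed
  qed (use B' U TU BV addV scaleV T.add T.scale in auto)
  also have "\<dots> = (\<Sum>b\<in>B. \<kappa>)"
  proof (rule sum.cong[OF refl])
    fix b assume b: "b \<in> B"
    then obtain u where "u \<in> U" "b = T u" using BV by auto
    then have "T b = pscale \<kappa> b" using idem by simp
    then show "co (T b) b = \<kappa>" using scaleV[of b \<kappa>] b BV diag by auto
  qed
  also have "\<dots> = of_nat (card B) * \<kappa>" by simp
  finally have tr: "quot_trace U {0} T = of_nat (card B) * \<kappa>" .
  have "B \<noteq> {}"
  proof
    assume "B = {}"
    then have "T v = 0" using co[of "T v"] nz by (simp add: is_coords_def)
    then show False using nz by simp
  qed
  then show ?thesis using tr fin \<open>\<kappa> \<noteq> 0\<close> by simp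
qed

subsection \<open>Linear extensions of maps between bases\<close>

text \<open>Common form of the two actions: renaming the variables of words and left multiplication
  by a permutation (\<open>act_free_eq_pushf\<close>, \<open>grp_mult_single_left\<close>).\<close>

definition pushf :: "('a \<Rightarrow> 'b) \<Rightarrow> ('a \<Rightarrow>\<^sub>0 'k::field) \<Rightarrow> ('b \<Rightarrow>\<^sub>0 'k)"
  where "pushf h f = (\<Sum>w\<in>Poly_Mapping.keys f. Poly_Mapping.single (h w) (Poly_Mapping.lookup f w))"

lemma sum_keys_superset:
  assumes "finite S" "Poly_Mapping.keys f \<subseteq> S" "\<And>w. F w 0 = (0 :: 'b :: comm_monoid_add)"
  shows "(\<Sum>w\<in>Poly_Mapping.keys f. F w (Poly_Mapping.lookup f w)) =
    (\<Sum>w\<in>S. F w (Poly_Mapping.lookup f w))"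
  using assms by (intro sum.mono_neutral_left) (auto simp: in_keys_iff)

lemma pushf_superset:
  assumes "finite S" "Poly_Mapping.keys f \<subseteq> S"
  shows "pushf h f = (\<Sum>w\<in>S. Poly_Mapping.single (h w) (Poly_Mapping.lookup f w))"
  unfolding pushf_def by (rule sum_keys_superset) (use assms in auto)

lemma keys_pscale_subset: "Poly_Mapping.keys (pscale c f) \<subseteq> Poly_Mapping.keys f"
  by (auto simp: in_keys_iff)

lemma pushf_linear:
  fixes h :: "'a \<Rightarrow> 'b"
  shows "Vector_Spaces.linear pscale pscale (pushf h :: ('a \<Rightarrow>\<^sub>0 'k::field) \<Rightarrow> _)"
proof (unfold_locales)
  show "pushf h (f + g) = pushf h f + pushf h g" for f g :: "'a \<Rightarrow>\<^sub>0 'k"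
    using Poly_Mapping.keys_add[of f g]
    by (simp add: pushf_superset[of "Poly_Mapping.keys f \<union> Poly_Mapping.keys g"]
        lookup_add single_add sum.distrib)
  show "pushf h (pscale c f) = pscale c (pushf h f)" for c and f :: "'a \<Rightarrow>\<^sub>0 'k"
    using keys_pscale_subset[of c f]
    by (simp add: pushf_superset[of "Poly_Mapping.keys f"] pm.scale_sum_right)
qed

lemma pushf_single [simp]: "pushf h (Poly_Mapping.single x k) = Poly_Mapping.single (h x) k"
  by (simp add: pushf_def)

interpretation pushf: Vector_Spaces.linear pscale pscale "pushf h :: ('a \<Rightarrow>\<^sub>0 'k::field) \<Rightarrow> ('b \<Rightarrow>\<^sub>0 'k)" for h
  by (rule pushf_linear)

lemma pushf_compose: "pushf h (pushf h' f) = pushf (h \<circ> h') f"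
  by (simp add: pushf_def[of h' f] pushf.sum) (simp add: pushf_def)

lemma act_free_eq_pushf: "act_free g = pushf (map (rename_var g))"
  by (rule ext) (simp add: act_free_def pushf_def)

lemma grp_mult_single_left:
  "grp_mult (Poly_Mapping.single \<sigma> (1::'k::field)) = pushf ((\<circ>) \<sigma>)"
  by (rule ext) (simp add: grp_mult_def pushf_def)

lemma grp_mult_eq:
  assumes "finite S" "Poly_Mapping.keys a \<subseteq> S"
  shows "grp_mult a b = (\<Sum>\<sigma>\<in>S. pscale (Poly_Mapping.lookup a \<sigma>) (pushf ((\<circ>) \<sigma>) b))"
proof -
  have "grp_mult a b = (\<Sum>\<sigma>\<in>Poly_Mapping.keys a. pscale (Poly_Mapping.lookup a \<sigma>) (pushf ((\<circ>) \<sigma>) b))"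
    by (simp add: grp_mult_def pushf_def pm.scale_sum_right)
  also have "\<dots> = (\<Sum>\<sigma>\<in>S. pscale (Poly_Mapping.lookup a \<sigma>) (pushf ((\<circ>) \<sigma>) b))"
    by (rule sum_keys_superset[where F = "\<lambda>\<sigma> k. pscale k (pushf ((\<circ>) \<sigma>) b)"]) (use assms in auto)
  finally show ?thesis .
qed

section \<open>The symmetric group on an initial segment\<close>

lemma finite_Sym [simp]: "finite (Sym n)"
  unfolding Sym_def by (rule finite_permutations) simp

lemma Sym_comp: "\<sigma> \<in> Sym n \<Longrightarrow> \<tau> \<in> Sym n \<Longrightarrow> \<sigma> \<circ> \<tau> \<in> Sym n"
  unfolding Sym_def by (auto intro: permutes_compose)

lemma Sym_inv: "\<sigma> \<in> Sym n \<Longrightarrow> inv \<sigma> \<in> Sym n"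
  unfolding Sym_def by (auto intro: permutes_inv)

lemma Sym_bij: "\<sigma> \<in> Sym n \<Longrightarrow> bij \<sigma>"
  unfolding Sym_def by (auto intro: permutes_bij)

lemma Sym_less_iff [simp]: "\<sigma> \<in> Sym n \<Longrightarrow> \<sigma> k < n \<longleftrightarrow> k < n"
  unfolding Sym_def using permutes_in_image[of \<sigma> "{..<n}" k] by auto

lemma Sym_inj: "\<sigma> \<in> Sym n \<Longrightarrow> \<sigma> x = \<sigma> y \<longleftrightarrow> x = y"
  using Sym_bij bij_is_inj inj_eq by metis

lemma Sym_inv_apply [simp]:
  assumes "\<sigma> \<in> Sym n"
  shows "inv \<sigma> (\<sigma> x) = x" "\<sigma> (inv \<sigma> x) = x"
  using assms unfolding Sym_def by (auto simp: permutes_inverses)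

lemma Sym_inv_comp [simp]:
  assumes "\<sigma> \<in> Sym n"
  shows "inv \<sigma> \<circ> \<sigma> = id" "\<sigma> \<circ> inv \<sigma> = id"
  using assms by (auto simp: fun_eq_iff)

lemma Sym_transpose: "a < n \<Longrightarrow> b < n \<Longrightarrow> transpose a b \<in> Sym n"
  unfolding Sym_def by (auto intro: permutes_swap_id)

lemma Sym_sign_comp: "\<sigma> \<in> Sym n \<Longrightarrow> \<tau> \<in> Sym n \<Longrightarrow> sign (\<sigma> \<circ> \<tau>) = sign \<sigma> * sign \<tau>"
  unfolding Sym_def using permutes_imp_permutation[of "{..<n}"] by (intro sign_compose) auto

lemma id_in_Sym [simp]: "id \<in> Sym n"
  unfolding Sym_def by (simp add: permutes_id)

subsection \<open>Cells of a Young diagram\<close>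

text \<open>Partial sums of the parts are monotone, which turns the \<open>LEAST\<close> in
  \<open>row_of\<close> into a comparison with a single partial sum.\<close>

lemma row_less_iff:
  assumes "k < sum_list l"
  shows "row_of l k < m \<longleftrightarrow> k < sum_list (take m l)"
proof -
  have mono: "sum_list (take i l) \<le> sum_list (take j l)" if "i \<le> j" for i j
  proof -
    have "take j l = take i l @ take (j - i) (drop i l)"
      using that take_add[of i "j - i" l] by simp
    then show ?thesis by simp
  qed
  have ex: "k < sum_list (take (Suc (length l)) l)" using assms by simp
  have P: "k < sum_list (take (Suc (row_of l k)) l)"
    unfolding row_of_def using ex by (rule LeastI)
  show ?thesis
  proof
    assume "row_of l k < m"
    then show "k < sum_list (take m l)"
      using P mono[of "Suc (row_of l k)" m] by simp
  next
    assume a: "k < sum_list (take m l)"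
    then obtain m' where "m = Suc m'" by (cases m) auto
    then show "row_of l k < m" unfolding row_of_def using a by (auto intro: Least_le le_imp_less_Suc)
  qed
qed

lemma row_of_bounds:
  assumes "k < sum_list l"
  shows "row_of l k < length l" "sum_list (take (row_of l k) l) \<le> k"
    "col_of l k < l ! row_of l k" "k = sum_list (take (row_of l k) l) + col_of l k"
proof -
  show 1: "row_of l k < length l" using row_less_iff[OF assms, of "length l"] assms by simp
  show 2: "sum_list (take (row_of l k) l) \<le> k"
    using row_less_iff[OF assms, of "row_of l k"] by simp
  then show 4: "k = sum_list (take (row_of l k) l) + col_of l k" by (simp add: col_of_def)
  have "k < sum_list (take (Suc (row_of l k)) l)"
    using row_less_iff[OF assms, of "Suc (row_of l k)"] by simp
  then show "col_of l k < l ! row_of l k"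
    using 1 4 by (simp add: take_Suc_conv_app_nth)
qed

lemma cell_inj:
  assumes "x < sum_list l" "y < sum_list l" "row_of l x = row_of l y" "col_of l x = col_of l y"
  shows "x = y"
  using assms row_of_bounds(4) by metis

lemma cell_exists:
  assumes "r < length l" "c < l ! r"
  shows "\<exists>x<sum_list l. row_of l x = r \<and> col_of l x = c"
proof -
  define x where "x = sum_list (take r l) + c"
  have "x < sum_list (take (Suc r) l)"
    using assms by (simp add: x_def take_Suc_conv_app_nth)
  moreover have "sum_list l = sum_list (take (Suc r) l) + sum_list (drop (Suc r) l)"
    by (metis append_take_drop_id sum_list_append)
  ultimately have "x < sum_list l" by simp
  moreover have "row_of l x < Suc r" "\<not> row_of l x < r"
    using row_less_iff[OF \<open>x < sum_list l\<close>] \<open>x < sum_list (take (Suc r) l)\<close> by (auto simp: x_def)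
  then have "row_of l x = r" by simp
  moreover have "col_of l x = c" using calculation by (simp add: col_of_def x_def)
  ultimately show ?thesis by blast
qed

lemma card_cells_rows_less:
  "card {x. x < sum_list l \<and> row_of l x < k} = sum_list (take k l)"
proof -
  have "sum_list (take k l) \<le> sum_list l"
    by (metis append_take_drop_id sum_list_append le_add1)
  then have "{x. x < sum_list l \<and> row_of l x < k} = {..<sum_list (take k l)}"
    using row_less_iff by auto
  then show ?thesis by simp
qed

text \<open>Differences of consecutive partial sums are the parts; without zero parts the length is
  determined as well.\<close>

lemma sum_list_take_inject:
  fixes k l :: "nat list"
  assumes "\<And>i. sum_list (take i k) = sum_list (take i l)" "0 \<notin> set k" "0 \<notin> set l"
  shows "k = l"
  using assms
proof (induction k arbitrary: l)
  case Nil
  have "sum_list (take 1 l) = 0" using Nil.prems(1)[of 1] by simp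
  then show ?case using Nil.prems(3) by (cases l) auto
next
  case (Cons x k)
  obtain y l' where l: "l = y # l'"
    using Cons.prems(1)[of 1] Cons.prems(2) by (cases l) auto
  have xy: "x = y" using Cons.prems(1)[of 1] l by simp
  have "sum_list (take i k) = sum_list (take i l')" for i
    using Cons.prems(1)[of "Suc i"] l xy by simp
  then show ?case using Cons.IH[of l'] Cons.prems(2,3) l xy by simp
qed

text \<open>A column of \<open>l'\<close> receives at most \<open>k\<close> entries from the first \<open>k\<close> rows of \<open>l\<close>.\<close>

lemma dominance_of_separated:
  assumes l: "l \<in> partitions n" and l': "l' \<in> partitions n" and f: "f \<in> Sym n"
    and sep: "\<And>x y. x < n \<Longrightarrow> y < n \<Longrightarrow> x \<noteq> y \<Longrightarrow> row_of l x = row_of l y \<Longrightarrow>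
      col_of l' (f x) \<noteq> col_of l' (f y)"
  shows "sum_list (take k l) \<le> sum_list (take k l')"
proof -
  have n: "sum_list l = n" "sum_list l' = n" using l l' by (auto simp: partitions_def)
  let ?A = "\<lambda>c. {x. x < n \<and> row_of l x < k \<and> col_of l' (f x) = c}"
  let ?B = "\<lambda>c. {x. x < n \<and> row_of l' x < k \<and> col_of l' x = c}"
  have colb: "col_of l' x < n" if "x < n" for x
    using row_of_bounds(4)[of x l'] that n by linarith
  have le: "card (?A c) \<le> card (?B c)" for c
  \<comment> \<open>If column \<open>c\<close> of \<open>l'\<close> ends within the first
    \<open>k\<close> rows, \<open>f\<close> injects all of \<open>?A c\<close> into it. Otherwise
    the column has a cell in each of these rows, while separation allows at most one entry from each
    of the first \<open>k\<close> rows of \<open>l\<close>.\<close>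
  proof (cases "\<forall>x<n. col_of l' x = c \<longrightarrow> row_of l' x < k")
    case True
    then have "f ` ?A c \<subseteq> ?B c" using f by auto
    moreover have "inj_on f (?A c)" using Sym_inj[OF f] by (auto intro: inj_onI)
    ultimately show ?thesis by (intro card_inj_on_le[of f]) auto
  next
    case False
    then obtain x0 where x0: "x0 < n" "col_of l' x0 = c" "\<not> row_of l' x0 < k" by auto
    have "inj_on (row_of l) (?A c)" using sep unfolding inj_on_def by blast
    then have "card (?A c) \<le> card {..<k}" by (rule card_inj_on_le) auto
    moreover have "{..<k} \<subseteq> row_of l' ` ?B c"
    proof
      fix r assume "r \<in> {..<k}"
      then have r: "r < k" by simp
      then have "r < row_of l' x0" using x0 by simp
      moreover have b: "row_of l' x0 < length l'" "c < l' ! row_of l' x0"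
        using row_of_bounds[of x0 l'] x0 n by auto
      moreover have "l' ! row_of l' x0 \<le> l' ! r"
        using l' calculation by (auto simp: partitions_def sorted_wrt_iff_nth_less)
      ultimately obtain x where "x < n" "row_of l' x = r" "col_of l' x = c"
        using cell_exists[of r l' c] n by auto
      then show "r \<in> row_of l' ` ?B c" using r by auto
    qed
    then have "card {..<k} \<le> card (?B c)" by (rule surj_card_le[rotated]) simp
    ultimately show ?thesis by simp
  qed
  have "{x. x < n \<and> row_of l x < k} = (\<Union>c<n. ?A c)"
    using colb Sym_less_iff[OF f] by auto
  moreover have "card (\<Union>c<n. ?A c) = (\<Sum>c<n. card (?A c))"
    by (rule card_UN_disjoint) auto
  ultimately have "card {x. x < n \<and> row_of l x < k} = (\<Sum>c<n. card (?A c))"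
    by (simp only:)
  also have "\<dots> \<le> (\<Sum>c<n. card (?B c))" by (intro sum_mono le)
  also have "\<dots> = card (\<Union>c<n. ?B c)" by (rule card_UN_disjoint[symmetric]) auto
  also have "(\<Union>c<n. ?B c) = {x. x < n \<and> row_of l' x < k}" using colb by auto
  finally show ?thesis using card_cells_rows_less[of l k] card_cells_rows_less[of l' k] n by simp
qed

subsection \<open>The irreducible modules\<close>

lemma row_stab_Sym: "\<sigma> \<in> row_stab l \<Longrightarrow> \<sigma> \<in> Sym (sum_list l)"
  and col_stab_Sym: "\<sigma> \<in> col_stab l \<Longrightarrow> \<sigma> \<in> Sym (sum_list l)"
  by (simp_all add: row_stab_def col_stab_def)

lemma finite_stab [simp]: "finite (row_stab l)" "finite (col_stab l)"
  unfolding row_stab_def col_stab_def by auto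

lemma row_stab_comp: "\<sigma> \<in> row_stab l \<Longrightarrow> \<tau> \<in> row_stab l \<Longrightarrow> \<sigma> \<circ> \<tau> \<in> row_stab l"
  and col_stab_comp: "\<sigma> \<in> col_stab l \<Longrightarrow> \<tau> \<in> col_stab l \<Longrightarrow> \<sigma> \<circ> \<tau> \<in> col_stab l"
  by (auto simp: row_stab_def col_stab_def Sym_comp)

lemma row_stab_inv: "\<sigma> \<in> row_stab l \<Longrightarrow> inv \<sigma> \<in> row_stab l"
  and col_stab_inv: "\<sigma> \<in> col_stab l \<Longrightarrow> inv \<sigma> \<in> col_stab l"
  unfolding row_stab_def col_stab_def mem_Collect_eq
  by (metis Sym_inv Sym_inv_apply(2) Sym_less_iff)+

lemma id_in_stab [simp]: "id \<in> row_stab l" "id \<in> col_stab l"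
  by (auto simp: row_stab_def col_stab_def)

lemma stab_comp_bij:
  assumes "\<sigma> \<in> row_stab l" "\<tau> \<in> col_stab l"
  shows "bij_betw (\<lambda>\<rho>. \<rho> \<circ> \<sigma>) (row_stab l) (row_stab l)"
    "bij_betw (\<lambda>\<rho>. \<sigma> \<circ> \<rho>) (row_stab l) (row_stab l)"
    "bij_betw (\<lambda>\<rho>. \<tau> \<circ> \<rho>) (col_stab l) (col_stab l)"
proof -
  have \<sigma>: "\<sigma> \<in> Sym (sum_list l)" and \<tau>: "\<tau> \<in> Sym (sum_list l)"
    using assms row_stab_Sym col_stab_Sym by auto
  show "bij_betw (\<lambda>\<rho>. \<rho> \<circ> \<sigma>) (row_stab l) (row_stab l)"
    by (rule bij_betw_byWitness[where f' = "\<lambda>\<rho>. \<rho> \<circ> inv \<sigma>"])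
      (use assms \<sigma> in \<open>auto simp: row_stab_comp row_stab_inv comp_assoc\<close>)
  show "bij_betw (\<lambda>\<rho>. \<sigma> \<circ> \<rho>) (row_stab l) (row_stab l)"
    by (rule bij_betw_byWitness[where f' = "\<lambda>\<rho>. inv \<sigma> \<circ> \<rho>"])
      (use assms \<sigma> in \<open>auto simp: row_stab_comp row_stab_inv comp_assoc[symmetric]\<close>)
  show "bij_betw (\<lambda>\<rho>. \<tau> \<circ> \<rho>) (col_stab l) (col_stab l)"
    by (rule bij_betw_byWitness[where f' = "\<lambda>\<rho>. inv \<tau> \<circ> \<rho>"])
      (use assms \<tau> in \<open>auto simp: col_stab_comp col_stab_inv comp_assoc[symmetric]\<close>)
qed

text \<open>Shows at once that the left ideal is a subspace of finite dimension, and reduces claims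
  about it to translates of the Young symmetrizer.\<close>

lemma irr_module_eq_span:
  fixes l :: "nat list"
  defines "c \<equiv> (young_symmetrizer l :: (nat \<Rightarrow> nat) \<Rightarrow>\<^sub>0 'k::field)"
  shows "irr_module l = pm.span ((\<lambda>\<sigma>. pushf ((\<circ>) \<sigma>) c) ` Sym (sum_list l))"
proof (intro equalityI subsetI)
  let ?n = "sum_list l"
  fix u :: "(nat \<Rightarrow> nat) \<Rightarrow>\<^sub>0 'k"
  assume "u \<in> irr_module l"
  then obtain a where a: "a \<in> grp_alg ?n" "u = grp_mult a c"
    unfolding irr_module_def c_def by auto
  then have "u = (\<Sum>\<sigma>\<in>Sym ?n. pscale (Poly_Mapping.lookup a \<sigma>) (pushf ((\<circ>) \<sigma>) c))"
    using grp_mult_eq[of "Sym ?n" a c] by (simp add: grp_alg_def)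
  then show "u \<in> pm.span ((\<lambda>\<sigma>. pushf ((\<circ>) \<sigma>) c) ` Sym ?n)"
    by (auto intro!: pm.span_sum pm.span_scale intro: pm.span_base)
next
  let ?n = "sum_list l"
  have mem: "(\<Sum>\<sigma>\<in>Sym ?n. pscale (k \<sigma>) (pushf ((\<circ>) \<sigma>) c)) \<in> irr_module l" for k
  proof -
    define a where "a = (\<Sum>\<sigma>\<in>Sym ?n. Poly_Mapping.single \<sigma> (k \<sigma>))"
    have lk: "Poly_Mapping.lookup a \<tau> = (if \<tau> \<in> Sym ?n then k \<tau> else 0)" for \<tau>
      by (simp add: a_def lookup_sum lookup_single when_def)
    then have sub: "Poly_Mapping.keys a \<subseteq> Sym ?n"
      by (auto simp: in_keys_iff split: if_splits)
    have "grp_mult a c = (\<Sum>\<sigma>\<in>Sym ?n. pscale (k \<sigma>) (pushf ((\<circ>) \<sigma>) c))"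
      using sub by (subst grp_mult_eq[of "Sym ?n"]) (auto simp: lk)
    then show ?thesis using sub unfolding irr_module_def grp_alg_def c_def by auto metis
  qed
  fix u :: "(nat \<Rightarrow> nat) \<Rightarrow>\<^sub>0 'k"
  assume "u \<in> pm.span ((\<lambda>\<sigma>. pushf ((\<circ>) \<sigma>) c) ` Sym ?n)"
  then show "u \<in> irr_module l"
  proof (induction rule: pm.span_induct_alt)
    case base
    show ?case using mem[of "\<lambda>_. 0"] by simp
  next
    case (step k x y)
    then obtain \<sigma> where \<sigma>: "\<sigma> \<in> Sym ?n" "x = pushf ((\<circ>) \<sigma>) c" by auto
    obtain a where a: "a \<in> grp_alg ?n" "y = grp_mult a c"
      using step unfolding irr_module_def c_def by auto
    have "pscale k x + y = (\<Sum>\<tau>\<in>Sym ?n. pscale (if \<tau> = \<sigma> then k else 0) (pushf ((\<circ>) \<tau>) c)) +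
        (\<Sum>\<tau>\<in>Sym ?n. pscale (Poly_Mapping.lookup a \<tau>) (pushf ((\<circ>) \<tau>) c))"
    proof -
      have "(\<Sum>\<tau>\<in>Sym ?n. pscale (if \<tau> = \<sigma> then k else 0) (pushf ((\<circ>) \<tau>) c)) =
          (\<Sum>\<tau>\<in>Sym ?n. if \<tau> = \<sigma> then pscale k x else 0)"
        using \<sigma> by (intro sum.cong) auto
      then show ?thesis
        using a \<sigma> grp_mult_eq[of "Sym ?n" a c] by (simp add: grp_alg_def)
    qed
    also have "\<dots> = (\<Sum>\<tau>\<in>Sym ?n. pscale ((if \<tau> = \<sigma> then k else 0) + Poly_Mapping.lookup a \<tau>)
        (pushf ((\<circ>) \<tau>) c))"
      by (simp add: pm.scale_left_distrib sum.distrib)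
    finally show ?case using mem by simp
  qed
qed

lemma irr_module_subspace: "pm.subspace (irr_module l)"
  by (simp add: irr_module_eq_span)

lemma irr_module_generator: "\<sigma> \<in> Sym (sum_list l) \<Longrightarrow> pushf ((\<circ>) \<sigma>) (young_symmetrizer l) \<in> irr_module l"
  by (auto simp: irr_module_eq_span intro: pm.span_base)

lemma pushf_id [simp]: "pushf id u = u"
  by (rule poly_mapping_eqI) (simp add: pushf_def lookup_sum lookup_single when_def in_keys_iff)

lemma comp_section_id [simp]: "(\<circ>) id = id"
  by (simp add: fun_eq_iff)

lemma comp_section_comp: "(\<circ>) \<sigma> \<circ> (\<circ>) \<tau> = (\<circ>) (\<sigma> \<circ> \<tau>)"
  by (simp add: fun_eq_iff)

lemma irr_module_closed:
  assumes "\<sigma> \<in> Sym (sum_list l)" "u \<in> irr_module l"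
  shows "pushf ((\<circ>) \<sigma>) u \<in> irr_module l"
proof -
  let ?G = "(\<lambda>\<sigma>. pushf ((\<circ>) \<sigma>) (young_symmetrizer l)) ` Sym (sum_list l)"
  have "pushf ((\<circ>) \<sigma>) ` ?G \<subseteq> irr_module l"
  proof clarify
    fix \<tau> assume "\<tau> \<in> Sym (sum_list l)"
    then show "pushf ((\<circ>) \<sigma>) (pushf ((\<circ>) \<tau>) (young_symmetrizer l)) \<in> irr_module l"
      using irr_module_generator[OF Sym_comp[OF assms(1)]]
      by (simp add: pushf_compose comp_section_comp)
  qed
  then have "pm.span (pushf ((\<circ>) \<sigma>) ` ?G) \<subseteq> irr_module l"
    by (intro pm.span_minimal irr_module_subspace)
  then show ?thesis
    using assms(2) by (auto simp: pushf.span_image irr_module_eq_span)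
qed

lemma irr_module_basis: "\<exists>B. quot_basis (irr_module l) {0} B"
proof (rule quot_basis_exists[OF irr_module_subspace])
  let ?G = "(\<lambda>\<sigma>. pushf ((\<circ>) \<sigma>) (young_symmetrizer l)) ` Sym (sum_list l)"
  show "?G \<subseteq> irr_module l" by (auto intro: irr_module_generator)
  show "irr_module l \<subseteq> pm.span (?G \<union> {0})" by (simp add: irr_module_eq_span)
qed (use pm.subspace_0[OF irr_module_subspace] in auto)

lemma irr_char_eq: "irr_char l \<sigma> = quot_trace (irr_module l) {0} (pushf ((\<circ>) \<sigma>))"
  unfolding irr_char_def by (simp add: grp_mult_single_left)

section \<open>Sums of characters over row stabilisers\<close>

definition row_sum :: "nat list \<Rightarrow> ((nat \<Rightarrow> nat) \<Rightarrow>\<^sub>0 'k::field) \<Rightarrow> ((nat \<Rightarrow> nat) \<Rightarrow>\<^sub>0 'k)"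
  where "row_sum l u = (\<Sum>r\<in>row_stab l. pushf ((\<circ>) r) u)"

lemma row_sum_linear:
  "Vector_Spaces.linear pscale pscale (row_sum l :: ((nat \<Rightarrow> nat) \<Rightarrow>\<^sub>0 'k::field) \<Rightarrow> _)"
proof unfold_locales
  show "row_sum l (f + g) = row_sum l f + row_sum l g" for f g :: "(nat \<Rightarrow> nat) \<Rightarrow>\<^sub>0 'k"
    by (simp add: row_sum_def pushf.add sum.distrib)
  show "row_sum l (pscale c f) = pscale c (row_sum l f)" for c and f :: "(nat \<Rightarrow> nat) \<Rightarrow>\<^sub>0 'k"
    by (simp add: row_sum_def pushf.scale pm.scale_sum_right)
qed

text \<open>Collects the character values into one trace, that of left multiplication by the sum of
  a row stabiliser. This operator is a multiple of a projection, so its trace can be tested for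
  zero.\<close>

lemma sum_irr_char_row_stab:
  assumes "sum_list l = sum_list l'"
  shows "(\<Sum>r\<in>row_stab l'. irr_char l r) = quot_trace (irr_module l) {0} (row_sum l')"
  unfolding irr_char_eq row_sum_def
  using irr_module_basis irr_module_subspace assms row_stab_Sym
  by (intro quot_trace_sum irr_module_closed) auto

lemma eq_uminus_imp_zero:
  fixes u :: "'a \<Rightarrow>\<^sub>0 'k::field_char_0"
  assumes "u = - u"
  shows "u = 0"
proof (rule poly_mapping_eqI)
  fix x
  have "Poly_Mapping.lookup u x = - Poly_Mapping.lookup u x"
    by (subst assms) simp
  then show "Poly_Mapping.lookup u x = Poly_Mapping.lookup 0 x" by simp
qed

text \<open>A transposition that lies in the row stabiliser and, after conjugation, in the column stabiliser
  changes the sign of the sum.\<close>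

lemma row_col_sum_vanishes:
  fixes l l' :: "nat list"
  assumes "l \<in> partitions n" "l' \<in> partitions n" "y \<in> Sym n"
    and "\<not> (\<forall>k. sum_list (take k l') \<le> sum_list (take k l))"
  shows "(\<Sum>r\<in>row_stab l'. \<Sum>\<tau>\<in>col_stab l.
    Poly_Mapping.single (r \<circ> y \<circ> \<tau>) (of_int (sign \<tau>) :: 'k::field_char_0)) = 0" (is "?S = 0")
proof -
  have n: "sum_list l = n" "sum_list l' = n" using assms by (auto simp: partitions_def)
  \<comment> \<open>By contraposition of \<open>dominance_of_separated\<close> for
    \<open>inv y\<close>: some row of \<open>l'\<close> has two entries whose preimages under
    \<open>y\<close> share a column of \<open>l\<close>.\<close>
  obtain a b where ab: "a < n" "b < n" "a \<noteq> b" "row_of l' a = row_of l' b"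
    "col_of l (inv y a) = col_of l (inv y b)"
    using dominance_of_separated[OF assms(2,1) Sym_inv[OF assms(3)]] assms(4) by blast
  define s where "s = transpose a b"
  define t where "t = transpose (inv y a) (inv y b)"
  have s: "s \<in> row_stab l'"
    unfolding row_stab_def mem_Collect_eq s_def
    using ab(4) n Sym_transpose[OF ab(1,2)] by (simp add: transpose_def)
  have t: "t \<in> col_stab l"
    unfolding col_stab_def mem_Collect_eq t_def
    using ab(1,2,5) n Sym_transpose[of "inv y a" n "inv y b"] Sym_inv[OF assms(3)]
    by (simp add: transpose_def)
  have sy: "s \<circ> y = y \<circ> t"
  proof
    fix x
    have "y x = z \<longleftrightarrow> x = inv y z" for z
      using Sym_inv_apply[OF assms(3)] by auto
    then show "(s \<circ> y) x = (y \<circ> t) x"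
      using assms(3) by (simp add: s_def t_def transpose_def)
  qed
  have tt: "t \<circ> t = id" by (simp add: t_def)
  have "inv y a \<noteq> inv y b" using ab Sym_inj[OF Sym_inv[OF assms(3)]] by simp
  then have sgn: "sign (t \<circ> \<tau>) = - sign \<tau>" if "\<tau> \<in> col_stab l" for \<tau>
    using Sym_sign_comp[OF col_stab_Sym[OF t] col_stab_Sym[OF that]]
    by (simp add: t_def sign_swap_id)
  have "?S = (\<Sum>r\<in>row_stab l'. \<Sum>\<tau>\<in>col_stab l.
      Poly_Mapping.single (r \<circ> s \<circ> y \<circ> \<tau>) (of_int (sign \<tau>)))"
    by (rule sum.reindex_bij_betw[OF stab_comp_bij(1)[OF s id_in_stab(2)], symmetric])
  also have "\<dots> = (\<Sum>r\<in>row_stab l'. \<Sum>\<tau>\<in>col_stab l.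
      Poly_Mapping.single (r \<circ> s \<circ> y \<circ> (t \<circ> \<tau>)) (of_int (sign (t \<circ> \<tau>))))"
    by (rule sum.cong[OF refl], rule sum.reindex_bij_betw[OF stab_comp_bij(3)[OF id_in_stab(1) t], symmetric])
  also have "\<dots> = (\<Sum>r\<in>row_stab l'. \<Sum>\<tau>\<in>col_stab l.
      - Poly_Mapping.single (r \<circ> y \<circ> \<tau>) (of_int (sign \<tau>)))"
  proof (intro sum.cong refl)
    fix r \<tau> :: "nat \<Rightarrow> nat" assume \<tau>: "\<tau> \<in> col_stab l"
    have "r \<circ> s \<circ> y \<circ> (t \<circ> \<tau>) = r \<circ> (s \<circ> y) \<circ> t \<circ> \<tau>" by (simp only: comp_assoc)
    also have "\<dots> = r \<circ> y \<circ> (t \<circ> t) \<circ> \<tau>" unfolding sy by (simp only: comp_assoc)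
    also have "\<dots> = r \<circ> y \<circ> \<tau>" unfolding tt by (simp only: comp_id)
    finally have "r \<circ> s \<circ> y \<circ> (t \<circ> \<tau>) = r \<circ> y \<circ> \<tau>" .
    then show "Poly_Mapping.single (r \<circ> s \<circ> y \<circ> (t \<circ> \<tau>)) (of_int (sign (t \<circ> \<tau>))) =
      - Poly_Mapping.single (r \<circ> y \<circ> \<tau>) (of_int (sign \<tau>) :: 'k)"
      by (simp only: sgn[OF \<tau>] of_int_minus single_uminus)
  qed
  also have "\<dots> = - ?S" by (simp add: sum_negf)
  finally show ?thesis by (rule eq_uminus_imp_zero)
qed

text \<open>On a translate by \<open>h\<close>, splitting off each row permutation \<sigma> of the
  Young symmetrizer leaves the double sum of \<open>row_col_sum_vanishes\<close> with
  \<open>y = h \<circ> \<sigma>\<close>.\<close>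

lemma row_sum_irr_module_zero:
  assumes l: "l \<in> partitions n" "l' \<in> partitions n"
    and nd: "\<not> (\<forall>k. sum_list (take k l') \<le> sum_list (take k l))"
    and u: "u \<in> irr_module l"
  shows "row_sum l' u = (0 :: (nat \<Rightarrow> nat) \<Rightarrow>\<^sub>0 'k::field_char_0)"
proof -
  have n: "sum_list l = n" "sum_list l' = n" using l by (auto simp: partitions_def)
  interpret R: Vector_Spaces.linear pscale pscale "row_sum l' :: _ \<Rightarrow> ((nat \<Rightarrow> nat) \<Rightarrow>\<^sub>0 'k)"
    by (rule row_sum_linear)
  have gen: "row_sum l' (pushf ((\<circ>) h) (young_symmetrizer l)) = (0 :: (nat \<Rightarrow> nat) \<Rightarrow>\<^sub>0 'k)"
    if h: "h \<in> Sym n" for h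
  proof -
    have "row_sum l' (pushf ((\<circ>) h) (young_symmetrizer l)) =
        (\<Sum>r\<in>row_stab l'. \<Sum>\<sigma>\<in>row_stab l. \<Sum>\<tau>\<in>col_stab l.
          Poly_Mapping.single (r \<circ> (h \<circ> \<sigma>) \<circ> \<tau>) (of_int (sign \<tau>) :: 'k))"
      by (simp add: row_sum_def young_symmetrizer_def pushf.sum comp_assoc)
    also have "\<dots> = (\<Sum>\<sigma>\<in>row_stab l. \<Sum>r\<in>row_stab l'. \<Sum>\<tau>\<in>col_stab l.
          Poly_Mapping.single (r \<circ> (h \<circ> \<sigma>) \<circ> \<tau>) (of_int (sign \<tau>) :: 'k))"
      by (rule sum.swap)
    also have "\<dots> = 0"
      using row_stab_Sym[of _ l] n h by (intro sum.neutral ballI row_col_sum_vanishes[OF l _ nd] Sym_comp) auto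
    finally show ?thesis .
  qed
  show ?thesis
    using u unfolding irr_module_eq_span
    by (rule R.eq_0_on_span[rotated]) (use gen n in auto)
qed

lemma row_sum_row_stab_invariant:
  assumes "r \<in> row_stab l"
  shows "pushf ((\<circ>) r) (row_sum l u) = row_sum l u"
proof -
  have "pushf ((\<circ>) r) (row_sum l u) = (\<Sum>s\<in>row_stab l. pushf ((\<circ>) (r \<circ> s)) u)"
    by (simp add: row_sum_def pushf.sum pushf_compose comp_section_comp)
  also have "\<dots> = row_sum l u"
    unfolding row_sum_def
    by (rule sum.reindex_bij_betw[OF stab_comp_bij(2)[OF assms id_in_stab(2)]])
  finally show ?thesis .
qed

text \<open>The row permutations are the left factors in the Young symmetrizer, so multiplying by
  one of them from the left only permutes the terms.\<close>

lemma row_sum_young_symmetrizer: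
  "row_sum l (young_symmetrizer l) = pscale (of_nat (card (row_stab l))) (young_symmetrizer l)"
proof -
  have "pushf ((\<circ>) r) (young_symmetrizer l) = young_symmetrizer l" if r: "r \<in> row_stab l" for r
  proof -
    have "pushf ((\<circ>) r) (young_symmetrizer l) = (\<Sum>\<sigma>\<in>row_stab l. \<Sum>\<tau>\<in>col_stab l.
        Poly_Mapping.single ((r \<circ> \<sigma>) \<circ> \<tau>) (of_int (sign \<tau>)))"
      by (simp add: young_symmetrizer_def pushf.sum comp_assoc)
    also have "\<dots> = young_symmetrizer l"
      unfolding young_symmetrizer_def
      by (rule sum.reindex_bij_betw[OF stab_comp_bij(2)[OF r id_in_stab(2)]])
    finally show ?thesis .
  qed
  then have "row_sum l (young_symmetrizer l) = (\<Sum>r\<in>row_stab l. young_symmetrizer l)"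
    unfolding row_sum_def by (intro sum.cong) auto
  also have "\<dots> = pscale (of_nat (card (row_stab l))) (young_symmetrizer l)"
    by (rule poly_mapping_eqI) (simp add: lookup_sum)
  finally show ?thesis .
qed

lemma row_col_stab_trivial:
  assumes "\<sigma> \<in> row_stab l" "\<sigma> \<in> col_stab l"
  shows "\<sigma> = id"
proof
  fix x
  show "\<sigma> x = id x"
  proof (cases "x < sum_list l")
    case True
    then show ?thesis
      using assms cell_inj[of "\<sigma> x" l x] by (auto simp: row_stab_def col_stab_def)
  next
    case False
    then show ?thesis
      using assms by (auto simp: row_stab_def Sym_def dest: permutes_not_in)
  qed
qed

text \<open>Row and column stabiliser meet in the identity only, so just one pair of factors
  multiplies to the identity. This is how the Young symmetrizer is seen to be nonzero.\<close>

lemma young_symmetrizer_id: "Poly_Mapping.lookup (young_symmetrizer l) id = (1 :: 'k::field)"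
proof -
  have eq: "\<sigma> \<circ> \<tau> = id \<longleftrightarrow> \<sigma> = id \<and> \<tau> = id" if "\<sigma> \<in> row_stab l" "\<tau> \<in> col_stab l" for \<sigma> \<tau>
  proof
    assume a: "\<sigma> \<circ> \<tau> = id"
    have "inv \<sigma> = inv \<sigma> \<circ> (\<sigma> \<circ> \<tau>)" using a by simp
    also have "\<dots> = \<tau>" using row_stab_Sym[OF that(1)] by (simp add: comp_assoc[symmetric])
    finally have "\<tau> \<in> row_stab l" using row_stab_inv[OF that(1)] by simp
    then have "\<tau> = id" using that row_col_stab_trivial by blast
    then show "\<sigma> = id \<and> \<tau> = id" using a by simp
  qed simp
  have "Poly_Mapping.lookup (young_symmetrizer l) id =
      (\<Sum>\<sigma>\<in>row_stab l. \<Sum>\<tau>\<in>col_stab l. if \<sigma> = id \<and> \<tau> = id then 1 else 0 :: 'k)"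
    unfolding young_symmetrizer_def lookup_sum lookup_single when_def
    using eq by (intro sum.cong refl) (auto simp: sign_id)
  also have "\<dots> = (\<Sum>\<sigma>\<in>row_stab l. if \<sigma> = id then 1 else 0)"
    by (intro sum.cong refl) auto
  also have "\<dots> = 1" by simp
  finally show ?thesis .
qed

text \<open>\<open>row_sum l\<close> is quasi-idempotent with factor \<kappa> the order of the row
  stabiliser, and it does not kill the Young symmetrizer. These are the diagonal entries of the
  triangular matrix.\<close>

lemma sum_irr_char_row_stab_nonzero:
  "(\<Sum>r\<in>row_stab l. irr_char l r) \<noteq> (0 :: 'k::field_char_0)"
proof -
  let ?c = "young_symmetrizer l :: (nat \<Rightarrow> nat) \<Rightarrow>\<^sub>0 'k"
  have card: "card (row_stab l) \<noteq> 0"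
    using id_in_stab(1)[of l] finite_stab(1)[of l] card_gt_0_iff by blast
  have "quot_trace (irr_module l) {0} (row_sum l) \<noteq> (0 :: 'k)"
  proof (rule quot_trace_quasi_idempotent[OF irr_module_subspace, where
        F = "(\<lambda>\<sigma>. pushf ((\<circ>) \<sigma>) ?c) ` Sym (sum_list l)" and \<kappa> = "of_nat (card (row_stab l))" and v = ?c])
    show "row_sum l (row_sum l u) = pscale (of_nat (card (row_stab l))) (row_sum l u)"
      for u :: "(nat \<Rightarrow> nat) \<Rightarrow>\<^sub>0 'k"
    proof -
      have "row_sum l (row_sum l u) = (\<Sum>r\<in>row_stab l. row_sum l u)"
        by (subst row_sum_def) (simp add: row_sum_row_stab_invariant)
      then show ?thesis by (simp add: poly_mapping_eq_iff fun_eq_iff lookup_sum)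
    qed
    show "?c \<in> irr_module l" using irr_module_generator[of id l] by simp
    show "row_sum l ?c \<noteq> 0"
    proof
      assume "row_sum l ?c = 0"
      then have "Poly_Mapping.lookup (row_sum l ?c) id = 0" by simp
      then show False using card by (simp add: row_sum_young_symmetrizer young_symmetrizer_id)
    qed
    show "row_sum l u \<in> irr_module l" if "u \<in> irr_module l" for u :: "(nat \<Rightarrow> nat) \<Rightarrow>\<^sub>0 'k"
      unfolding row_sum_def using that row_stab_Sym
      by (intro pm.subspace_sum irr_module_subspace irr_module_closed) auto
  qed (use card in \<open>auto simp: row_sum_linear irr_module_eq_span intro: pm.span_base\<close>)
  then show ?thesis by (simp add: sum_irr_char_row_stab)
qed

lemma sum_irr_char_row_stab_zero:
  assumes l: "l \<in> partitions n" "l' \<in> partitions n"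
    and nd: "\<not> (\<forall>k. sum_list (take k l') \<le> sum_list (take k l))"
  shows "(\<Sum>r\<in>row_stab l'. irr_char l r) = (0 :: 'k::field_char_0)"
proof -
  have n: "sum_list l = sum_list l'" using l by (auto simp: partitions_def)
  \<comment> \<open>The operator vanishes on the module, so it factors through the empty index
    set.\<close>
  have "quot_trace (irr_module l) {0} (row_sum l') =
      (\<Sum>x\<in>{}. (\<lambda>_ _. 0) x ((\<lambda>_. 0) x) :: 'k)"
    using row_sum_irr_module_zero[OF l nd] irr_module_basis irr_module_subspace
    by (intro quot_trace_factor) (auto simp: pm.subspace_0[OF irr_module_subspace])
  then show ?thesis by (simp add: sum_irr_char_row_stab[OF n])
qed

lemma finite_partitions [simp]: "finite (partitions n)"
proof (rule finite_subset)
  show "partitions n \<subseteq> {l. set l \<subseteq> {..n} \<and> length l \<le> n}"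
  proof clarify
    fix l assume "l \<in> partitions n"
    then have l: "0 \<notin> set l" "sum_list l = n" by (auto simp: partitions_def)
    have "length l \<le> sum_list l" using l(1) by (induction l) auto
    then show "set l \<subseteq> {..n} \<and> length l \<le> n" using l(2) member_le_sum_list by force
  qed
qed (simp add: finite_lists_length_le)

text \<open>Among the partitions with nonzero coefficient take \<open>m\<close> with
  \<open>M m\<close> maximal and sum the relation over the row stabiliser of \<open>m\<close>. A
  term that survives belongs to a partition dominating \<open>m\<close>, hence by maximality to
  \<open>m\<close> itself.\<close>

lemma irr_char_independent:
  fixes d :: "nat list \<Rightarrow> 'k::field_char_0"
  assumes "\<And>g. g \<in> Sym n \<Longrightarrow> (\<Sum>l\<in>partitions n. d l * irr_char l g) = 0"
    and "l \<in> partitions n"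
  shows "d l = 0"
proof -
  \<comment> \<open>\<open>M\<close> grows strictly along the dominance order. Partial sums beyond
    \<open>n\<close> carry no information, since a partition of \<open>n\<close> has at most
    \<open>n\<close> parts.\<close>
  define M where "M l = (\<Sum>k\<le>n. sum_list (take k l))" for l :: "nat list"
  have M: "l = l'" if l: "l \<in> partitions n" "l' \<in> partitions n" and "M l \<le> M l'"
    and dom: "\<And>k. sum_list (take k l') \<le> sum_list (take k l)" for l l'
  proof (rule sum_list_take_inject)
    fix i
    have "M l = M l'" using that sum_mono[of "{..n}" "\<lambda>k. sum_list (take k l')"] unfolding M_def by (meson le_antisym)
    then have eq: "sum_list (take k l') = sum_list (take k l)" if "k \<le> n" for k
      using sum_mono_inv[of "\<lambda>k. sum_list (take k l')" "{..n}" "\<lambda>k. sum_list (take k l)" k] dom that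
      unfolding M_def by auto
    have len: "length l \<le> n" if "l \<in> partitions n" for l
    proof -
      have "length l \<le> sum_list l" if "0 \<notin> set l" using that by (induction l) auto
      then show ?thesis using that by (auto simp: partitions_def)
    qed
    show "sum_list (take i l) = sum_list (take i l')"
      using eq[of i] len[OF l(1)] len[OF l(2)] l by (cases "i \<le> n") (auto simp: partitions_def)
  qed (use l in \<open>auto simp: partitions_def\<close>)
  let ?D = "{l \<in> partitions n. d l \<noteq> 0}"
  have "?D = {}"
  proof (rule ccontr)
    assume ne: "?D \<noteq> {}"
    have "Max (M ` ?D) \<in> M ` ?D" using ne by (intro Max_in) auto
    then obtain m where m: "m \<in> ?D" "M m = Max (M ` ?D)" by auto
    have max: "M l \<le> M m" if "l \<in> ?D" for l using that m(2) by simp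
    have "0 = (\<Sum>r\<in>row_stab m. \<Sum>l\<in>partitions n. d l * irr_char l r)"
      using assms(1) row_stab_Sym[of _ m] m by (intro sum.neutral[symmetric]) (auto simp: partitions_def)
    also have "\<dots> = (\<Sum>l\<in>partitions n. d l * (\<Sum>r\<in>row_stab m. irr_char l r))"
      by (subst sum.swap) (simp add: sum_distrib_left)
    also have "\<dots> = (\<Sum>l\<in>partitions n. if l = m then d m * (\<Sum>r\<in>row_stab m. irr_char m r) else 0)"
    proof (intro sum.cong refl)
      fix l assume l: "l \<in> partitions n"
      show "d l * (\<Sum>r\<in>row_stab m. irr_char l r) =
          (if l = m then d m * (\<Sum>r\<in>row_stab m. irr_char m r) else 0)"
      proof (cases "l = m \<or> d l = 0")
        case True
        then show ?thesis using m by auto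
      next
        case False
        then have "\<not> (\<forall>k. sum_list (take k m) \<le> sum_list (take k l))"
          using M[OF l, of m] m max[of l] l by auto
        then show ?thesis
          using sum_irr_char_row_stab_zero[OF l, of m] m False by auto
      qed
    qed
    also have "\<dots> = d m * (\<Sum>r\<in>row_stab m. irr_char m r)" using m by simp
    finally show False using m sum_irr_char_row_stab_nonzero[of m] by auto
  qed
  then show ?thesis using assms(2) by blast
qed

subsection \<open>Harmonic functions on subsets\<close>

definition ksub :: "nat \<Rightarrow> nat \<Rightarrow> nat set set"
  where "ksub n j = {X. X \<subseteq> {..<n} \<and> card X = j}"

text \<open>Writing \<open>Suc (card Y) = j\<close> instead of using a predecessor makes the
  condition void for \<open>j = 0\<close>; the constants are then harmonic, as the one-row case
  requires.\<close>

definition harmonic :: "nat \<Rightarrow> nat \<Rightarrow> (nat set \<Rightarrow> 'k::field) \<Rightarrow> bool"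
  where "harmonic n j f \<longleftrightarrow>
    (\<forall>Y. Y \<subseteq> {..<n} \<and> Suc (card Y) = j \<longrightarrow> (\<Sum>x\<in>{..<n} - Y. f (insert x Y)) = 0)"

lemma finite_ksub [simp]: "finite (ksub n j)"
  unfolding ksub_def by (rule finite_subset[of _ "Pow {..<n}"]) auto

lemma ksub_image [simp]:
  assumes "\<sigma> \<in> Sym n" "X \<in> ksub n j"
  shows "\<sigma> ` X \<in> ksub n j"
  using assms Sym_bij[OF assms(1)] card_image[of \<sigma> X]
  by (auto simp: ksub_def bij_def intro: inj_on_subset)

lemma Sym_image_lessThan: "\<sigma> \<in> Sym n \<Longrightarrow> \<sigma> ` {..<n} = {..<n}"
  unfolding Sym_def using permutes_image[of \<sigma> "{..<n}"] by simp

lemma Sym_image_Diff: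
  assumes "\<sigma> \<in> Sym n"
  shows "{..<n} - \<sigma> ` Y = \<sigma> ` ({..<n} - Y)"
  using Sym_image_lessThan[OF assms] Sym_bij[OF assms] by (metis bij_is_inj image_set_diff)

lemma Sym_sum_image:
  assumes "\<sigma> \<in> Sym n"
  shows "(\<Sum>x\<in>\<sigma> ` A. f x) = (\<Sum>x\<in>A. f (\<sigma> x))"
  using Sym_bij[OF assms] by (subst sum.reindex) (auto simp: bij_def intro: inj_on_subset)

lemma harmonic_sum_translate:
  assumes "harmonic n j f" "\<sigma> \<in> Sym n" "Y \<subseteq> {..<n}" "Suc (card Y) = j"
  shows "(\<Sum>x\<in>{..<n} - Y. f (\<sigma> ` insert x Y)) = 0"
proof -
  have "\<sigma> ` Y \<in> ksub n (card Y)" using assms by (intro ksub_image) (auto simp: ksub_def)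
  then have "(\<Sum>x\<in>{..<n} - \<sigma> ` Y. f (insert x (\<sigma> ` Y))) = 0"
    using assms unfolding harmonic_def ksub_def by auto
  then show ?thesis
    by (simp add: Sym_image_Diff[OF assms(2)] Sym_sum_image[OF assms(2)])
qed

lemma harmonic_translate:
  assumes "harmonic n j f" "\<sigma> \<in> Sym n"
  shows "harmonic n j (\<lambda>X. f (\<sigma> ` X))"
  using harmonic_sum_translate[OF assms] unfolding harmonic_def by blast

section \<open>Inclusion matrices and permutation characters on subsets\<close>

lemma sum_Pow_alternating:
  assumes "finite S"
  shows "(\<Sum>A\<in>Pow S. (-1) ^ card A) = (if S = {} then 1 else 0 :: 'k::field)"
  using assms
proof (induction S)
  case (insert x S)
  have "(\<Sum>A\<in>Pow (insert x S). (-1) ^ card A) =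
      (\<Sum>A\<in>Pow S. (-1) ^ card A) + (\<Sum>A\<in>insert x ` Pow S. (-1) ^ card A :: 'k)"
    unfolding Pow_insert using insert by (intro sum.union_disjoint) auto
  also have "(\<Sum>A\<in>insert x ` Pow S. (-1) ^ card A :: 'k) = (\<Sum>A\<in>Pow S. (-1) ^ card (insert x A))"
    using insert by (subst sum.reindex) (auto simp: inj_on_def)
  also have "\<dots> = (\<Sum>A\<in>Pow S. - ((-1) ^ card A))"
  proof (intro sum.cong refl)
    fix A assume "A \<in> Pow S"
    then have "finite A" "x \<notin> A" using insert finite_subset by auto
    then show "(-1) ^ card (insert x A) = - ((-1) ^ card A :: 'k)" by simp
  qed
  finally show ?case by (simp add: sum_negf)
qed simp

text \<open>Inclusion and exclusion over the subsets \<open>A\<close> of \<open>Y0\<close> that miss \<open>X\<close>.\<close>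

lemma inclusion_matrix_right_inverse:
  assumes "Y0 \<in> ksub n i" "2 * i < n"
  shows "\<exists>L :: nat set \<Rightarrow> 'k::field_char_0. \<forall>Y\<in>ksub n i.
    (\<Sum>x\<in>{..<n} - Y. L (insert x Y)) = (if Y = Y0 then 1 else 0)"
proof -
  \<comment> \<open>For fixed \<open>Y\<close>, a set \<open>A\<close> is counted once for every
    point outside \<open>Y\<close> and \<open>A\<close>. The denominator is the number of these
    points, positive because \<open>A\<close> has at most \<open>i\<close> elements; what remains is
    an alternating sum over the subsets of \<open>Y0 - Y\<close>.\<close>
  define w :: "nat set \<Rightarrow> 'k" where "w A = (-1) ^ card A / of_nat (n - i - card A)" for A
  define L :: "nat set \<Rightarrow> 'k" where "L X = (\<Sum>A\<in>Pow (Y0 - X). w A)" for X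
  have Y0: "Y0 \<subseteq> {..<n}" "card Y0 = i" "finite Y0"
    using assms by (auto simp: ksub_def finite_subset)
  have "(\<Sum>x\<in>{..<n} - Y. L (insert x Y)) = (if Y = Y0 then 1 else 0)" if Y: "Y \<in> ksub n i" for Y
  proof -
    have Yf: "Y \<subseteq> {..<n}" "card Y = i" "finite Y"
      using Y by (auto simp: ksub_def finite_subset)
    have "(\<Sum>x\<in>{..<n} - Y. L (insert x Y)) =
        (\<Sum>x\<in>{..<n} - Y. \<Sum>A\<in>Pow (Y0 - Y). if x \<notin> A then w A else 0)"
      unfolding L_def using Y0
      by (intro sum.cong refl sum.mono_neutral_cong_left) auto
    also have "\<dots> = (\<Sum>A\<in>Pow (Y0 - Y). \<Sum>x\<in>{..<n} - Y. if x \<notin> A then w A else 0)"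
      by (rule sum.swap)
    also have "\<dots> = (\<Sum>A\<in>Pow (Y0 - Y). (-1) ^ card A)"
    proof (intro sum.cong refl)
      fix A assume A: "A \<in> Pow (Y0 - Y)"
      then have fA: "finite A" "card A \<le> i" "A \<subseteq> {..<n}" "A \<inter> Y = {}"
        using Y0 card_mono[of Y0 A] finite_subset[of A Y0] by auto
      have "(\<Sum>x\<in>{..<n} - Y. if x \<notin> A then w A else 0) = (\<Sum>x\<in>{..<n} - Y - A. w A)"
        by (intro sum.mono_neutral_cong_right) auto
      also have "\<dots> = of_nat (card ({..<n} - Y - A)) * w A" by simp
      also have "card ({..<n} - Y - A) = n - i - card A"
        using Yf fA by (subst card_Diff_subset; auto simp: card_Diff_subset)
      also have "n - i - card A \<noteq> 0" using fA assms by auto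
      then have "of_nat (n - i - card A) * w A = (-1) ^ card A"
        unfolding w_def by (simp del: of_nat_diff)
      finally show "(\<Sum>x\<in>{..<n} - Y. if x \<notin> A then w A else 0) = (-1) ^ card A" .
    qed
    also have "\<dots> = (if Y0 - Y = {} then 1 else 0)"
      using Y0 by (intro sum_Pow_alternating) auto
    also have "Y0 - Y = {} \<longleftrightarrow> Y = Y0"
      using Y0 Yf card_subset_eq[of Y Y0] by auto
    finally show ?thesis .
  qed
  then show ?thesis by blast
qed

text \<open>Double counting of the pairs of an \<open>i\<close>-subset inside an
  \<open>(i + 1)\<close>-subset: such a pair is given by the larger set and the deleted point, or by
  the smaller set and the added point.\<close>

lemma sum_flags:
  "(\<Sum>X\<in>ksub n (Suc i). \<Sum>y\<in>X. F (X - {y}) X) =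
   (\<Sum>Y\<in>ksub n i. \<Sum>x\<in>{..<n} - Y. F Y (insert x Y))"
proof -
  have fin: "finite X" if "X \<in> ksub n k" for X k
    using that by (auto simp: ksub_def finite_subset)
  have "(\<Sum>X\<in>ksub n (Suc i). \<Sum>y\<in>X. F (X - {y}) X) =
      (\<Sum>(X, y)\<in>Sigma (ksub n (Suc i)) (\<lambda>X. X). F (X - {y}) X)"
    using fin by (intro sum.Sigma) auto
  also have "\<dots> = (\<Sum>(Y, x)\<in>Sigma (ksub n i) (\<lambda>Y. {..<n} - Y). F Y (insert x Y))"
  proof (rule sum.reindex_bij_witness[where j = "\<lambda>(X, y). (X - {y}, y)"
        and i = "\<lambda>(Y, x). (insert x Y, x)"])
    fix a assume "a \<in> Sigma (ksub n i) (\<lambda>Y. {..<n} - Y)"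
    then obtain Y x where a: "a = (Y, x)" "Y \<in> ksub n i" "x < n" "x \<notin> Y" by auto
    then have "card (insert x Y) = Suc i" using fin[of Y] by (simp add: ksub_def)
    then show "(case a of (Y, x) \<Rightarrow> (insert x Y, x)) \<in> Sigma (ksub n (Suc i)) (\<lambda>X. X)"
      using a by (simp add: ksub_def)
    show "(case case a of (Y, x) \<Rightarrow> (insert x Y, x) of (X, y) \<Rightarrow> (X - {y}, y)) = a"
      using a by simp
  next
    fix a assume "a \<in> Sigma (ksub n (Suc i)) (\<lambda>X. X)"
    then obtain X y where a: "a = (X, y)" "X \<in> ksub n (Suc i)" "y \<in> X" by auto
    then show "(case a of (X, y) \<Rightarrow> (X - {y}, y)) \<in> Sigma (ksub n i) (\<lambda>Y. {..<n} - Y)"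
      using fin[of X] by (auto simp: ksub_def)
    show "(case case a of (X, y) \<Rightarrow> (X - {y}, y) of (Y, x) \<Rightarrow> (insert x Y, x)) = a"
      "(case case a of (X, y) \<Rightarrow> (X - {y}, y) of (Y, x) \<Rightarrow> F Y (insert x Y)) =
       (case a of (X, y) \<Rightarrow> F (X - {y}) X)"
      using a by (simp_all add: insert_absorb)
  qed
  also have "\<dots> = (\<Sum>Y\<in>ksub n i. \<Sum>x\<in>{..<n} - Y. F Y (insert x Y))"
    by (rule sum.Sigma[symmetric]) auto
  finally show ?thesis .
qed

text \<open>The value at \<sigma> of the permutation character on \<open>j\<close>-subsets.\<close>

definition fixc :: "nat \<Rightarrow> nat \<Rightarrow> (nat \<Rightarrow> nat) \<Rightarrow> nat"
  where "fixc n j \<sigma> = card {X \<in> ksub n j. \<sigma> ` X = X}"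

lemma fixc_eq_sum: "of_nat (fixc n j \<sigma>) = (\<Sum>X\<in>ksub n j. if \<sigma> ` X = X then 1 else 0 :: 'k::field_char_0)"
proof -
  have "(\<Sum>X\<in>ksub n j. if \<sigma> ` X = X then 1 else 0 :: 'k) = (\<Sum>X\<in>{X \<in> ksub n j. \<sigma> ` X = X}. 1)"
    by (intro sum.mono_neutral_cong_right) auto
  then show ?thesis by (simp add: fixc_def)
qed

text \<open>\<open>E\<close> is the matrix of a projection onto the harmonic functions, whose complement is
  isomorphic to the permutation module of \<open>(j - 1)\<close>-subsets.\<close>

lemma trace_harmonic_projection:
  fixes E :: "nat set \<Rightarrow> nat set \<Rightarrow> 'k::field_char_0"
  assumes \<sigma>: "\<sigma> \<in> Sym n" and j: "2 * j \<le> n"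
    and E1: "\<And>X. harmonic n j (\<lambda>X0. E X0 X)"
    and E2: "\<And>f X0. harmonic n j f \<Longrightarrow> X0 \<in> ksub n j \<Longrightarrow> (\<Sum>X\<in>ksub n j. E X0 X * f X) = f X0"
  shows "(\<Sum>X\<in>ksub n j. E (\<sigma> ` X) X) =
    of_nat (fixc n j \<sigma>) - (if j = 0 then 0 else of_nat (fixc n (j - 1) \<sigma>))"
proof (cases j)
  case 0
  then have "ksub n j = {{}}" by (auto simp: ksub_def finite_subset)
  moreover have "harmonic n j (\<lambda>_. 1 :: 'k)" using 0 by (simp add: harmonic_def)
  ultimately show ?thesis using E2[of "\<lambda>_. 1" "{}"] 0 by (simp add: fixc_eq_sum)
next
  case (Suc i)
  have i: "2 * i < n" using j Suc by simp
  define L :: "nat set \<Rightarrow> nat set \<Rightarrow> 'k" where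
    "L Y0 = (SOME L. \<forall>Y\<in>ksub n i. (\<Sum>x\<in>{..<n} - Y. L (insert x Y)) = (if Y = Y0 then 1 else 0))" for Y0
  have L: "(\<Sum>x\<in>{..<n} - Y. L Y0 (insert x Y)) = (if Y = Y0 then 1 else 0)"
    if "Y \<in> ksub n i" "Y0 \<in> ksub n i" for Y Y0
    using someI_ex[OF inclusion_matrix_right_inverse[OF that(2) i, where 'k = 'k]] that(1)
    unfolding L_def[symmetric] by blast
  \<comment> \<open>Identity matrix minus a correction through \<open>(j - 1)\<close>-subsets. As
    \<open>L\<close> is a right inverse of the inclusion matrix, the correction makes every row of
    \<open>k\<close> harmonic.\<close>
  define k where "k X0 X = (if X = X0 then 1 else 0) - (\<Sum>y\<in>X0. L (X0 - {y}) X)" for X0 X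
  have del: "X - {y} \<in> ksub n i" if "X \<in> ksub n j" "y \<in> X" for X y
    using that Suc by (auto simp: ksub_def finite_subset)
  have harm: "harmonic n j (k X0)" if X0: "X0 \<in> ksub n j" for X0
    unfolding harmonic_def
  proof (intro allI impI)
    fix Y assume "Y \<subseteq> {..<n} \<and> Suc (card Y) = j"
    then have Y: "Y \<in> ksub n i" using Suc by (auto simp: ksub_def)
    have fX: "finite X0" "X0 \<subseteq> {..<n}" using X0 by (auto simp: ksub_def finite_subset)
    have "(\<Sum>x\<in>{..<n} - Y. k X0 (insert x Y)) =
        (\<Sum>x\<in>{..<n} - Y. if insert x Y = X0 then 1 else 0) -
        (\<Sum>y\<in>X0. \<Sum>x\<in>{..<n} - Y. L (X0 - {y}) (insert x Y))"
      unfolding k_def sum_subtractf by (subst (2) sum.swap) simp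
    also have "(\<Sum>y\<in>X0. \<Sum>x\<in>{..<n} - Y. L (X0 - {y}) (insert x Y)) =
        (\<Sum>y\<in>X0. if Y = X0 - {y} then 1 else 0)"
      using L[OF Y del[OF X0]] by (intro sum.cong) auto
    also have "\<dots> = (\<Sum>x\<in>{..<n} - Y. if insert x Y = X0 then 1 else 0)"
      using fX by (intro sum.mono_neutral_cong) auto
    finally show "(\<Sum>x\<in>{..<n} - Y. k X0 (insert x Y)) = 0" by simp
  qed
  have push: "(\<Sum>x\<in>{..<n} - Y. f (\<sigma> ` insert x Y)) = (\<Sum>x\<in>{..<n} - \<sigma> ` Y. f (insert x (\<sigma> ` Y)))"
    for f :: "nat set \<Rightarrow> 'k" and Y
    by (simp add: Sym_image_Diff[OF \<sigma>] Sym_sum_image[OF \<sigma>])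
  \<comment> \<open>First evaluation of the trace of the product: \<open>E\<close> fixes the
    harmonic rows of \<open>k\<close>, and the correction term contributes the permutation character
    on \<open>(j - 1)\<close>-subsets.\<close>
  have "(\<Sum>X0\<in>ksub n j. \<Sum>X\<in>ksub n j. E (\<sigma> ` X0) X * k X0 X) = (\<Sum>X0\<in>ksub n j. k X0 (\<sigma> ` X0))"
    using \<sigma> by (intro sum.cong refl E2 harm ksub_image)
  also have "\<dots> = of_nat (fixc n j \<sigma>) - (\<Sum>X0\<in>ksub n j. \<Sum>y\<in>X0. L (X0 - {y}) (\<sigma> ` X0))"
    by (simp add: k_def sum_subtractf fixc_eq_sum)
  also have "(\<Sum>X0\<in>ksub n j. \<Sum>y\<in>X0. L (X0 - {y}) (\<sigma> ` X0)) =
      (\<Sum>Y\<in>ksub n i. \<Sum>x\<in>{..<n} - Y. L Y (\<sigma> ` insert x Y))"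
    unfolding Suc by (rule sum_flags)
  also have "\<dots> = (\<Sum>Y\<in>ksub n i. if \<sigma> ` Y = Y then 1 else 0)"
    using L \<sigma> by (intro sum.cong refl) (simp add: push del: image_insert)
  also have "\<dots> = of_nat (fixc n i \<sigma>)" by (simp add: fixc_eq_sum)
  finally have *: "(\<Sum>X0\<in>ksub n j. \<Sum>X\<in>ksub n j. E (\<sigma> ` X0) X * k X0 X) =
      of_nat (fixc n j \<sigma>) - of_nat (fixc n i \<sigma>)" .
  \<comment> \<open>Second evaluation: expand \<open>k\<close> instead. The correction is killed
    because the columns of \<open>E\<close> are harmonic, and the translated trace of
    \<open>E\<close> remains.\<close>
  have "(\<Sum>X0\<in>ksub n j. \<Sum>X\<in>ksub n j. E (\<sigma> ` X0) X * k X0 X) =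
      (\<Sum>X0\<in>ksub n j. E (\<sigma> ` X0) X0) -
      (\<Sum>X0\<in>ksub n j. \<Sum>X\<in>ksub n j. \<Sum>y\<in>X0. E (\<sigma> ` X0) X * L (X0 - {y}) X)"
  proof -
    have "(\<Sum>X\<in>ksub n j. E (\<sigma> ` X0) X * k X0 X) =
        E (\<sigma> ` X0) X0 - (\<Sum>X\<in>ksub n j. \<Sum>y\<in>X0. E (\<sigma> ` X0) X * L (X0 - {y}) X)"
      if "X0 \<in> ksub n j" for X0
      using that by (simp add: k_def right_diff_distrib sum_subtractf sum_distrib_left
          if_distrib[of "\<lambda>x. E (\<sigma> ` X0) _ * x"] cong: if_cong)
    then show ?thesis by (simp add: sum_subtractf)
  qed
  also have "(\<Sum>X0\<in>ksub n j. \<Sum>X\<in>ksub n j. \<Sum>y\<in>X0. E (\<sigma> ` X0) X * L (X0 - {y}) X) =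
      (\<Sum>X\<in>ksub n j. \<Sum>X0\<in>ksub n j. \<Sum>y\<in>X0. E (\<sigma> ` X0) X * L (X0 - {y}) X)"
    by (rule sum.swap)
  also have "\<dots> = (\<Sum>X\<in>ksub n j. \<Sum>Y\<in>ksub n i. \<Sum>x\<in>{..<n} - Y. E (\<sigma> ` insert x Y) X * L Y X)"
    unfolding Suc by (rule sum.cong[OF refl], rule sum_flags)
  also have "\<dots> = (\<Sum>X\<in>ksub n j. \<Sum>Y\<in>ksub n i. (\<Sum>x\<in>{..<n} - Y. E (\<sigma> ` insert x Y) X) * L Y X)"
    by (simp add: sum_distrib_right)
  also have "\<dots> = 0"
  proof (intro sum.neutral ballI)
    fix X Y assume "Y \<in> ksub n i"
    then have "(\<Sum>x\<in>{..<n} - Y. E (\<sigma> ` insert x Y) X) = 0"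
      using Suc by (intro harmonic_sum_translate[OF E1 \<sigma>]) (auto simp: ksub_def)
    then show "(\<Sum>x\<in>{..<n} - Y. E (\<sigma> ` insert x Y) X) * L Y X = 0" by simp
  qed
  finally show ?thesis using * Suc by simp
qed

section \<open>Averages of harmonic functions over a block stabiliser\<close>

definition block_stab :: "nat \<Rightarrow> nat \<Rightarrow> (nat \<Rightarrow> nat) set"
  where "block_stab n m = {\<sigma> \<in> Sym n. \<sigma> ` {m..<n} = {m..<n}}"

text \<open>The sum G_s depends only on the number \<open>s\<close> of points exchanged between the
  two blocks. Harmonicity at a \<open>(j - 1)\<close>-subset gives (s + 1) G_s + (m - s) G_{s+1} =
  0, so G_s is (-1)^s G_0 / binom(m, s); the factor \<open>fact m\<close> clears the
  denominator.\<close>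

lemma sum_block_stab_harmonic:
  fixes f :: "nat set \<Rightarrow> 'k::field_char_0"
  assumes f: "harmonic n j f" and n: "n = m + j" and "j \<le> m"
    and S: "S \<subseteq> {m..<n}" "S' \<subseteq> {..<m}" "card S = s" "card S' = s"
  shows "of_nat (fact m) * (\<Sum>r\<in>block_stab n m. f (r ` (({m..<n} - S) \<union> S'))) =
    (-1) ^ s * of_nat (card (block_stab n m) * fact s * fact (m - s)) * f {m..<n}"
  using S
proof (induction s arbitrary: S S')
  case 0
  then have "S = {}" "S' = {}" by (auto simp: finite_subset)
  moreover have "(\<Sum>r\<in>block_stab n m. f (r ` {m..<n})) = (\<Sum>r\<in>block_stab n m. f {m..<n})"
    by (intro sum.cong) (auto simp: block_stab_def)
  ultimately show ?case by simp
next
  case (Suc s)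
  let ?R = "block_stab n m" and ?Q = "{m..<n}"
  define G where "G S S' = (\<Sum>r\<in>?R. f (r ` ((?Q - S) \<union> S')))" for S S'
  have fS: "finite S" "finite S'" using Suc.prems finite_subset by blast+
  obtain y where y: "y \<in> S'" using Suc.prems by fastforce
  define S1 where "S1 = S' - {y}"
  \<comment> \<open>The \<open>(j - 1)\<close>-subset at which harmonicity is used. Adding a point
    of \<open>S\<close> restores that point to the block and leaves \<open>s\<close> exchanged;
    adding a point below \<open>m\<close> leaves \<open>s + 1\<close> exchanged.\<close>
  define T where "T = (?Q - S) \<union> S1"
  have S1: "S1 \<subseteq> {..<m}" "card S1 = s" "y \<notin> S1" "S' = insert y S1" "finite S1" "y < m"
    using Suc.prems y fS by (auto simp: S1_def)
  have SQ: "m \<le> x \<and> x < n" if "x \<in> S" for x using that Suc.prems(1) by auto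
  have S1m: "x < m" if "x \<in> S1" for x using that S1 by auto
  have sm: "s < m" using card_mono[of "{..<m}" S'] Suc.prems by simp
  have T: "T \<subseteq> {..<n}" using S1 n by (auto simp: T_def)
  have "card S \<le> j" using card_mono[of ?Q S] Suc.prems n by simp
  then have cT: "Suc (card T) = j"
    using S1 Suc.prems fS n by (subst T_def, subst card_Un_disjoint) (auto simp: card_Diff_subset)
  have compl: "{..<n} - T = S \<union> ({..<m} - S1)"
  proof (rule set_eqI)
    show "x \<in> {..<n} - T \<longleftrightarrow> x \<in> S \<union> ({..<m} - S1)" for x
      using SQ[of x] S1m[of x] n by (auto simp: T_def)
  qed
  \<comment> \<open>The transposition of \<open>y\<close> and \<open>z\<close> acts below
    \<open>m\<close>, so it lies in the block stabiliser and can be absorbed into the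
    summation.\<close>
  have swap: "G S (insert z S1) = G S S'" if z: "z \<in> {..<m} - S1" for z
  proof -
    let ?t = "transpose y z"
    have tS: "?t \<in> Sym n" using z S1 n by (intro Sym_transpose) auto
    have tQ: "?t ` ?Q = ?Q" using z S1 by (intro transpose_image_eq) auto
    have mem: "r \<circ> ?t \<in> ?R" if "r \<in> ?R" for r
    proof -
      have "(r \<circ> ?t) ` ?Q = r ` ?t ` ?Q" by (rule image_comp[symmetric])
      then show ?thesis using that tS unfolding tQ by (simp add: block_stab_def Sym_comp)
    qed
    have tT: "?t ` ((?Q - S) \<union> S') = (?Q - S) \<union> insert z S1"
    proof -
      have "?t ` T = T" using z S1 SQ[of y] SQ[of z] by (intro transpose_image_eq) (auto simp: T_def)
      then show ?thesis using S1 by (simp add: T_def)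
    qed
    have "G S S' = (\<Sum>r\<in>?R. f ((r \<circ> ?t) ` ((?Q - S) \<union> S')))"
      unfolding G_def
      by (rule sum.reindex_bij_witness[where i = "\<lambda>r. r \<circ> ?t" and j = "\<lambda>r. r \<circ> ?t"])
        (use mem in \<open>auto simp: comp_assoc\<close>)
    also have "\<dots> = G S (insert z S1)"
      unfolding G_def image_comp[symmetric] tT ..
    finally show ?thesis ..
  qed
  have "0 = (\<Sum>r\<in>?R. \<Sum>z\<in>{..<n} - T. f (r ` insert z T))"
    using harmonic_sum_translate[OF f _ T cT] by (intro sum.neutral[symmetric]) (auto simp: block_stab_def)
  also have "\<dots> = (\<Sum>z\<in>{..<n} - T. \<Sum>r\<in>?R. f (r ` insert z T))" by (rule sum.swap)
  also have "\<dots> = (\<Sum>z\<in>S. \<Sum>r\<in>?R. f (r ` insert z T)) + (\<Sum>z\<in>{..<m} - S1. \<Sum>r\<in>?R. f (r ` insert z T))"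
    unfolding compl using Suc.prems(1) fS by (intro sum.union_disjoint) auto
  also have "(\<Sum>z\<in>S. \<Sum>r\<in>?R. f (r ` insert z T)) = (\<Sum>z\<in>S. G (S - {z}) S1)"
  proof (rule sum.cong[OF refl])
    fix z assume "z \<in> S"
    then have "insert z T = (?Q - (S - {z})) \<union> S1" using SQ[of z] by (auto simp: T_def)
    then show "(\<Sum>r\<in>?R. f (r ` insert z T)) = G (S - {z}) S1" unfolding G_def by (simp only:)
  qed
  also have "(\<Sum>z\<in>{..<m} - S1. \<Sum>r\<in>?R. f (r ` insert z T)) = (\<Sum>z\<in>{..<m} - S1. G S (insert z S1))"
    unfolding G_def T_def Un_insert_right ..
  also have "\<dots> = of_nat (m - s) * G S S'"
  proof -
    have "(\<Sum>z\<in>{..<m} - S1. G S (insert z S1)) = (\<Sum>z\<in>{..<m} - S1. G S S')"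
      by (rule sum.cong[OF refl swap])
    then show ?thesis using S1(1,2,5) by (simp add: card_Diff_subset del: of_nat_diff)
  qed
  finally have eq0: "0 = (\<Sum>z\<in>S. G (S - {z}) S1) + of_nat (m - s) * G S S'" .
  have "of_nat (fact m) * (\<Sum>z\<in>S. G (S - {z}) S1) + of_nat (m - s) * (of_nat (fact m) * G S S') =
      of_nat (fact m) * ((\<Sum>z\<in>S. G (S - {z}) S1) + of_nat (m - s) * G S S')"
    by (simp add: distrib_left mult.left_commute del: of_nat_diff)
  also have "\<dots> = 0" unfolding eq0[symmetric] by (rule mult_zero_right)
  finally have "of_nat (fact m) * (\<Sum>z\<in>S. G (S - {z}) S1) + of_nat (m - s) * (of_nat (fact m) * G S S') = 0" .
  moreover have "of_nat (fact m) * (\<Sum>z\<in>S. G (S - {z}) S1) =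
      of_nat (Suc s) * ((-1) ^ s * of_nat (card ?R * fact s * fact (m - s)) * f ?Q)"
  proof -
    have "of_nat (fact m) * G (S - {z}) S1 =
        (-1) ^ s * of_nat (card ?R * fact s * fact (m - s)) * f ?Q" if "z \<in> S" for z
      unfolding G_def using that Suc.prems S1 fS by (intro Suc.IH) auto
    then show ?thesis using Suc.prems by (simp add: sum_distrib_left)
  qed
  ultimately have "of_nat (m - s) * (of_nat (fact m) * G S S') =
      - (of_nat (Suc s) * ((-1) ^ s * of_nat (card ?R * fact s * fact (m - s)) * f ?Q))"
    by (metis add_eq_0_iff)
  also have "\<dots> = of_nat (m - s) *
      ((-1) ^ Suc s * of_nat (card ?R * fact (Suc s) * fact (m - Suc s)) * f ?Q)"
  proof -
    have fm: "fact (m - s) = (m - s) * fact (m - Suc s)"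
      using sm by (metis Suc_diff_Suc fact_Suc of_nat_id)
    have "Suc s * (card ?R * fact s * fact (m - s)) =
        (m - s) * (card ?R * fact (Suc s) * fact (m - Suc s))"
      unfolding fm fact_Suc of_nat_id by (simp only: mult_ac)
    then have eq: "of_nat (Suc s) * of_nat (card ?R * fact s * fact (m - s)) =
        (of_nat (m - s) * of_nat (card ?R * fact (Suc s) * fact (m - Suc s)) :: 'k)"
      by (metis of_nat_mult)
    have "- (a * ((-1) ^ s * b * F)) = d * ((-1) ^ Suc s * c * F)" if "a * b = d * c"
      for a b c d F :: 'k
    proof -
      have "a * ((-1) ^ s * b * F) = (-1) ^ s * (a * b) * F" by (simp only: mult_ac)
      then show ?thesis by (simp add: that)
    qed
    then show ?thesis using eq .
  qed
  finally have "of_nat (fact m) * G S S' =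
      (-1) ^ Suc s * of_nat (card ?R * fact (Suc s) * fact (m - Suc s)) * f ?Q"
    using sm by (subst (asm) mult_cancel_left) (auto simp del: of_nat_diff)
  then show ?case unfolding G_def .
qed

subsection \<open>Characters of two-row partitions\<close>

lemma sum_list_part [simp]: "sum_list (part l) = sum_list l"
  by (induction l) (simp_all add: part_def)

lemma two_row_cells:
  assumes "j \<le> m" "k < m + j"
  shows "row_of (part [m, j]) k = (if k < m then 0 else 1)"
    "col_of (part [m, j]) k = (if k < m then k else k - m)"
proof -
  let ?l = "part [m, j]"
  have k: "k < sum_list ?l" using assms by simp
  have m: "m \<noteq> 0" using assms by auto
  have 1: "row_of ?l k < 1 \<longleftrightarrow> k < m"
    using row_less_iff[OF k, of 1] m by (simp add: part_def)
  have 2: "row_of ?l k < 2"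
    using row_less_iff[OF k, of 2] m assms by (simp add: part_def)
  show r: "row_of ?l k = (if k < m then 0 else 1)" using 1 2 by auto
  show "col_of ?l k = (if k < m then k else k - m)"
    unfolding col_of_def r using m by (simp add: part_def)
qed

lemma two_row_stab:
  assumes "j \<le> m"
  shows "row_stab (part [m, j]) = block_stab (m + j) m"
proof -
  have "(\<forall>k<m + j. row_of (part [m, j]) (\<sigma> k) = row_of (part [m, j]) k) \<longleftrightarrow>
      \<sigma> ` {m..<m + j} = {m..<m + j}" if \<sigma>: "\<sigma> \<in> Sym (m + j)" for \<sigma>
  proof -
    have "(\<forall>k<m + j. row_of (part [m, j]) (\<sigma> k) = row_of (part [m, j]) k) \<longleftrightarrow>
        (\<forall>k<m + j. \<sigma> k < m \<longleftrightarrow> k < m)"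
      using two_row_cells(1)[OF assms] Sym_less_iff[OF \<sigma>] by (auto split: if_splits)
    also have "\<dots> \<longleftrightarrow> \<sigma> ` {m..<m + j} = {m..<m + j}"
    proof
      assume a: "\<forall>k<m + j. \<sigma> k < m \<longleftrightarrow> k < m"
      have "\<sigma> ` {m..<m + j} \<subseteq> {m..<m + j}"
      proof clarify
        fix x assume x: "x \<in> {m..<m + j}"
        then have "\<sigma> x < m + j" using Sym_less_iff[OF \<sigma>, of x] by auto
        moreover have "\<not> \<sigma> x < m" using a x by auto
        ultimately show "\<sigma> x \<in> {m..<m + j}" by simp
      qed
      moreover have "inj_on \<sigma> {m..<m + j}"
        using Sym_bij[OF \<sigma>] by (auto simp: bij_def intro: inj_on_subset)
      ultimately show "\<sigma> ` {m..<m + j} = {m..<m + j}" by (intro endo_inj_surj) auto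
    next
      assume a: "\<sigma> ` {m..<m + j} = {m..<m + j}"
      have "\<sigma> k \<in> \<sigma> ` {m..<m + j} \<longleftrightarrow> k \<in> {m..<m + j}" for k
        using Sym_bij[OF \<sigma>] by (intro inj_image_mem_iff) (auto simp: bij_def)
      then have *: "\<sigma> k \<in> {m..<m + j} \<longleftrightarrow> k \<in> {m..<m + j}" for k unfolding a .
      show "\<forall>k<m + j. \<sigma> k < m \<longleftrightarrow> k < m"
      proof (intro allI impI)
        fix k assume "k < m + j"
        then show "\<sigma> k < m \<longleftrightarrow> k < m"
          using *[of k] Sym_less_iff[OF \<sigma>, of k] by auto
      qed
    qed
    finally show ?thesis .
  qed
  then show ?thesis by (auto simp: row_stab_def block_stab_def)
qed

lemma two_row_col_stab:
  assumes "j \<le> m" "\<tau> \<in> col_stab (part [m, j])" "k < m + j"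
  shows "(if \<tau> k < m then \<tau> k else \<tau> k - m) = (if k < m then k else k - m)"
proof -
  have "\<tau> \<in> Sym (m + j)" using assms(2) col_stab_Sym by fastforce
  then show ?thesis
    using assms two_row_cells(2)[OF assms(1), of k] two_row_cells(2)[OF assms(1), of "\<tau> k"]
    by (auto simp: col_stab_def)
qed

lemma two_row_transpose:
  assumes "j \<le> m" "k \<in> {m..<m + j}"
  shows "transpose k (k - m) \<in> col_stab (part [m, j])"
proof -
  have "transpose k (k - m) \<in> Sym (m + j)" using assms by (intro Sym_transpose) auto
  moreover have "col_of (part [m, j]) (transpose k (k - m) x) = col_of (part [m, j]) x"
    if "x < m + j" for x
  proof -
    have k: "k < m + j" "k - m < m + j" "\<not> k < m" "k - m < m" using assms by auto
    show ?thesis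
      using two_row_cells(2)[OF assms(1) k(1)] two_row_cells(2)[OF assms(1) k(2)] k
      by (simp add: transpose_def)
  qed
  ultimately show ?thesis by (simp add: col_stab_def)
qed

text \<open>For \<tau> in the column stabiliser: the number of columns of length 2 whose entries
  \<tau> exchanges, that is, the number of points leaving the second row.\<close>

definition exc :: "nat \<Rightarrow> nat \<Rightarrow> (nat \<Rightarrow> nat) \<Rightarrow> nat"
  where "exc m j \<tau> = card {k \<in> {m..<m + j}. \<tau> k < m}"

lemma exc_zero_imp_id:
  assumes "j \<le> m" "\<tau> \<in> col_stab (part [m, j])" "exc m j \<tau> = 0"
  shows "\<tau> = id"
proof -
  have \<tau>: "\<tau> \<in> Sym (m + j)" using assms(2) col_stab_Sym by fastforce
  have "finite {k \<in> {m..<m + j}. \<tau> k < m}" by simp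
  then have none: "{k \<in> {m..<m + j}. \<tau> k < m} = {}" using assms(3) unfolding exc_def by (metis card_0_eq)
  have "\<tau> ` {m..<m + j} \<subseteq> {m..<m + j}"
  proof clarify
    fix x assume x: "x \<in> {m..<m + j}"
    then have "\<tau> x < m + j" using Sym_less_iff[OF \<tau>, of x] by auto
    moreover have "\<not> \<tau> x < m" using none x by blast
    ultimately show "\<tau> x \<in> {m..<m + j}" by simp
  qed
  moreover have "inj_on \<tau> {m..<m + j}"
    using Sym_bij[OF \<tau>] by (auto simp: bij_def intro: inj_on_subset)
  ultimately have "\<tau> ` {m..<m + j} = {m..<m + j}" by (intro endo_inj_surj) auto
  then have "\<tau> \<in> row_stab (part [m, j])" using \<tau> by (simp add: two_row_stab[OF assms(1)] block_stab_def)
  then show ?thesis using assms(2) by (rule row_col_stab_trivial)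
qed

text \<open>\<tau> is a product of disjoint transpositions, one for each exchanged column; the
  induction undoes one of them at a time.\<close>

lemma sign_two_row_col_stab:
  assumes "j \<le> m" "\<tau> \<in> col_stab (part [m, j])"
  shows "sign \<tau> = (-1) ^ exc m j \<tau>"
  using assms(2)
proof (induction "exc m j \<tau>" arbitrary: \<tau>)
  case 0
  then have "\<tau> = id" using exc_zero_imp_id[OF assms(1)] by metis
  then have "sign \<tau> = 1" by simp
  then show ?case using "0.hyps" by (metis power_0)
next
  case (Suc s)
  let ?A = "\<lambda>\<tau>. {k \<in> {m..<m + j}. \<tau> k < m}"
  have "?A \<tau> \<noteq> {}" using Suc.hyps(2) unfolding exc_def by (metis card.empty nat.distinct(1))
  then obtain k where k: "k \<in> {m..<m + j}" "\<tau> k < m" by auto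
  have \<tau>: "\<tau> \<in> Sym (m + j)" using Suc.prems col_stab_Sym by fastforce
  have tk: "\<tau> k = k - m" using two_row_col_stab[OF assms(1) Suc.prems, of k] k by auto
  let ?t = "transpose k (k - m)"
  have t: "?t \<in> col_stab (part [m, j])" using assms(1) k(1) by (rule two_row_transpose)
  have comp: "?t \<circ> \<tau> \<in> col_stab (part [m, j])" using t Suc.prems by (rule col_stab_comp)
  have "?A (?t \<circ> \<tau>) = ?A \<tau> - {k}"
  proof (rule set_eqI)
    fix x
    show "x \<in> ?A (?t \<circ> \<tau>) \<longleftrightarrow> x \<in> ?A \<tau> - {k}"
    proof (cases "x \<in> {m..<m + j} \<and> x \<noteq> k")
      case False
      then show ?thesis using k tk by auto
    next
      case True
      then have ne: "\<tau> x \<noteq> k - m" using Sym_inj[OF \<tau>, of x k] tk by simp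
      have "\<tau> x \<noteq> k" using two_row_col_stab[OF assms(1) Suc.prems, of x] True k by auto
      then show ?thesis using ne True by simp
    qed
  qed
  then have "exc m j (?t \<circ> \<tau>) = exc m j \<tau> - 1"
    using k unfolding exc_def by (simp add: card_Diff_singleton)
  then have e: "exc m j (?t \<circ> \<tau>) = s" using Suc.hyps(2) by simp
  have "sign (?t \<circ> \<tau>) = (-1) ^ s" using Suc.hyps(1)[OF e[symmetric] comp] e by simp
  moreover have "sign (?t \<circ> \<tau>) = sign ?t * sign \<tau>"
    using Sym_sign_comp[OF col_stab_Sym[OF t] col_stab_Sym[OF Suc.prems]] .
  moreover have "sign ?t = -1" using k assms(1) by (auto simp: sign_swap_id)
  ultimately have "sign \<tau> = - ((-1) ^ s)" by simp
  then show ?case using Suc.hyps(2)[symmetric] by simp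
qed

section \<open>Polytabloids and translates of the Young symmetrizer\<close>

definition tabloid_coeff :: "nat \<Rightarrow> nat \<Rightarrow> nat set \<Rightarrow> (nat \<Rightarrow> nat) \<Rightarrow> 'k::field"
  where "tabloid_coeff m j X h =
    (\<Sum>\<tau>\<in>col_stab (part [m, j]). if h ` \<tau> ` {m..<m + j} = X then of_int (sign \<tau>) else 0)"

text \<open>Identify a tabloid with the set in its second row. For fixed \<open>h\<close>,
  \<open>tabloid_coeff\<close> as a function of \<open>X\<close> is the polytabloid of the tableau
  \<open>h\<close>. Read here as a function of \<open>h\<close> for fixed \<open>X\<close>, it is
  the translate of the Young symmetrizer by any permutation taking the block to
  \<open>X\<close>.\<close>

definition polytabloid :: "nat \<Rightarrow> nat \<Rightarrow> nat set \<Rightarrow> (nat \<Rightarrow> nat) \<Rightarrow>\<^sub>0 'k::field"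
  where "polytabloid m j X = (\<Sum>h\<in>Sym (m + j). Poly_Mapping.single h (tabloid_coeff m j X h))"

lemma lookup_polytabloid:
  "Poly_Mapping.lookup (polytabloid m j X) h = (if h \<in> Sym (m + j) then tabloid_coeff m j X h else 0)"
  by (simp add: polytabloid_def lookup_sum lookup_single when_def)

lemma Sym_sign_inv: "\<sigma> \<in> Sym n \<Longrightarrow> sign (inv \<sigma>) = sign \<sigma>"
  unfolding Sym_def using permutes_imp_permutation[of "{..<n}"] by (intro sign_inverse) auto

lemma Sym_image_eq_iff: "\<sigma> \<in> Sym n \<Longrightarrow> \<sigma> ` X = \<sigma> ` Y \<longleftrightarrow> X = Y"
  using Sym_bij[of \<sigma> n] by (simp add: bij_def inj_image_eq_iff)

lemma bij_betw_col_stab_inv: "bij_betw inv (col_stab l) (col_stab l)"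
  by (rule bij_betw_byWitness[where f' = inv])
    (auto simp: col_stab_inv inv_inv_eq Sym_bij[OF col_stab_Sym])

text \<open>For given \<tau>, the equation \<open>g \<circ> (\<sigma> \<circ> \<tau>) = x\<close>
  has one solution \<sigma>, and this is a row permutation exactly if
  \<open>x \<circ> inv \<tau>\<close> takes the block to the same set as \<open>g\<close>. Passing
  from \<tau> to its inverse preserves the sign.\<close>

lemma pushf_young_symmetrizer_two_row:
  assumes j: "j \<le> m" and g: "g \<in> Sym (m + j)"
  shows "pushf ((\<circ>) g) (young_symmetrizer (part [m, j])) =
    (polytabloid m j (g ` {m..<m + j}) :: (nat \<Rightarrow> nat) \<Rightarrow>\<^sub>0 'k::field)"
proof (rule poly_mapping_eqI)
  fix x
  let ?Q = "{m..<m + j}" and ?l = "part [m, j]"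
  have "Poly_Mapping.lookup (pushf ((\<circ>) g) (young_symmetrizer ?l)) x =
      (\<Sum>\<sigma>\<in>row_stab ?l. \<Sum>\<tau>\<in>col_stab ?l. if g \<circ> (\<sigma> \<circ> \<tau>) = x then of_int (sign \<tau>) else 0 :: 'k)"
    by (simp add: young_symmetrizer_def pushf.sum lookup_sum lookup_single when_def)
  also have "\<dots> = (\<Sum>\<tau>\<in>col_stab ?l. \<Sum>\<sigma>\<in>row_stab ?l. if g \<circ> (\<sigma> \<circ> \<tau>) = x then of_int (sign \<tau>) else 0)"
    by (rule sum.swap)
  also have "\<dots> = (\<Sum>\<tau>\<in>col_stab ?l.
      if x \<in> Sym (m + j) \<and> x ` inv \<tau> ` ?Q = g ` ?Q then of_int (sign (inv \<tau>)) else 0)"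
  proof (rule sum.cong[OF refl])
    fix \<tau> assume "\<tau> \<in> col_stab ?l"
    then have \<tau>: "\<tau> \<in> Sym (m + j)" using col_stab_Sym by fastforce
    have eq: "g \<circ> (\<sigma> \<circ> \<tau>) = x \<longleftrightarrow> \<sigma> = inv g \<circ> x \<circ> inv \<tau>" for \<sigma>
    proof
      assume x: "g \<circ> (\<sigma> \<circ> \<tau>) = x"
      show "\<sigma> = inv g \<circ> x \<circ> inv \<tau>"
        unfolding x[symmetric] using g \<tau> by (simp add: fun_eq_iff)
    next
      assume "\<sigma> = inv g \<circ> x \<circ> inv \<tau>"
      then show "g \<circ> (\<sigma> \<circ> \<tau>) = x" using g \<tau> by (auto simp: fun_eq_iff)
    qed
    have S: "inv g \<circ> x \<circ> inv \<tau> \<in> Sym (m + j) \<longleftrightarrow> x \<in> Sym (m + j)"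
    proof
      assume a: "inv g \<circ> x \<circ> inv \<tau> \<in> Sym (m + j)"
      have "g \<circ> ((inv g \<circ> x \<circ> inv \<tau>) \<circ> \<tau>) \<in> Sym (m + j)"
        by (rule Sym_comp[OF g Sym_comp[OF a \<tau>]])
      then show "x \<in> Sym (m + j)" unfolding eq[THEN iffD2, OF refl] .
    qed (use g \<tau> in \<open>auto intro!: Sym_comp Sym_inv\<close>)
    have im: "(inv g \<circ> x \<circ> inv \<tau>) ` ?Q = ?Q \<longleftrightarrow> x ` inv \<tau> ` ?Q = g ` ?Q"
    proof -
      have "(inv g \<circ> x \<circ> inv \<tau>) ` ?Q = ?Q \<longleftrightarrow> g ` (inv g \<circ> x \<circ> inv \<tau>) ` ?Q = g ` ?Q"
        by (rule Sym_image_eq_iff[OF g, symmetric])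
      also have "g ` (inv g \<circ> x \<circ> inv \<tau>) ` ?Q = x ` inv \<tau> ` ?Q"
        using g by (simp add: image_image)
      finally show ?thesis .
    qed
    show "(\<Sum>\<sigma>\<in>row_stab ?l. if g \<circ> (\<sigma> \<circ> \<tau>) = x then of_int (sign \<tau>) else 0 :: 'k) =
        (if x \<in> Sym (m + j) \<and> x ` inv \<tau> ` ?Q = g ` ?Q then of_int (sign (inv \<tau>)) else 0)"
      unfolding eq using S im by (simp add: two_row_stab[OF j] block_stab_def Sym_sign_inv[OF \<tau>])
  qed
  also have "\<dots> = (\<Sum>\<tau>\<in>col_stab ?l.
      if x \<in> Sym (m + j) \<and> x ` \<tau> ` ?Q = g ` ?Q then of_int (sign \<tau>) else 0)"
    by (rule sum.reindex_bij_betw[OF bij_betw_col_stab_inv])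
  also have "\<dots> = Poly_Mapping.lookup (polytabloid m j (g ` ?Q)) x"
    by (simp add: lookup_polytabloid tabloid_coeff_def)
  finally show "Poly_Mapping.lookup (pushf ((\<circ>) g) (young_symmetrizer ?l)) x =
      (Poly_Mapping.lookup (polytabloid m j (g ` ?Q)) x :: 'k)" .
qed

lemma ksub_transitive:
  assumes "X \<in> ksub n j" "Y \<in> ksub n j"
  shows "\<exists>\<sigma>\<in>Sym n. \<sigma> ` X = Y"
proof -
  have X: "X \<subseteq> {..<n}" "finite X" "card X = j" and Y: "Y \<subseteq> {..<n}" "finite Y" "card Y = j"
    using assms by (auto simp: ksub_def finite_subset)
  obtain f where f: "bij_betw f X Y" using X Y finite_same_card_bij by metis
  have "card ({..<n} - X) = card ({..<n} - Y)" using X Y by (simp add: card_Diff_subset)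
  then obtain g where g: "bij_betw g ({..<n} - X) ({..<n} - Y)"
    using finite_same_card_bij by (metis finite_Diff finite_lessThan)
  define \<sigma> where "\<sigma> x = (if x \<in> X then f x else if x < n then g x else x)" for x
  have 1: "bij_betw \<sigma> X Y" using f by (subst bij_betw_cong[of _ _ f]) (auto simp: \<sigma>_def)
  have 2: "bij_betw \<sigma> ({..<n} - X) ({..<n} - Y)"
    using g by (subst bij_betw_cong[of _ _ g]) (auto simp: \<sigma>_def)
  have "bij_betw \<sigma> (X \<union> ({..<n} - X)) (Y \<union> ({..<n} - Y))"
    using 1 2 by (rule bij_betw_combine) auto
  moreover have "X \<union> ({..<n} - X) = {..<n}" "Y \<union> ({..<n} - Y) = {..<n}" using X Y by auto
  ultimately have "\<sigma> permutes {..<n}"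
    using X by (intro bij_imp_permutes) (auto simp: \<sigma>_def)
  then show ?thesis using 1 by (auto simp: Sym_def bij_betw_def)
qed

lemma pushf_polytabloid:
  assumes \<sigma>: "\<sigma> \<in> Sym (m + j)"
  shows "pushf ((\<circ>) \<sigma>) (polytabloid m j X) =
    (polytabloid m j (\<sigma> ` X) :: (nat \<Rightarrow> nat) \<Rightarrow>\<^sub>0 'k::field)"
proof -
  have c: "tabloid_coeff m j (\<sigma> ` X) (\<sigma> \<circ> h) = (tabloid_coeff m j X h :: 'k)" for h
    unfolding tabloid_coeff_def image_comp[symmetric] Sym_image_eq_iff[OF \<sigma>] ..
  have b: "bij_betw ((\<circ>) \<sigma>) (Sym (m + j)) (Sym (m + j))"
    by (rule bij_betw_byWitness[where f' = "(\<circ>) (inv \<sigma>)"])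
      (use \<sigma> in \<open>auto simp: Sym_comp Sym_inv comp_assoc[symmetric]\<close>)
  have "pushf ((\<circ>) \<sigma>) (polytabloid m j X) =
      (\<Sum>h\<in>Sym (m + j). Poly_Mapping.single (\<sigma> \<circ> h) (tabloid_coeff m j (\<sigma> ` X) (\<sigma> \<circ> h) :: 'k))"
    by (simp add: polytabloid_def pushf.sum c)
  also have "\<dots> = polytabloid m j (\<sigma> ` X)"
    unfolding polytabloid_def by (rule sum.reindex_bij_betw[OF b])
  finally show ?thesis .
qed

text \<open>A \<open>(j - 1)\<close>-subset misses one of the \<open>j\<close> columns of length 2; exchanging the entries of that
  column changes the signs.\<close>

lemma harmonic_tabloid_coeff:
  assumes j: "j \<le> m" and h: "h \<in> Sym (m + j)"
  shows "harmonic (m + j) j (\<lambda>X. tabloid_coeff m j X h :: 'k::field_char_0)"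
  unfolding harmonic_def
proof (intro allI impI, elim conjE)
  fix Y assume Y: "Y \<subseteq> {..<m + j}" "Suc (card Y) = j"
  let ?Q = "{m..<m + j}" and ?C = "col_stab (part [m, j])"
  let ?Y = "inv h ` Y"
  have fY: "finite Y" using Y finite_subset by blast
  have "(\<lambda>x. if x < m then x else x - m) ` ?Y \<noteq> {..<j} \<and>
      \<not> {..<j} \<subseteq> (\<lambda>x. if x < m then x else x - m) ` ?Y"
  proof -
    have "card ((\<lambda>x. if x < m then x else x - m) ` ?Y) < card {..<j}"
      using Y fY card_image_le[of ?Y "\<lambda>x. if x < m then x else x - m"] card_image_le[of Y "inv h"] by simp
    then show ?thesis using card_mono[of "(\<lambda>x. if x < m then x else x - m) ` ?Y" "{..<j}"] fY by fastforce
  qed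
  then obtain i where i: "i < j" "i \<notin> (\<lambda>x. if x < m then x else x - m) ` ?Y" by blast
  let ?k = "m + i"
  have k: "?k \<in> ?Q" "?k - m = i" using i by auto
  let ?t = "transpose ?k i"
  have t: "?t \<in> ?C" using two_row_transpose[OF j k(1)] k(2) by simp
  have "i \<notin> ?Y" "?k \<notin> ?Y"
    using i j imageI[of i ?Y "\<lambda>x. if x < m then x else x - m"]
      imageI[of ?k ?Y "\<lambda>x. if x < m then x else x - m"] by auto
  then have tY: "?t ` ?Y = ?Y" by (intro transpose_image_eq) auto
  have tS: "?t \<in> Sym (m + j)" using col_stab_Sym[OF t] by simp
  have sgn: "sign (?t \<circ> \<tau>) = - sign \<tau>" if "\<tau> \<in> ?C" for \<tau>
    using Sym_sign_comp[OF col_stab_Sym[OF t] col_stab_Sym[OF that]] i(1) j by (simp add: sign_swap_id)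
  \<comment> \<open>At most one \<open>x\<close> completes \<open>Y\<close> to the set
    \<open>h\<close> \<tau> \<open>?Q\<close>, so the inner sum only records whether
    \<open>Y\<close> is contained in it.\<close>
  have cnt: "(\<Sum>x\<in>{..<m + j} - Y. if h ` \<tau> ` ?Q = insert x Y then s else 0) =
      (if ?Y \<subseteq> \<tau> ` ?Q then s else 0)" if "\<tau> \<in> ?C" for \<tau> and s :: 'k
  proof -
    have \<tau>: "\<tau> \<in> Sym (m + j)" using col_stab_Sym[OF that] by simp
    have Q: "?Q \<in> ksub (m + j) j" by (auto simp: ksub_def)
    let ?Z = "h ` \<tau> ` ?Q"
    have Z: "?Z \<subseteq> {..<m + j}" "card ?Z = j" "finite ?Z"
      using ksub_image[OF h ksub_image[OF \<tau> Q]] by (auto simp: ksub_def finite_subset)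
    have "Y = h ` ?Y" using h by (simp add: image_image)
    then have sub: "?Y \<subseteq> \<tau> ` ?Q \<longleftrightarrow> Y \<subseteq> ?Z"
      using Sym_bij[OF h] by (metis bij_is_inj inj_image_subset_iff)
    show ?thesis
    proof (cases "Y \<subseteq> ?Z")
      case True
      then have "card (?Z - Y) = 1" using Y Z fY by (simp add: card_Diff_subset)
      then obtain z where z: "?Z - Y = {z}" by (metis card_1_singletonE)
      then have zz: "z \<in> ?Z" "z \<notin> Y" by blast+
      have Ze: "?Z = insert z Y"
        using Diff_partition[OF True] unfolding z by simp
      have "z < m + j" using Z(1) zz(1) by blast
      have "?Z = insert x Y \<longleftrightarrow> x = z" if "x \<in> {..<m + j} - Y" for x
        unfolding Ze using that zz(2) by auto
      then have "(\<Sum>x\<in>{..<m + j} - Y. if ?Z = insert x Y then s else 0) =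
          (\<Sum>x\<in>{..<m + j} - Y. if x = z then s else 0)"
        by (intro sum.cong refl) simp
      also have "\<dots> = s" using zz(2) \<open>z < m + j\<close> by simp
      finally show ?thesis using True sub by simp
    next
      case False
      then have "?Z \<noteq> insert x Y" for x by auto
      then show ?thesis using False sub by simp
    qed
  qed
  have AB: "(\<Sum>x\<in>{..<m + j} - Y. tabloid_coeff m j (insert x Y) h) =
      (\<Sum>\<tau>\<in>?C. if ?Y \<subseteq> \<tau> ` ?Q then of_int (sign \<tau>) else 0 :: 'k)" (is "?A = ?B")
    unfolding tabloid_coeff_def using cnt by (subst sum.swap) (intro sum.cong refl)
  have "?B = (\<Sum>\<tau>\<in>?C. if ?Y \<subseteq> (?t \<circ> \<tau>) ` ?Q then of_int (sign (?t \<circ> \<tau>)) else 0)"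
    by (rule sum.reindex_bij_betw[OF stab_comp_bij(3)[OF id_in_stab(1) t], symmetric])
  also have "\<dots> = (\<Sum>\<tau>\<in>?C. - (if ?Y \<subseteq> \<tau> ` ?Q then of_int (sign \<tau>) else 0))"
  proof (rule sum.cong[OF refl])
    fix \<tau> assume \<tau>: "\<tau> \<in> ?C"
    have "?Y \<subseteq> (?t \<circ> \<tau>) ` ?Q \<longleftrightarrow> ?t ` ?Y \<subseteq> ?t ` \<tau> ` ?Q"
      by (simp only: tY image_comp[symmetric])
    also have "\<dots> \<longleftrightarrow> ?Y \<subseteq> \<tau> ` ?Q"
      using Sym_bij[OF tS] by (simp add: bij_def inj_image_subset_iff)
    finally show "(if ?Y \<subseteq> (?t \<circ> \<tau>) ` ?Q then of_int (sign (?t \<circ> \<tau>)) else 0) =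
        - (if ?Y \<subseteq> \<tau> ` ?Q then of_int (sign \<tau>) else 0 :: 'k)"
      by (simp only: sgn[OF \<tau>] of_int_minus) auto
  qed
  also have "\<dots> = - ?B" by (rule sum_negf)
  finally have eq: "?B = - ?B" .
  have "b = 0" if "b = - b" for b :: 'k using that by simp
  then have "?B = 0" using eq .
  then show "?A = 0" unfolding AB .
qed

text \<open>The scalar by which the matrix of \<open>tabloid_coeff\<close> acts on harmonic
  functions. For \<open>j \<le> m\<close> each summand over \<open>fact m\<close> is the order of
  the block stabiliser divided by binom(m, \<open>exc m j \<tau>\<close>), the modulus of the factor
  in \<open>sum_block_stab_harmonic\<close>.\<close>

definition two_row_const :: "nat \<Rightarrow> nat \<Rightarrow> 'k::field_char_0"
  where "two_row_const m j = (\<Sum>\<tau>\<in>col_stab (part [m, j]).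
    of_nat (card (block_stab (m + j) m) * fact (exc m j \<tau>) * fact (m - exc m j \<tau>))) / of_nat (fact m)"

lemma two_row_const_nonzero: "two_row_const m j \<noteq> (0 :: 'k::field_char_0)"
proof -
  let ?c = "\<lambda>\<tau>. card (block_stab (m + j) m) * fact (exc m j \<tau>) * fact (m - exc m j \<tau>)"
  have "id \<in> block_stab (m + j) m" "finite (block_stab (m + j) m)" by (auto simp: block_stab_def)
  then have "card (block_stab (m + j) m) > 0" using card_gt_0_iff by blast
  then have "0 < ?c id" by simp
  also have "?c id \<le> (\<Sum>\<tau>\<in>col_stab (part [m, j]). ?c \<tau>)"
    by (rule member_le_sum[OF id_in_stab(2)]) auto
  finally have "(of_nat (\<Sum>\<tau>\<in>col_stab (part [m, j]). ?c \<tau>) :: 'k) \<noteq> 0"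
    by (simp only: of_nat_eq_0_iff)
  moreover have "of_nat (fact m) \<noteq> (0 :: 'k)" by simp
  moreover have "two_row_const m j = of_nat (\<Sum>\<tau>\<in>col_stab (part [m, j]). ?c \<tau>) / (of_nat (fact m) :: 'k)"
    by (simp only: two_row_const_def of_nat_sum)
  ultimately show ?thesis by (simp only: divide_eq_0_iff simp_thms)
qed

text \<open>For each column permutation the relevant \<open>g\<close> form a coset of the block
  stabiliser, so the inner sum is an average of \<open>f\<close> that
  \<open>sum_block_stab_harmonic\<close> evaluates at \<open>X0\<close>. Its sign cancels the sign
  of the column permutation.\<close>

lemma tabloid_coeff_reproducing:
  fixes f :: "nat set \<Rightarrow> 'k::field_char_0"
  assumes j: "j \<le> m" and f: "harmonic (m + j) j f" and X0: "X0 \<in> ksub (m + j) j"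
  shows "(\<Sum>g\<in>Sym (m + j). tabloid_coeff m j X0 g * f (g ` {m..<m + j})) = two_row_const m j * f X0"
proof -
  let ?Q = "{m..<m + j}" and ?C = "col_stab (part [m, j])" and ?R = "block_stab (m + j) m"
  have Q: "?Q \<in> ksub (m + j) j" by (auto simp: ksub_def)
  obtain g0 where g0: "g0 \<in> Sym (m + j)" "g0 ` ?Q = X0" using ksub_transitive[OF Q X0] by blast
  define F where "F \<tau> = (\<Sum>r\<in>?R. f (g0 ` r ` \<tau> ` ?Q))" for \<tau>
  let ?c = "\<lambda>\<tau>. card ?R * fact (exc m j \<tau>) * fact (m - exc m j \<tau>)"
  have F: "of_int (sign \<tau>) * F \<tau> = of_nat (?c \<tau>) / of_nat (fact m) * f X0" if \<tau>: "\<tau> \<in> ?C" for \<tau>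
  proof -
    have \<tau>S: "\<tau> \<in> Sym (m + j)" using col_stab_Sym[OF \<tau>] by simp
    let ?S = "?Q - \<tau> ` ?Q" and ?S' = "\<tau> ` ?Q - ?Q"
    have inj: "inj_on \<tau> A" for A using Sym_bij[OF \<tau>S] by (auto simp: bij_def intro: inj_on_subset)
    have tQ: "\<tau> ` ?Q \<subseteq> {..<m + j}" "card (\<tau> ` ?Q) = j"
      using ksub_image[OF \<tau>S Q] by (auto simp: ksub_def)
    have S': "?S' \<subseteq> {..<m}" using tQ by auto
    have "?S' = \<tau> ` {k \<in> ?Q. \<tau> k < m}" using tQ by auto
    then have cS': "card ?S' = exc m j \<tau>" unfolding exc_def using inj by (simp add: card_image)
    have cS: "card ?S = exc m j \<tau>"
    proof -
      have "card ?S = card ?Q - card (?Q \<inter> \<tau> ` ?Q)" by (simp add: card_Diff_subset_Int)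
      moreover have "card ?S' = card (\<tau> ` ?Q) - card (?Q \<inter> \<tau> ` ?Q)"
        by (subst card_Diff_subset_Int) (auto simp: Int_commute)
      ultimately show ?thesis using cS' tQ by simp
    qed
    have un: "(?Q - ?S) \<union> ?S' = \<tau> ` ?Q" by auto
    have "of_nat (fact m) * (\<Sum>r\<in>?R. f (g0 ` r ` ((?Q - ?S) \<union> ?S'))) =
        (-1) ^ exc m j \<tau> * of_nat (?c \<tau>) * f (g0 ` ?Q)"
      by (rule sum_block_stab_harmonic[OF harmonic_translate[OF f g0(1)] refl j _ S' cS cS']) auto
    then have *: "of_nat (fact m) * F \<tau> = (-1) ^ exc m j \<tau> * of_nat (?c \<tau>) * f X0"
      unfolding un F_def g0(2) .
    have "of_int (sign \<tau>) = ((-1) ^ exc m j \<tau> :: 'k)" using sign_two_row_col_stab[OF j \<tau>] by simp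
    then have "of_nat (fact m) * (of_int (sign \<tau>) * F \<tau>) =
        ((-1) ^ exc m j \<tau> * (-1) ^ exc m j \<tau>) * (of_nat (?c \<tau>) * f X0)"
      using * by (simp only: mult.left_commute[of "of_nat (fact m)"] mult.assoc)
    also have "(-1) ^ exc m j \<tau> * (-1) ^ exc m j \<tau> = (1 :: 'k)"
      by (simp flip: power_add)
    finally have "of_nat (fact m) * (of_int (sign \<tau>) * F \<tau>) = of_nat (?c \<tau>) * f X0" by simp
    moreover have "of_nat (fact m) \<noteq> (0 :: 'k)" by simp
    ultimately show ?thesis by (metis times_divide_eq_left nonzero_mult_div_cancel_left)
  qed
  have "(\<Sum>g\<in>Sym (m + j). tabloid_coeff m j X0 g * f (g ` ?Q)) =
      (\<Sum>g\<in>Sym (m + j). \<Sum>\<tau>\<in>?C. if g ` \<tau> ` ?Q = X0 then of_int (sign \<tau>) * f (g ` ?Q) else 0)"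
    unfolding tabloid_coeff_def sum_distrib_right by (intro sum.cong refl) auto
  also have "\<dots> = (\<Sum>\<tau>\<in>?C. \<Sum>g\<in>Sym (m + j). if g ` \<tau> ` ?Q = X0 then of_int (sign \<tau>) * f (g ` ?Q) else 0)"
    by (rule sum.swap)
  also have "\<dots> = (\<Sum>\<tau>\<in>?C. of_int (sign (inv \<tau>)) * F (inv \<tau>))"
  proof (rule sum.cong[OF refl])
    fix \<tau> assume "\<tau> \<in> ?C"
    then have \<tau>: "\<tau> \<in> Sym (m + j)" using col_stab_Sym by fastforce
    have "(\<Sum>g\<in>Sym (m + j). if g ` \<tau> ` ?Q = X0 then of_int (sign \<tau>) * f (g ` ?Q) else 0) =
        (\<Sum>g\<in>{g \<in> Sym (m + j). g ` \<tau> ` ?Q = X0}. of_int (sign \<tau>) * f (g ` ?Q))"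
      by (intro sum.mono_neutral_cong_right) auto
    also have "\<dots> = (\<Sum>r\<in>?R. of_int (sign \<tau>) * f (g0 ` r ` inv \<tau> ` ?Q))"
    proof (rule sum.reindex_bij_witness[where i = "\<lambda>r. g0 \<circ> r \<circ> inv \<tau>" and j = "\<lambda>g. inv g0 \<circ> g \<circ> \<tau>"])
      fix g assume g: "g \<in> {g \<in> Sym (m + j). g ` \<tau> ` ?Q = X0}"
      show rec: "g0 \<circ> (inv g0 \<circ> g \<circ> \<tau>) \<circ> inv \<tau> = g" using g0(1) \<tau> by (simp add: fun_eq_iff)
      have "(inv g0 \<circ> g \<circ> \<tau>) ` ?Q = inv g0 ` g ` \<tau> ` ?Q" by (simp only: image_comp comp_assoc)
      also have "\<dots> = inv g0 ` g0 ` ?Q" using g g0(2) by simp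
      also have "\<dots> = ?Q" using g0(1) by (simp add: image_image)
      finally show "inv g0 \<circ> g \<circ> \<tau> \<in> ?R"
        using g g0(1) \<tau> by (auto simp: block_stab_def intro!: Sym_comp Sym_inv)
      have "g0 ` (inv g0 \<circ> g \<circ> \<tau>) ` inv \<tau> ` ?Q = (g0 \<circ> (inv g0 \<circ> g \<circ> \<tau>) \<circ> inv \<tau>) ` ?Q"
        by (simp only: image_comp comp_assoc)
      then show "of_int (sign \<tau>) * f (g0 ` (inv g0 \<circ> g \<circ> \<tau>) ` inv \<tau> ` ?Q) = of_int (sign \<tau>) * f (g ` ?Q)"
        unfolding rec by (simp only:)
    next
      fix r assume r: "r \<in> ?R"
      show "inv g0 \<circ> (g0 \<circ> r \<circ> inv \<tau>) \<circ> \<tau> = r" using g0(1) \<tau> by (simp add: fun_eq_iff)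
      have "(g0 \<circ> r \<circ> inv \<tau>) ` \<tau> ` ?Q = g0 ` r ` inv \<tau> ` \<tau> ` ?Q" by (simp only: image_comp comp_assoc)
      also have "inv \<tau> ` \<tau> ` ?Q = ?Q" using \<tau> by (simp add: image_image)
      also have "r ` ?Q = ?Q" using r by (simp add: block_stab_def)
      finally show "g0 \<circ> r \<circ> inv \<tau> \<in> {g \<in> Sym (m + j). g ` \<tau> ` ?Q = X0}"
        using r g0 \<tau> by (auto simp: block_stab_def intro!: Sym_comp Sym_inv)
    qed
    also have "\<dots> = of_int (sign (inv \<tau>)) * F (inv \<tau>)"
      by (simp add: F_def sum_distrib_left Sym_sign_inv[OF \<tau>])
    finally show "(\<Sum>g\<in>Sym (m + j). if g ` \<tau> ` ?Q = X0 then of_int (sign \<tau>) * f (g ` ?Q) else 0) =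
        of_int (sign (inv \<tau>)) * F (inv \<tau>)" .
  qed
  also have "\<dots> = (\<Sum>\<tau>\<in>?C. of_int (sign \<tau>) * F \<tau>)"
    by (rule sum.reindex_bij_betw[OF bij_betw_col_stab_inv])
  also have "\<dots> = (\<Sum>\<tau>\<in>?C. of_nat (?c \<tau>) / of_nat (fact m) * f X0)"
    by (rule sum.cong[OF refl F])
  also have "\<dots> = two_row_const m j * f X0"
    unfolding two_row_const_def sum_divide_distrib sum_distrib_right ..
  finally show ?thesis .
qed

text \<open>Left multiplication factors through functions on \<open>j\<close>-subsets: the
  polytabloids span the ideal, and summing coefficients over the permutations that take the block to
  \<open>X\<close> gives the functionals. The trace then becomes that of the translated projection
  \<open>E\<close>.\<close>

theorem irr_char_two_row:
  assumes j: "j \<le> m" and \<sigma>: "\<sigma> \<in> Sym (m + j)"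
  shows "irr_char (part [m, j]) \<sigma> =
    (of_nat (fixc (m + j) j \<sigma>) - (if j = 0 then 0 else of_nat (fixc (m + j) (j - 1) \<sigma>)) :: 'k::field_char_0)"
proof -
  let ?n = "m + j" and ?Q = "{m..<m + j}" and ?l = "part [m, j]"
  let ?K = "ksub ?n j" and ?\<gamma> = "two_row_const m j :: 'k"
  let ?U = "irr_module ?l :: ((nat \<Rightarrow> nat) \<Rightarrow>\<^sub>0 'k) set"
  have Q: "?Q \<in> ?K" by (auto simp: ksub_def)
  define i where "i X u = (\<Sum>g\<in>{g \<in> Sym ?n. g ` ?Q = X}. Poly_Mapping.lookup u g) / ?\<gamma>"
    for X and u :: "(nat \<Rightarrow> nat) \<Rightarrow>\<^sub>0 'k"
  define E where "E X0 X = i X (polytabloid m j X0)" for X0 X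
  have iadd: "i X (u + v) = i X u + i X v" for X u v
    by (simp add: i_def lookup_add sum.distrib add_divide_distrib)
  have iscale: "i X (pscale k u) = k * i X u" for X k u
    by (simp add: i_def sum_distrib_left)
  have izero: "i X 0 = 0" for X by (simp add: i_def)
  have polyU: "polytabloid m j X \<in> ?U" if X: "X \<in> ?K" for X
  proof -
    obtain g where "g \<in> Sym ?n" "g ` ?Q = X" using ksub_transitive[OF Q X] by blast
    then show ?thesis
      using irr_module_generator[of g ?l, where 'a = 'k] pushf_young_symmetrizer_two_row[OF j, of g, where 'k = 'k] by auto
  qed
  have Eeq: "E X0 X = (\<Sum>g\<in>{g \<in> Sym ?n. g ` ?Q = X}. tabloid_coeff m j X0 g) / ?\<gamma>" for X0 X
    unfolding E_def i_def by (simp add: lookup_polytabloid)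
  have E1: "harmonic ?n j (\<lambda>X0. E X0 X)" for X
    unfolding harmonic_def
  proof (intro allI impI)
    fix Y assume Y: "Y \<subseteq> {..<?n} \<and> Suc (card Y) = j"
    have "(\<Sum>x\<in>{..<?n} - Y. E (insert x Y) X) =
        (\<Sum>g\<in>{g \<in> Sym ?n. g ` ?Q = X}. \<Sum>x\<in>{..<?n} - Y. tabloid_coeff m j (insert x Y) g) / ?\<gamma>"
      unfolding Eeq sum_divide_distrib[symmetric] by (subst sum.swap) simp
    also have "\<dots> = 0"
      using harmonic_tabloid_coeff[OF j, where 'k = 'k] Y by (simp add: harmonic_def)
    finally show "(\<Sum>x\<in>{..<?n} - Y. E (insert x Y) X) = 0" .
  qed
  have E2: "(\<Sum>X\<in>?K. E X0 X * f X) = f X0" if f: "harmonic ?n j f" and X0: "X0 \<in> ?K" for f X0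
  proof -
    have "(\<Sum>X\<in>?K. E X0 X * f X) =
        (\<Sum>X\<in>?K. \<Sum>g\<in>{g \<in> Sym ?n. g ` ?Q = X}. tabloid_coeff m j X0 g * f (g ` ?Q)) / ?\<gamma>"
      unfolding Eeq sum_divide_distrib by (intro sum.cong refl) (simp add: sum_distrib_right)
    also have "(\<Sum>X\<in>?K. \<Sum>g\<in>{g \<in> Sym ?n. g ` ?Q = X}. tabloid_coeff m j X0 g * f (g ` ?Q)) =
        (\<Sum>g\<in>Sym ?n. tabloid_coeff m j X0 g * f (g ` ?Q))"
      using Q by (intro sum.group) auto
    also have "\<dots> / ?\<gamma> = f X0"
      using tabloid_coeff_reproducing[OF j f X0] two_row_const_nonzero[of m j, where 'k = 'k] by simp
    finally show ?thesis .
  qed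
  \<comment> \<open>The coefficient of a polytabloid at a fixed \<open>h\<close> is harmonic in
    \<open>X\<close>, so \<open>E\<close> reproduces it; hence the polytabloids, though dependent,
    satisfy this expansion with the coefficients \<open>i X u\<close>.\<close>
  have expand: "u = (\<Sum>X\<in>?K. pscale (i X u) (polytabloid m j X))" if "u \<in> ?U" for u
    using that[unfolded irr_module_eq_span]
  proof (induction u rule: pm.span_induct_alt)
    case base
    show ?case by (simp add: izero)
  next
    case (step k x y)
    then obtain g where g: "g \<in> Sym ?n" "x = pushf ((\<circ>) g) (young_symmetrizer ?l)" by auto
    define X0 where "X0 = g ` ?Q"
    have X0: "X0 \<in> ?K" unfolding X0_def using g(1) Q by (rule ksub_image)
    have x: "x = polytabloid m j X0"
      using pushf_young_symmetrizer_two_row[OF j g(1), where 'k = 'k] g(2) by (simp add: X0_def)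
    have "x = (\<Sum>X\<in>?K. pscale (i X x) (polytabloid m j X))"
    proof (rule poly_mapping_eqI)
      fix h
      have "(\<Sum>X\<in>?K. E X0 X * Poly_Mapping.lookup (polytabloid m j X) h) =
          Poly_Mapping.lookup (polytabloid m j X0) h"
      proof (cases "h \<in> Sym ?n")
        case True
        then show ?thesis using E2[OF harmonic_tabloid_coeff[OF j True] X0] by (simp add: lookup_polytabloid)
      qed (simp add: lookup_polytabloid)
      then show "Poly_Mapping.lookup x h =
          Poly_Mapping.lookup (\<Sum>X\<in>?K. pscale (i X x) (polytabloid m j X)) h"
        unfolding x by (simp add: lookup_sum E_def)
    qed
    then have "pscale k x + y = pscale k (\<Sum>X\<in>?K. pscale (i X x) (polytabloid m j X)) +
        (\<Sum>X\<in>?K. pscale (i X y) (polytabloid m j X))"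
      using step.IH by simp
    also have "\<dots> = (\<Sum>X\<in>?K. pscale (i X (pscale k x + y)) (polytabloid m j X))"
      by (simp add: iadd iscale pm.scale_sum_right pm.scale_left_distrib sum.distrib)
    finally show ?case .
  qed
  have "irr_char ?l \<sigma> = quot_trace ?U {0} (pushf ((\<circ>) \<sigma>))" by (rule irr_char_eq)
  also have "\<dots> = (\<Sum>X\<in>?K. i X (polytabloid m j (\<sigma> ` X)))"
  proof (rule quot_trace_factor[OF irr_module_basis])
    fix u assume u: "u \<in> ?U"
    have "pushf ((\<circ>) \<sigma>) u = pushf ((\<circ>) \<sigma>) (\<Sum>X\<in>?K. pscale (i X u) (polytabloid m j X))"
      using expand[OF u] by simp
    also have "\<dots> = (\<Sum>X\<in>?K. pscale (i X u) (polytabloid m j (\<sigma> ` X)))"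
      by (simp add: pushf.sum pushf.scale pushf_polytabloid[OF \<sigma>])
    finally show "pushf ((\<circ>) \<sigma>) u - (\<Sum>X\<in>?K. pscale (i X u) (polytabloid m j (\<sigma> ` X))) \<in> {0}"
      by simp
  qed (use \<sigma> in \<open>auto simp: irr_module_subspace iadd iscale irr_module_closed polyU izero\<close>)
  also have "\<dots> = (\<Sum>X\<in>?K. E (\<sigma> ` X) X)" by (simp add: E_def)
  also have "\<dots> = of_nat (fixc ?n j \<sigma>) - (if j = 0 then 0 else of_nat (fixc ?n (j - 1) \<sigma>))"
    using \<sigma> j by (intro trace_harmonic_projection E1 E2) auto
  finally show ?thesis .
qed

subsection \<open>Values of words\<close>

lemma mscale_nth [simp]: "mscale c X $ i $ j = c * X $ i $ j"
  by (simp add: mscale_def matrix_matrix_mult_def mat_def if_distrib if_distribR cong: if_cong)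

lemma munit_nth [simp]: "munit i j $ k $ l = (if k = i \<and> l = j then 1 else 0)"
  by (simp add: munit_def axis_def)

lemma matrix_mult_3:
  fixes A B :: "'k::field ^ 3 ^ 3"
  shows "(A ** B) $ i $ j = A $ i $ 1 * B $ 1 $ j + A $ i $ 2 * B $ 2 $ j + A $ i $ 3 * B $ 3 $ j"
  by (simp add: matrix_matrix_mult_def sum_3)

lemma A_even_entries:
  assumes "X \<in> A_even"
  shows "X $ 1 $ 2 = 0" "X $ 2 $ 1 = 0" "X $ 2 $ 3 = 0" "X $ 3 $ 1 = 0" "X $ 3 $ 2 = 0"
    "X $ 3 $ 3 = X $ 1 $ 1"
  using assms by (auto simp: A_even_def)

lemma A_odd_entries:
  assumes "X \<in> A_odd"
  shows "X $ 1 $ 1 = 0" "X $ 2 $ 2 = 0" "X $ 3 $ 3 = 0" "X $ 1 $ 3 = 0" "X $ 2 $ 1 = 0"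
    "X $ 3 $ 1 = 0" "X $ 3 $ 2 = 0"
  using assms by (auto simp: A_odd_def)

text \<open>The involution fixes every even element, so a skew one equals its own negative.\<close>

lemma admissible_YM:
  fixes \<rho> :: "var \<Rightarrow> 'k::field_char_0 ^ 3 ^ 3"
  assumes "admissible \<rho>"
  shows "\<rho> (YM i) = 0"
proof -
  have X: "\<rho> (YM i) \<in> A_even" "invol (\<rho> (YM i)) = - \<rho> (YM i)"
    using assms by (auto simp: admissible_def skew_part_def)
  have "x = 0" if "x = - x" for x :: 'k using that by simp
  moreover have "invol (\<rho> (YM i)) $ k $ l = - (\<rho> (YM i) $ k $ l)" for k l using X(2) by simp
  from this[of 1 1] this[of 1 3] this[of 2 2]
  have "\<rho> (YM i) $ 1 $ 1 = - (\<rho> (YM i) $ 1 $ 1)" "\<rho> (YM i) $ 1 $ 3 = - (\<rho> (YM i) $ 1 $ 3)"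
    "\<rho> (YM i) $ 2 $ 2 = - (\<rho> (YM i) $ 2 $ 2)"
    using A_even_entries(6)[OF X(1)] by (simp_all only: invol_entries)
  ultimately have "\<rho> (YM i) $ 1 $ 1 = 0" "\<rho> (YM i) $ 1 $ 3 = 0" "\<rho> (YM i) $ 2 $ 2 = 0" by blast+
  then show ?thesis using A_even_entries[OF X(1)] by (simp add: vec_eq_iff forall_3)
qed

fun isz :: "var \<Rightarrow> bool" where
  "isz (ZP i) = True" | "isz (ZM i) = True" | "isz (YP i) = False" | "isz (YM i) = False"

text \<open>On odd variables: the ratio of the (2,3) entry to the (1,2) entry, which the reflection
  interchanges.\<close>

fun zsgn :: "var \<Rightarrow> 'k::field" where
  "zsgn (ZM i) = -1" | "zsgn (ZP i) = 1" | "zsgn (YP i) = 1" | "zsgn (YM i) = 1"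

lemma admissible_YP:
  assumes "admissible \<rho>"
  shows "\<rho> (YP i) $ 1 $ 2 = 0" "\<rho> (YP i) $ 2 $ 1 = 0" "\<rho> (YP i) $ 2 $ 3 = 0"
    "\<rho> (YP i) $ 3 $ 1 = 0" "\<rho> (YP i) $ 3 $ 2 = 0" "\<rho> (YP i) $ 3 $ 3 = \<rho> (YP i) $ 1 $ 1"
  using A_even_entries[of "\<rho> (YP i)"] assms by (auto simp: admissible_def sym_part_def)

lemma admissible_odd:
  fixes \<rho> :: "var \<Rightarrow> 'k::field ^ 3 ^ 3"
  assumes "admissible \<rho>" "isz v"
  shows "\<rho> v $ 1 $ 1 = 0" "\<rho> v $ 2 $ 2 = 0" "\<rho> v $ 3 $ 3 = 0" "\<rho> v $ 1 $ 3 = 0"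
    "\<rho> v $ 2 $ 1 = 0" "\<rho> v $ 3 $ 1 = 0" "\<rho> v $ 3 $ 2 = 0" "\<rho> v $ 2 $ 3 = zsgn v * \<rho> v $ 1 $ 2"
proof -
  have "\<rho> v \<in> A_odd"
    using assms by (cases v) (auto simp: admissible_def sym_part_def skew_part_def)
  note A_odd_entries[OF this]
  then show "\<rho> v $ 1 $ 1 = 0" "\<rho> v $ 2 $ 2 = 0" "\<rho> v $ 3 $ 3 = 0" "\<rho> v $ 1 $ 3 = 0"
    "\<rho> v $ 2 $ 1 = 0" "\<rho> v $ 3 $ 1 = 0" "\<rho> v $ 3 $ 2 = 0" by blast+
  show "\<rho> v $ 2 $ 3 = zsgn v * \<rho> v $ 1 $ 2"
  proof (cases v)
    case (ZP i)
    then have "invol (\<rho> v) = \<rho> v" using assms by (simp add: admissible_def sym_part_def)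
    then have "invol (\<rho> v) $ 1 $ 2 = \<rho> v $ 1 $ 2" by simp
    then show ?thesis using ZP by (simp add: invol_entries)
  next
    case (ZM i)
    then have "invol (\<rho> v) = - \<rho> v" using assms by (simp add: admissible_def skew_part_def)
    then have "invol (\<rho> v) $ 1 $ 2 = - (\<rho> v $ 1 $ 2)" by simp
    then show ?thesis using ZM by (simp add: invol_entries)
  qed (use assms in auto)
qed

text \<open>\<open>yset True w\<close> and \<open>yset False w\<close> collect the indices of the variables \<open>YP i\<close> that are preceded in \<open>w\<close> by
  an even, respectively odd, number of odd variables. On the path through the rows of the matrix units
  they contribute their diagonal entries at \<open>e\<^sub>1\<^sub>1 + e\<^sub>3\<^sub>3\<close> and at \<open>e\<^sub>2\<^sub>2\<close>.\<close>

fun yset :: "bool \<Rightarrow> var list \<Rightarrow> nat set" where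
  "yset b [] = {}"
| "yset b (YP i # w) = (if b then insert i (yset b w) else yset b w)"
| "yset b (YM i # w) = yset b w"
| "yset b (ZP i # w) = yset (\<not> b) w"
| "yset b (ZM i # w) = yset (\<not> b) w"

definition zlist :: "var list \<Rightarrow> var list"
  where "zlist w = filter isz w"

text \<open>Where this sign occurs in an entry of a word, the last odd variable is the one that
  contributes its (2,3) entry.\<close>

definition lsgn :: "var list \<Rightarrow> 'k::field"
  where "lsgn w = (if zlist w = [] then 1 else zsgn (last (zlist w)))"

text \<open>With two odd variables the only nonzero entry carries \<open>lsgn\<close>, which depends
  on their order and has to be divided out. With one odd variable the sign is the same for all words
  in the same variables.\<close>

definition eps :: "var list \<Rightarrow> 'k::field"
  where "eps w = (if length (zlist w) = 2 then lsgn w else 1)"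

lemma zlist_simps [simp]:
  "zlist [] = []" "isz v \<Longrightarrow> zlist (v # w) = v # zlist w" "\<not> isz v \<Longrightarrow> zlist (v # w) = zlist w"
  by (simp_all add: zlist_def)

lemma yset_isz: "isz v \<Longrightarrow> yset b (v # w) = yset (\<not> b) w"
  by (cases v) auto

lemma yset_union: "yset True w \<union> yset False w = {i. YP i \<in> set w}"
proof (induction w)
  case (Cons v w)
  then show ?case by (cases v) auto
qed auto

lemma yset_subset: "yset b w \<subseteq> {i. YP i \<in> set w}"
  using yset_union[of w] by (cases b) auto

lemma finite_yset [simp]: "finite (yset b w)"
  by (induction b w rule: yset.induct) auto

lemma yset_disjoint: "distinct w \<Longrightarrow> yset True w \<inter> yset False w = {}"
proof (induction w)
  case (Cons v w)
  then show ?case using yset_subset[of _ w] by (cases v) auto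
qed auto

lemma yset_False_no_z: "zlist w = [] \<Longrightarrow> yset False w = {}"
proof (induction w)
  case (Cons v w)
  then show ?case by (cases v) auto
qed auto

lemma eval_word_simps [simp]: "eval_word \<rho> [] = mat 1" "eval_word \<rho> (v # w) = \<rho> v ** eval_word \<rho> w"
  by (simp_all add: eval_word_def)

lemma mat_1_nth [simp]: "mat 1 $ i $ j = (if i = j then 1 else 0 :: 'k::field)"
  by (simp add: mat_def)

lemma eval_word_zero:
  assumes "v \<in> set w" "\<rho> v = 0"
  shows "eval_word \<rho> w = 0"
  using assms(1)
proof (induction w)
  case (Cons u w)
  have "0 ** X = (0 :: 'a ^ 3 ^ 3)" "X ** 0 = (0 :: 'a ^ 3 ^ 3)" for X :: "'a ^ 3 ^ 3"
    by (simp_all add: vec_eq_iff matrix_matrix_mult_def)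
  then show ?case using Cons assms(2) by auto
qed simp

section \<open>Matrix entries of words under a fixed admissible substitution\<close>

context
  fixes \<rho> :: "var \<Rightarrow> 'k::field_char_0 ^ 3 ^ 3"
  assumes \<rho>: "admissible \<rho>"
begin

private definition "P b w = (\<Prod>i\<in>yset b w. \<rho> (YP i) $ 1 $ 1)"
private definition "Q b w = (\<Prod>i\<in>yset b w. \<rho> (YP i) $ 2 $ 2)"
private definition "Z w = prod_list (map (\<lambda>v. \<rho> v $ 1 $ 2) (zlist w))"

private lemma rec_simps:
  assumes "distinct (YP i # w)"
  shows "P True (YP i # w) = \<rho> (YP i) $ 1 $ 1 * P True w" "P False (YP i # w) = P False w"
    "Q True (YP i # w) = \<rho> (YP i) $ 2 $ 2 * Q True w" "Q False (YP i # w) = Q False w"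
    "Z (YP i # w) = Z w"
  using assms yset_subset[of True w] by (auto simp: P_def Q_def Z_def prod.insert_if)

private lemma rec_simps_odd:
  assumes "isz v"
  shows "P b (v # w) = P (\<not> b) w" "Q b (v # w) = Q (\<not> b) w" "Z (v # w) = \<rho> v $ 1 $ 2 * Z w"
  using assms by (simp_all add: P_def Q_def Z_def yset_isz)

private lemma rec_nil: "P b [] = 1" "Q b [] = 1" "Z [] = 1"
  by (simp_all add: P_def Q_def Z_def)

lemmas evs = matrix_mult_3 admissible_YP[OF \<rho>] admissible_odd[OF \<rho>] admissible_YM[OF \<rho>]

private lemma lower_entries:
  "eval_word \<rho> w $ 2 $ 1 = 0" "eval_word \<rho> w $ 3 $ 1 = 0" "eval_word \<rho> w $ 3 $ 2 = 0"
proof (induction w)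
  case (Cons v w)
  { case 1 show ?case using Cons by (cases v) (simp_all add: evs) }
  { case 2 show ?case using Cons by (cases v) (simp_all add: evs) }
  { case 3 show ?case using Cons by (cases v) (simp_all add: evs) }
qed auto

text \<open>The even values commute, and the (1,3) entry obeys the product rule because the square
  of the unit at (1,3) is zero.\<close>

lemma eval_no_z:
  assumes "distinct w" "zlist w = []" "\<forall>i. YM i \<notin> set w"
  shows "eval_word \<rho> w $ 1 $ 1 = P True w" "eval_word \<rho> w $ 3 $ 3 = P True w"
    "eval_word \<rho> w $ 2 $ 2 = Q True w" "eval_word \<rho> w $ 1 $ 2 = 0" "eval_word \<rho> w $ 2 $ 3 = 0"
    "eval_word \<rho> w $ 1 $ 3 = (\<Sum>k\<in>yset True w. \<rho> (YP k) $ 1 $ 3 * (\<Prod>i\<in>yset True w - {k}. \<rho> (YP i) $ 1 $ 1))"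
proof -
  have "eval_word \<rho> w $ 1 $ 1 = P True w \<and> eval_word \<rho> w $ 3 $ 3 = P True w \<and>
    eval_word \<rho> w $ 2 $ 2 = Q True w \<and> eval_word \<rho> w $ 1 $ 2 = 0 \<and> eval_word \<rho> w $ 2 $ 3 = 0 \<and>
    eval_word \<rho> w $ 1 $ 3 = (\<Sum>k\<in>yset True w. \<rho> (YP k) $ 1 $ 3 * (\<Prod>i\<in>yset True w - {k}. \<rho> (YP i) $ 1 $ 1))"
    using assms
  proof (induction w)
    case (Cons v w)
    then obtain i where v: "v = YP i" by (cases v) auto
    have i: "i \<notin> yset True w" using Cons.prems v yset_subset[of True w] by auto
    have "(\<Sum>k\<in>yset True w. \<rho> (YP k) $ 1 $ 3 * (\<Prod>l\<in>insert i (yset True w) - {k}. \<rho> (YP l) $ 1 $ 1)) =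
        (\<Sum>k\<in>yset True w. \<rho> (YP i) $ 1 $ 1 * (\<rho> (YP k) $ 1 $ 3 * (\<Prod>l\<in>yset True w - {k}. \<rho> (YP l) $ 1 $ 1)))"
    proof (rule sum.cong[OF refl])
      fix k assume k: "k \<in> yset True w"
      then have "insert i (yset True w) - {k} = insert i (yset True w - {k})" using i by auto
      then show "\<rho> (YP k) $ 1 $ 3 * (\<Prod>l\<in>insert i (yset True w) - {k}. \<rho> (YP l) $ 1 $ 1) =
          \<rho> (YP i) $ 1 $ 1 * (\<rho> (YP k) $ 1 $ 3 * (\<Prod>l\<in>yset True w - {k}. \<rho> (YP l) $ 1 $ 1))"
        using i by simp
    qed
    then have s: "(\<Sum>k\<in>insert i (yset True w). \<rho> (YP k) $ 1 $ 3 * (\<Prod>l\<in>insert i (yset True w) - {k}. \<rho> (YP l) $ 1 $ 1)) =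
        \<rho> (YP i) $ 1 $ 3 * P True w +
        \<rho> (YP i) $ 1 $ 1 * (\<Sum>k\<in>yset True w. \<rho> (YP k) $ 1 $ 3 * (\<Prod>l\<in>yset True w - {k}. \<rho> (YP l) $ 1 $ 1))"
      using i by (simp add: sum_distrib_left P_def)
    show ?case
      using Cons v s rec_simps[of i w] lower_entries[of w] by (simp add: evs)
  qed (simp add: rec_nil)
  then show "eval_word \<rho> w $ 1 $ 1 = P True w" "eval_word \<rho> w $ 3 $ 3 = P True w"
    "eval_word \<rho> w $ 2 $ 2 = Q True w" "eval_word \<rho> w $ 1 $ 2 = 0" "eval_word \<rho> w $ 2 $ 3 = 0"
    "eval_word \<rho> w $ 1 $ 3 = (\<Sum>k\<in>yset True w. \<rho> (YP k) $ 1 $ 3 * (\<Prod>i\<in>yset True w - {k}. \<rho> (YP i) $ 1 $ 1))"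
    by blast+
qed

text \<open>An odd value leads from row 1 to row 2 or from row 2 to row 3. Along the first path the
  even variables before it act at row 1 and those after it at row 2; along the second they act at
  row 2 and at row 3, where the diagonal entry is that of row 1.\<close>

lemma eval_one_z:
  assumes "distinct w" "length (zlist w) = 1" "\<forall>i. YM i \<notin> set w"
  shows "eval_word \<rho> w $ 1 $ 1 = 0" "eval_word \<rho> w $ 3 $ 3 = 0"
    "eval_word \<rho> w $ 2 $ 2 = 0" "eval_word \<rho> w $ 1 $ 3 = 0"
    "eval_word \<rho> w $ 1 $ 2 = Z w * P True w * Q False w"
    "eval_word \<rho> w $ 2 $ 3 = lsgn w * Z w * Q True w * P False w"
proof -
  have "eval_word \<rho> w $ 1 $ 1 = 0 \<and> eval_word \<rho> w $ 3 $ 3 = 0 \<and>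
    eval_word \<rho> w $ 2 $ 2 = 0 \<and> eval_word \<rho> w $ 1 $ 3 = 0 \<and>
    eval_word \<rho> w $ 1 $ 2 = Z w * P True w * Q False w \<and>
    eval_word \<rho> w $ 2 $ 3 = lsgn w * Z w * Q True w * P False w"
    using assms
  proof (induction w)
    case (Cons v w)
    show ?case
    proof (cases "isz v")
      case True
      then have z: "zlist w = []" using Cons.prems by simp
      then have "Z w = 1" "P False w = 1" "Q False w = 1" by (simp_all add: Z_def P_def Q_def yset_False_no_z)
      then show ?thesis
        using eval_no_z[OF _ z] Cons.prems True lower_entries[of w] z
        by (simp add: evs rec_simps_odd lsgn_def)
    next
      case False
      then obtain i where v: "v = YP i" using Cons.prems by (cases v) auto
      then show ?thesis
        using Cons rec_simps[of i w] lower_entries[of w] by (simp add: evs lsgn_def)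
    qed
  qed simp
  then show "eval_word \<rho> w $ 1 $ 1 = 0" "eval_word \<rho> w $ 3 $ 3 = 0"
    "eval_word \<rho> w $ 2 $ 2 = 0" "eval_word \<rho> w $ 1 $ 3 = 0"
    "eval_word \<rho> w $ 1 $ 2 = Z w * P True w * Q False w"
    "eval_word \<rho> w $ 2 $ 3 = lsgn w * Z w * Q True w * P False w"
    by blast+
qed

text \<open>The only path runs from 1 through 2 to 3. Even variables before the first and after the
  last odd one contribute the same diagonal entry, since the entries at rows 1 and 3 agree; this is
  why only the parity matters.\<close>

lemma eval_two_z:
  assumes "distinct w" "length (zlist w) = 2" "\<forall>i. YM i \<notin> set w"
  shows "eval_word \<rho> w $ 1 $ 1 = 0" "eval_word \<rho> w $ 3 $ 3 = 0"
    "eval_word \<rho> w $ 2 $ 2 = 0" "eval_word \<rho> w $ 1 $ 2 = 0" "eval_word \<rho> w $ 2 $ 3 = 0"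
    "eval_word \<rho> w $ 1 $ 3 = lsgn w * Z w * P True w * Q False w"
proof -
  have "eval_word \<rho> w $ 1 $ 1 = 0 \<and> eval_word \<rho> w $ 3 $ 3 = 0 \<and>
    eval_word \<rho> w $ 2 $ 2 = 0 \<and> eval_word \<rho> w $ 1 $ 2 = 0 \<and> eval_word \<rho> w $ 2 $ 3 = 0 \<and>
    eval_word \<rho> w $ 1 $ 3 = lsgn w * Z w * P True w * Q False w"
    using assms
  proof (induction w)
    case (Cons v w)
    show ?case
    proof (cases "isz v")
      case True
      then have z: "length (zlist w) = 1" using Cons.prems by simp
      then have "zlist w \<noteq> []" by auto
      then show ?thesis
        using eval_one_z[OF _ z] Cons.prems True lower_entries[of w]
        by (simp add: evs rec_simps_odd lsgn_def)
    next
      case False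
      then obtain i where v: "v = YP i" using Cons.prems by (cases v) auto
      then show ?thesis
        using Cons rec_simps[of i w] lower_entries[of w] by (simp add: evs lsgn_def)
    qed
  qed simp
  then show "eval_word \<rho> w $ 1 $ 1 = 0" "eval_word \<rho> w $ 3 $ 3 = 0"
    "eval_word \<rho> w $ 2 $ 2 = 0" "eval_word \<rho> w $ 1 $ 2 = 0" "eval_word \<rho> w $ 2 $ 3 = 0"
    "eval_word \<rho> w $ 1 $ 3 = lsgn w * Z w * P True w * Q False w"
    by blast+
qed

text \<open>A third odd step would lead out of the three rows.\<close>

lemma eval_many_z:
  assumes "distinct w" "length (zlist w) \<ge> 3" "\<forall>i. YM i \<notin> set w"
  shows "eval_word \<rho> w = 0"
  using assms
proof (induction w)
  case (Cons v w)
  show ?case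
  proof (cases "isz v \<and> length (zlist w) = 2")
    case True
    then show ?thesis
      using eval_two_z[of w] Cons.prems lower_entries[of w]
      by (simp add: vec_eq_iff forall_3 evs)
  next
    case False
    then have "eval_word \<rho> w = 0" using Cons by (cases "isz v") auto
    then show ?thesis by (simp add: vec_eq_iff matrix_matrix_mult_def)
  qed
qed simp

text \<open>The even variables outside \<open>yset True\<close> are those in
  \<open>yset False\<close>, so equal first sets force equal second sets and all products agree;
  with two odd variables \<open>eps\<close> cancels \<open>lsgn\<close>.\<close>

lemma eval_word_cong:
  assumes w: "distinct w" "distinct w'" "set w = set w'" and yset: "yset True w = yset True w'"
    and YM: "\<forall>i. YM i \<notin> set w" and len: "length (zlist w) \<le> 2"
  shows "mscale (eps w) (eval_word \<rho> w) = mscale (eps w') (eval_word \<rho> w')"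
proof -
  have z: "distinct (zlist w)" "distinct (zlist w')" "set (zlist w) = set (zlist w')"
    using w by (auto simp: zlist_def)
  then have l: "length (zlist w) = length (zlist w')" by (metis distinct_card)
  have "yset False w = {i. YP i \<in> set w} - yset True w" "yset False w' = {i. YP i \<in> set w'} - yset True w'"
    using yset_union yset_disjoint[OF w(1)] yset_disjoint[OF w(2)] by blast+
  then have yF: "yset False w = yset False w'" using w yset by simp
  have Zw: "Z w = Z w'" unfolding Z_def using z by (metis prod.distinct_set_conv_list)
  have PQ: "P b w = P b w'" "Q b w = Q b w'" for b
    unfolding P_def Q_def using yset yF by (cases b; simp)+
  have YM': "\<forall>i. YM i \<notin> set w'" using YM w by simp
  have sq: "zsgn v * (zsgn v * x) = (x :: 'k)" for v x by (cases v) auto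
  have c1: ?thesis if 1: "zlist w = []"
  proof -
    have "zlist w' = []" using l 1 by simp
    then show ?thesis
      using eval_no_z[OF w(1) 1 YM] eval_no_z[OF w(2) _ YM'] yset PQ lower_entries[of w] lower_entries[of w'] 1
      by (simp add: vec_eq_iff forall_3 eps_def)
  qed
  have c2: ?thesis if 2: "length (zlist w) = 1"
  proof -
    have len2: "length (zlist w') = 1" using l 2 by simp
    obtain v where v: "zlist w = [v]" using 2 by (metis One_nat_def length_0_conv length_Suc_conv)
    obtain v' where v': "zlist w' = [v']" using len2 by (metis One_nat_def length_0_conv length_Suc_conv)
    have "v = v'" using v v' z(3) by simp
    then have "lsgn w = (lsgn w' :: 'k)" using v v' by (simp add: lsgn_def)
    then show ?thesis
      using eval_one_z[OF w(1) 2 YM] eval_one_z[OF w(2) len2 YM'] PQ Zw lower_entries[of w] lower_entries[of w'] 2 len2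
      by (simp add: vec_eq_iff forall_3 eps_def)
  qed
  have c3: ?thesis if 3: "length (zlist w) = 2"
  proof -
    have len3: "length (zlist w') = 2" using l 3 by simp
    have ne: "zlist w \<noteq> []" "zlist w' \<noteq> []" using 3 len3 by auto
    have "eps u * eval_word \<rho> u $ 1 $ 3 = Z w * P True w * Q False w" if "u = w \<or> u = w'" for u
      using eval_two_z(6)[OF w(1) 3 YM] eval_two_z(6)[OF w(2) len3 YM'] PQ Zw that 3 len3 ne
      by (auto simp: eps_def lsgn_def mult.assoc sq)
    from this[of w] this[of w']
    have "eps w * eval_word \<rho> w $ 1 $ 3 = eps w' * eval_word \<rho> w' $ 1 $ 3" by simp
    then show ?thesis
      using eval_two_z(1-5)[OF w(1) 3 YM] eval_two_z(1-5)[OF w(2) len3 YM']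
        lower_entries[of w] lower_entries[of w']
      by (simp add: vec_eq_iff forall_3)
  qed
  show ?thesis
  proof (cases "zlist w = []")
    case False
    then have "length (zlist w) = 1 \<or> length (zlist w) = 2"
      using len by (cases "length (zlist w)") auto
    then show ?thesis using c2 c3 by blast
  qed (rule c1)
qed

text \<open>The column in which a path from row 1 ends after \<open>k\<close> odd steps.\<close>

definition zcol :: "nat \<Rightarrow> 3"
  where "zcol k = (if k = 0 then 1 else if k = 1 then 2 else 3)"

text \<open>An even variable in \<open>S\<close> survives only at row 1, any other only at row 2.
  The entry is therefore nonzero exactly if \<open>S\<close> contains \<open>yset True w\<close> and
  misses \<open>yset False w\<close>; this separates the classes of words.\<close>

lemma eval_word_indicator:
  assumes Y: "\<And>i. \<rho> (YP i) $ 1 $ 1 = (if i \<in> S then 1 else 0)"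
    "\<And>i. \<rho> (YP i) $ 2 $ 2 = (if i \<in> S then 0 else 1)"
    and O: "\<And>v. isz v \<Longrightarrow> \<rho> v $ 1 $ 2 = 1"
    and w: "distinct w" "\<forall>i. YM i \<notin> set w" "length (zlist w) \<le> 2"
    and S: "S \<subseteq> {i. YP i \<in> set w}" "zlist w = [] \<Longrightarrow> S = {i. YP i \<in> set w}"
  shows "eval_word \<rho> w $ 1 $ zcol (length (zlist w)) = (if yset True w = S then eps w else 0)"
proof -
  have "map (\<lambda>v. \<rho> v $ 1 $ 2) (zlist w) = map (\<lambda>v. 1) (zlist w)"
    using O by (intro map_cong) (auto simp: zlist_def)
  then have Z1: "Z w = 1" unfolding Z_def by (simp add: map_replicate_const)
  have pr: "(\<Prod>i\<in>A. if p i then 1 else 0 :: 'k) = (if \<forall>i\<in>A. p i then 1 else 0)"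
    if "finite A" for A :: "nat set" and p
    using that by (induction A rule: finite_induct) auto
  have "P True w = (if yset True w \<subseteq> S then 1 else 0)"
    unfolding P_def Y subset_eq by (rule pr) simp
  moreover have "Q False w = (if yset False w \<inter> S = {} then 1 else 0)"
  proof -
    have "Q False w = (\<Prod>i\<in>yset False w. if i \<notin> S then 1 else 0)"
      unfolding Q_def Y by (intro prod.cong) auto
    also have "\<dots> = (if \<forall>i\<in>yset False w. i \<notin> S then 1 else 0)" by (rule pr) simp
    also have "(\<forall>i\<in>yset False w. i \<notin> S) \<longleftrightarrow> yset False w \<inter> S = {}" by blast
    finally show ?thesis .
  qed
  moreover have "yset True w \<subseteq> S \<and> yset False w \<inter> S = {} \<longleftrightarrow> yset True w = S"
    using yset_union[of w] yset_disjoint[OF w(1)] S(1) by blast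
  ultimately have PQ: "P True w * Q False w = (if yset True w = S then 1 else 0)"
    by (auto split: if_splits)
  consider "length (zlist w) = 0" | "length (zlist w) = 1" | "length (zlist w) = 2"
    using w(3) by linarith
  then show ?thesis
  proof cases
    case 1
    then have z: "zlist w = []" by simp
    then have "yset True w = S" using S yset_union[of w] yset_False_no_z[OF z] by simp
    moreover have "Q False w = 1" using z by (simp add: Q_def yset_False_no_z)
    ultimately show ?thesis using eval_no_z(1)[OF w(1) z w(2)] PQ z by (simp add: zcol_def eps_def)
  next
    case 2
    then show ?thesis using eval_one_z(5)[OF w(1) 2 w(2)] PQ Z1 by (simp add: zcol_def eps_def)
  next
    case 3
    then show ?thesis using eval_two_z(6)[OF w(1) 3 w(2)] PQ Z1 by (simp add: zcol_def eps_def mult.assoc)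
  qed
qed

end

lemma indicator_substitution:
  "\<exists>\<rho> :: var \<Rightarrow> 'k::field_char_0 ^ 3 ^ 3. admissible \<rho> \<and>
    (\<forall>i. \<rho> (YP i) $ 1 $ 1 = (if i \<in> S then 1 else 0)) \<and>
    (\<forall>i. \<rho> (YP i) $ 2 $ 2 = (if i \<in> S then 0 else 1)) \<and> (\<forall>v. isz v \<longrightarrow> \<rho> v $ 1 $ 2 = 1)"
proof -
  define \<rho> :: "var \<Rightarrow> 'k ^ 3 ^ 3" where "\<rho> v = (case v of
      YP i \<Rightarrow> mscale (if i \<in> S then 1 else 0) (munit 1 1 + munit 3 3) +
        mscale (if i \<in> S then 0 else 1) (munit 2 2) + mscale 0 (munit 1 3)
    | YM i \<Rightarrow> mscale 0 (munit 1 1 + munit 3 3) + mscale 0 (munit 2 2) + mscale 0 (munit 1 3)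
    | ZP i \<Rightarrow> mscale 1 (munit 1 2) + mscale 1 (munit 2 3)
    | ZM i \<Rightarrow> mscale 1 (munit 1 2) + mscale (-1) (munit 2 3))" for v
  have "\<rho> (YP i) \<in> A_even" "\<rho> (YM i) \<in> A_even" "\<rho> (ZP i) \<in> A_odd" "\<rho> (ZM i) \<in> A_odd" for i
    unfolding \<rho>_def A_even_def A_odd_def var.case by blast+
  moreover have "invol (\<rho> (YP i)) = \<rho> (YP i)" "invol (\<rho> (YM i)) = - \<rho> (YM i)"
    "invol (\<rho> (ZP i)) = \<rho> (ZP i)" "invol (\<rho> (ZM i)) = - \<rho> (ZM i)" for i
    by (simp_all add: vec_eq_iff forall_3 invol_entries \<rho>_def)
  ultimately have "admissible \<rho>" by (simp add: admissible_def sym_part_def skew_part_def)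
  moreover have "\<rho> v $ 1 $ 2 = 1" if "isz v" for v using that by (cases v) (auto simp: \<rho>_def)
  ultimately show ?thesis by (intro exI[of _ \<rho>]) (simp add: \<rho>_def)
qed

subsection \<open>The cocharacter\<close>

definition lf :: "('a \<Rightarrow> 'k) \<Rightarrow> ('a \<Rightarrow>\<^sub>0 'k::field) \<Rightarrow> 'k"
  where "lf c f = (\<Sum>w\<in>Poly_Mapping.keys f. Poly_Mapping.lookup f w * c w)"

lemma lf_superset:
  assumes "finite S" "Poly_Mapping.keys f \<subseteq> S"
  shows "lf c f = (\<Sum>w\<in>S. Poly_Mapping.lookup f w * c w)"
  unfolding lf_def by (rule sum_keys_superset[where F = "\<lambda>w k. k * c w"]) (use assms in auto)

lemma lf_add: "lf c (f + g) = lf c f + lf c g"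
  using Poly_Mapping.keys_add[of f g]
  by (simp add: lf_superset[of "Poly_Mapping.keys f \<union> Poly_Mapping.keys g"] lookup_add
      distrib_right sum.distrib)

lemma lf_scale: "lf c (pscale k f) = k * lf c f"
  using keys_pscale_subset[of k f]
  by (simp add: lf_superset[of "Poly_Mapping.keys f"] sum_distrib_left mult.assoc)

lemma lf_zero [simp]: "lf c 0 = 0"
  by (simp add: lf_def)

lemma lf_single [simp]: "lf c (Poly_Mapping.single w k) = k * c w"
  by (simp add: lf_def)

lemma lf_sum: "lf c (\<Sum>x\<in>A. f x) = (\<Sum>x\<in>A. lf c (f x))"
  by (induction A rule: infinite_finite_induct) (auto simp: lf_add)

lemma lf_diff: "lf c (f - g) = lf c f - lf c g"
  using lf_add[of c "f - g" g] by simp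

lemma lf_pushf: "lf c (pushf h f) = lf (c \<circ> h) f"
  by (simp add: pushf_def lf_sum) (simp add: lf_def)

lemma keys_pushf: "Poly_Mapping.keys (pushf h f) \<subseteq> h ` Poly_Mapping.keys f"
proof (rule subsetI, rule ccontr)
  fix y assume y: "y \<in> Poly_Mapping.keys (pushf h f)" "y \<notin> h ` Poly_Mapping.keys f"
  have "Poly_Mapping.lookup (pushf h f) y =
      (\<Sum>w\<in>Poly_Mapping.keys f. Poly_Mapping.lookup f w when h w = y)"
    by (simp add: pushf_def lookup_sum lookup_single)
  also have "\<dots> = 0" using y(2) by (intro sum.neutral) auto
  finally show False using y(1) by (simp add: in_keys_iff)
qed

text \<open>Presents the identities as the common kernel of linear functionals, one for each
  admissible substitution and each matrix entry.\<close>

lemma Id_A_iff: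
  "f \<in> Id_A \<longleftrightarrow> (\<forall>\<rho>. admissible \<rho> \<longrightarrow> (\<forall>i j. lf (\<lambda>w. eval_word \<rho> w $ i $ j) f = 0))"
  by (simp add: Id_A_def eval_free_def vec_eq_iff lf_def)

lemma subspace_Id_A: "pm.subspace Id_A"
  by (auto simp: pm.subspace_def Id_A_iff lf_add lf_scale)

lemma subspace_multilin: "pm.subspace (multilin n1 n2 n3 n4)"
proof (rule pm.subspaceI)
  show "0 \<in> multilin n1 n2 n3 n4" by (simp add: multilin_def)
  show "f + g \<in> multilin n1 n2 n3 n4" if "f \<in> multilin n1 n2 n3 n4" "g \<in> multilin n1 n2 n3 n4"
    for f g :: "'a free_alg"
    unfolding multilin_def mem_Collect_eq
  proof
    fix w assume "w \<in> Poly_Mapping.keys (f + g)"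
    then have "w \<in> Poly_Mapping.keys f \<or> w \<in> Poly_Mapping.keys g"
      using Poly_Mapping.keys_add[of f g] by auto
    then show "distinct w \<and> set w = vars_upto n1 n2 n3 n4" using that by (auto simp: multilin_def)
  qed
  show "pscale c f \<in> multilin n1 n2 n3 n4" if "f \<in> multilin n1 n2 n3 n4" for c and f :: "'a free_alg"
    unfolding multilin_def mem_Collect_eq
  proof
    fix w assume "w \<in> Poly_Mapping.keys (pscale c f)"
    then have "w \<in> Poly_Mapping.keys f" by (rule subsetD[OF keys_pscale_subset])
    then show "distinct w \<and> set w = vars_upto n1 n2 n3 n4" using that by (simp add: multilin_def)
  qed
qed

lemma inj_rename_var:
  assumes "g1 \<in> Sym n1" "g2 \<in> Sym n2" "g3 \<in> Sym n3" "g4 \<in> Sym n4"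
  shows "inj (rename_var (g1, g2, g3, g4))"
proof (rule injI)
  fix u v assume "rename_var (g1, g2, g3, g4) u = rename_var (g1, g2, g3, g4) v"
  then show "u = v"
    by (cases u; cases v) (simp_all add: Sym_inj[OF assms(1)] Sym_inj[OF assms(2)] Sym_inj[OF assms(3)] Sym_inj[OF assms(4)])
qed

lemma rename_var_word:
  assumes g: "g1 \<in> Sym n1" "g2 \<in> Sym n2" "g3 \<in> Sym n3" "g4 \<in> Sym n4"
    and w: "distinct w" "set w = vars_upto n1 n2 n3 n4"
  shows "distinct (map (rename_var (g1, g2, g3, g4)) w)"
    "set (map (rename_var (g1, g2, g3, g4)) w) = vars_upto n1 n2 n3 n4"
proof -
  let ?r = "rename_var (g1, g2, g3, g4)"
  show "distinct (map ?r w)"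
    using w(1) inj_on_subset[OF inj_rename_var[OF g] subset_UNIV] by (simp add: distinct_map)
  have "?r ` vars_upto n1 n2 n3 n4 =
      YP ` g1 ` {..<n1} \<union> YM ` g2 ` {..<n2} \<union> ZP ` g3 ` {..<n3} \<union> ZM ` g4 ` {..<n4}"
    by (simp add: vars_upto_def image_Un image_image)
  then show "set (map ?r w) = vars_upto n1 n2 n3 n4"
    using w(2) g by (simp add: Sym_image_lessThan vars_upto_def)
qed

lemma act_free_multilin:
  assumes "g1 \<in> Sym n1" "g2 \<in> Sym n2" "g3 \<in> Sym n3" "g4 \<in> Sym n4" "f \<in> multilin n1 n2 n3 n4"
  shows "act_free (g1, g2, g3, g4) f \<in> multilin n1 n2 n3 n4"
  unfolding multilin_def mem_Collect_eq act_free_eq_pushf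
proof
  fix w assume "w \<in> Poly_Mapping.keys (pushf (map (rename_var (g1, g2, g3, g4))) f)"
  then have "w \<in> map (rename_var (g1, g2, g3, g4)) ` Poly_Mapping.keys f"
    by (rule subsetD[OF keys_pushf])
  then obtain u where "u \<in> Poly_Mapping.keys f" "w = map (rename_var (g1, g2, g3, g4)) u"
    by (rule imageE)
  then show "distinct w \<and> set w = vars_upto n1 n2 n3 n4"
    using rename_var_word[OF assms(1-4), of u] assms(5) by (simp add: multilin_def)
qed

text \<open>Renaming the variables before evaluation amounts to changing the substitution, which
  stays admissible because renaming preserves parity and symmetry.\<close>

lemma act_free_Id_A:
  assumes "f \<in> Id_A"
  shows "act_free g f \<in> Id_A"
proof -
  obtain g1 g2 g3 g4 where g: "g = (g1, g2, g3, g4)" by (cases g) auto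
  have ev: "eval_word \<rho> (map h w) = eval_word (\<rho> \<circ> h) w" for \<rho> :: "var \<Rightarrow> 'a ^ 3 ^ 3" and h w
    by (induction w) auto
  have "admissible (\<rho> \<circ> rename_var g)" if "admissible \<rho>" for \<rho> :: "var \<Rightarrow> 'a ^ 3 ^ 3"
    using that by (simp add: admissible_def g)
  then show ?thesis
    using assms by (simp add: Id_A_iff act_free_eq_pushf lf_pushf comp_def ev)
qed

lemma yset_map_rename: "yset b (map (rename_var (g1, g2, g3, g4)) w) = g1 ` yset b w"
  by (induction b w rule: yset.induct) auto

lemma eps_map_rename: "eps (map (rename_var g) w) = (eps w :: 'k::field)"
proof -
  obtain g1 g2 g3 g4 where g: "g = (g1, g2, g3, g4)" by (cases g) auto
  have "isz (rename_var g v) = isz v" for v unfolding g by (cases v) auto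
  then have z: "zlist (map (rename_var g) w) = map (rename_var g) (zlist w)"
    by (simp add: zlist_def filter_map comp_def)
  have "zsgn (rename_var g v) = (zsgn v :: 'k)" for v unfolding g by (cases v) auto
  then show ?thesis by (simp add: eps_def lsgn_def z last_map)
qed

lemma eps_square: "eps w * eps w = (1 :: 'k::field)"
proof -
  have "zsgn v * zsgn v = (1 :: 'k)" for v by (cases v) auto
  then show ?thesis by (simp add: eps_def lsgn_def)
qed

lemma length_zlist_multilin:
  assumes "distinct w" "set w = vars_upto n1 n2 n3 n4"
  shows "length (zlist w) = n3 + n4"
proof -
  have "set (zlist w) = {v \<in> vars_upto n1 n2 n3 n4. isz v}" by (simp add: zlist_def assms)
  also have "\<dots> = ZP ` {..<n3} \<union> ZM ` {..<n4}"
  proof (rule set_eqI)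
    show "v \<in> {v \<in> vars_upto n1 n2 n3 n4. isz v} \<longleftrightarrow> v \<in> ZP ` {..<n3} \<union> ZM ` {..<n4}" for v
      by (cases v) (simp_all add: vars_upto_def image_iff)
  qed
  finally have "card (set (zlist w)) = card (ZP ` {..<n3} \<union> ZM ` {..<n4})" by simp
  also have "\<dots> = card (ZP ` {..<n3}) + card (ZM ` {..<n4})"
    by (rule card_Un_disjoint) auto
  also have "\<dots> = n3 + n4" by (simp add: card_image inj_on_def)
  finally have "card (set (zlist w)) = n3 + n4" .
  moreover have "distinct (zlist w)" using assms(1) by (simp add: zlist_def)
  ultimately show ?thesis using distinct_card[of "zlist w"] by simp
qed

lemma YM_in_vars_upto [simp]: "YM i \<in> vars_upto n1 n2 n3 n4 \<longleftrightarrow> i < n2"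
  and YP_in_vars_upto [simp]: "YP i \<in> vars_upto n1 n2 n3 n4 \<longleftrightarrow> i < n1"
  by (simp_all add: vars_upto_def image_iff)

text \<open>Every multilinear word evaluates to zero, so the quotient is zero and its trace is an
  empty sum.\<close>

lemma cochar_zero:
  assumes g: "g \<in> Sym n1 \<times> Sym n2 \<times> Sym n3 \<times> Sym n4" and n: "n2 \<noteq> 0 \<or> n3 + n4 \<ge> 3"
  shows "cochar n1 n2 n3 n4 g = (0 :: 'k::field_char_0)"
proof -
  let ?U = "multilin n1 n2 n3 n4 :: 'k free_alg set"
  have ev: "eval_word \<rho> w = 0"
    if "admissible \<rho>" "distinct w" "set w = vars_upto n1 n2 n3 n4" for \<rho> :: "var \<Rightarrow> 'k ^ 3 ^ 3" and w
  proof (cases "\<exists>i. YM i \<in> set w")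
    case True
    then obtain i where "YM i \<in> set w" ..
    then show ?thesis using admissible_YM[OF that(1)] by (rule eval_word_zero)
  next
    case False
    then have "YM 0 \<notin> vars_upto n1 n2 n3 n4" using that(3) by simp
    then have "n3 + n4 \<ge> 3" using n by simp
    then show ?thesis
      using eval_many_z[OF that(1,2)] False length_zlist_multilin[OF that(2,3)] by simp
  qed
  have sub: "?U \<subseteq> Id_A"
  proof
    fix f :: "'k free_alg" assume f: "f \<in> ?U"
    have "lf (\<lambda>w. eval_word \<rho> w $ i $ j) f = 0" if "admissible \<rho>" for \<rho> :: "var \<Rightarrow> 'k ^ 3 ^ 3" and i j
      unfolding lf_def using f ev[OF that] by (intro sum.neutral) (auto simp: multilin_def)
    then show "f \<in> Id_A" by (simp add: Id_A_iff)
  qed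
  have W: "pm.subspace (?U \<inter> Id_A)" by (intro pm.subspace_inter subspace_multilin subspace_Id_A)
  have sp: "?U \<subseteq> pm.span ({} \<union> (?U \<inter> Id_A))"
  proof
    fix f assume "f \<in> ?U"
    then show "f \<in> pm.span ({} \<union> (?U \<inter> Id_A))" using sub by (intro pm.span_base) auto
  qed
  have ex: "\<exists>B. quot_basis ?U (?U \<inter> Id_A) B"
    by (rule quot_basis_exists[OF subspace_multilin W Int_lower1 finite.emptyI empty_subsetI sp])
  obtain g1 g2 g3 g4 where g': "g = (g1, g2, g3, g4)" by (cases g) auto
  have TU: "act_free g u \<in> ?U" if "u \<in> ?U" for u
    using g that unfolding g' by (intro act_free_multilin) auto
  have "quot_trace ?U (?U \<inter> Id_A) (act_free g) = (\<Sum>x\<in>{}. (\<lambda>_ _. 0) x ((\<lambda>_. 0) x) :: 'k)"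
  proof (rule quot_trace_factor[OF ex W subspace_multilin TU])
    show "act_free g u - (\<Sum>x\<in>{}. pscale ((\<lambda>_ _. 0) x u) ((\<lambda>_. 0) x)) \<in> ?U \<inter> Id_A" if "u \<in> ?U" for u
      using TU[OF that] sub by auto
  qed auto
  then show ?thesis by (simp add: cochar_def)
qed

section \<open>Representatives of multilinear words modulo the identities\<close>

lemma yset_append_YP: "yset b (map YP xs @ w) = (if b then set xs else {}) \<union> yset b w"
  by (induction xs) auto

lemma yset_no_YP: "(\<And>i. YP i \<notin> set w) \<Longrightarrow> yset b w = {}"
  using yset_subset[of b w] by auto

text \<open>The possible sets \<open>yset True w\<close> for multilinear words \<open>w\<close>; without odd variables every even
  variable is counted.\<close>

definition word_index :: "nat \<Rightarrow> nat \<Rightarrow> nat \<Rightarrow> nat set set"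
  where "word_index n1 n3 n4 = (if n3 + n4 = 0 then {{..<n1}} else Pow {..<n1})"

lemma yset_in_word_index:
  assumes "distinct w" "set w = vars_upto n1 n2 n3 n4"
  shows "yset True w \<in> word_index n1 n3 n4"
proof -
  have u: "yset True w \<union> yset False w = {..<n1}" using yset_union[of w] assms(2) by auto
  show ?thesis
  proof (cases "n3 + n4 = 0")
    case True
    then have "zlist w = []" using length_zlist_multilin[OF assms] by simp
    then show ?thesis using u True by (simp add: word_index_def yset_False_no_z)
  next
    case False
    then show ?thesis using u by (auto simp: word_index_def)
  qed
qed

text \<open>Put the variables of \<open>S\<close> before the first odd variable and the other even
  ones immediately after it, ahead of the remaining odd ones. Without odd variables there is no such
  separation, but then \<open>S\<close> contains all of them.\<close>

lemma word_exists:
  assumes S: "S \<in> word_index n1 n3 n4"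
  shows "\<exists>w. distinct w \<and> set w = vars_upto n1 0 n3 n4 \<and> yset True w = S"
proof -
  let ?zs = "map ZP [0..<n3] @ map ZM [0..<n4]"
  have zs: "distinct ?zs" "set ?zs = ZP ` {..<n3} \<union> ZM ` {..<n4}"
    by (auto simp: distinct_map inj_on_def)
  have S1: "S \<subseteq> {..<n1}" using S by (auto simp: word_index_def split: if_splits)
  obtain xs where xs: "set xs = S" "distinct xs"
    using finite_distinct_list[of S] S1 finite_subset by blast
  obtain ys where ys: "set ys = {..<n1} - S" "distinct ys"
    using finite_distinct_list[of "{..<n1} - S"] by blast
  have inj: "inj_on YP A" for A by (simp add: inj_on_def)
  show ?thesis
  proof (cases ?zs)
    case Nil
    then have n: "n3 = 0" "n4 = 0" by auto
    then have "S = {..<n1}" using S by (simp add: word_index_def)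
    then have "distinct (map YP xs)" "set (map YP xs) = vars_upto n1 0 n3 n4" "yset True (map YP xs) = S"
      using xs n inj yset_append_YP[of True xs "[]"] by (simp_all add: distinct_map vars_upto_def)
    then show ?thesis by blast
  next
    case (Cons z zs')
    let ?w = "map YP xs @ z # map YP ys @ zs'"
    have zin: "z \<in> set ?zs" "set zs' \<subseteq> set ?zs" by (auto simp: Cons)
    have no: "YP i \<notin> set ?zs" for i by auto
    have z: "isz z" using zin(1) by auto
    have "YP i \<notin> set zs'" for i using no zin(2) by blast
    then have "yset b zs' = {}" for b by (rule yset_no_YP)
    then have "yset True ?w = S" using xs z by (simp add: yset_append_YP yset_isz)
    moreover have "set ?w = YP ` set xs \<union> YP ` set ys \<union> set (z # zs')" by auto
    then have "set ?w = vars_upto n1 0 n3 n4"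
      using xs ys S1 unfolding Cons[symmetric] zs(2) by (auto simp: vars_upto_def)
    moreover have "distinct ?w"
    proof -
      have "distinct (z # zs')" using zs(1) unfolding Cons .
      moreover have "YP i \<noteq> z" "YP i \<notin> set zs'" for i using no zin by auto
      ultimately show ?thesis using xs ys inj by (auto simp: distinct_map)
    qed
    ultimately show ?thesis by blast
  qed
qed

text \<open>The signed words \<open>p S\<close> represent a basis of the quotient with dual
  functionals \<open>lf (c S)\<close>, and the group permutes this basis through its action on sets;
  the trace counts the fixed sets.\<close>

lemma cochar_value:
  assumes g: "g1 \<in> Sym n1" "g2 \<in> Sym 0" "g3 \<in> Sym n3" "g4 \<in> Sym n4" and n: "n3 + n4 \<le> 2"
  shows "cochar n1 0 n3 n4 (g1, g2, g3, g4) =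
    (of_nat (card {S \<in> word_index n1 n3 n4. g1 ` S = S}) :: 'k::field_char_0)"
proof -
  let ?g = "(g1, g2, g3, g4)"
  let ?U = "multilin n1 0 n3 n4 :: 'k free_alg set" and ?I = "word_index n1 n3 n4"
  let ?W = "?U \<inter> Id_A"
  have finI: "finite ?I" by (simp add: word_index_def)
  define c where "c S w = (if yset True w = S then eps w else 0 :: 'k)" for S w
  define wd where "wd S = (SOME w. distinct w \<and> set w = vars_upto n1 0 n3 n4 \<and> yset True w = S)" for S
  have wd: "distinct (wd S)" "set (wd S) = vars_upto n1 0 n3 n4" "yset True (wd S) = S" if "S \<in> ?I" for S
    using someI_ex[OF word_exists[OF that]] unfolding wd_def by blast+
  define p where "p S = Poly_Mapping.single (wd S) (eps (wd S) :: 'k)" for S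
  have p: "p S \<in> ?U" if "S \<in> ?I" for S
    using wd[OF that] by (simp add: p_def multilin_def)
  have U: "pm.subspace ?U" by (rule subspace_multilin)
  have W: "pm.subspace ?W" by (intro pm.subspace_inter subspace_multilin subspace_Id_A)
  \<comment> \<open>On multilinear polynomials \<open>lf (c S)\<close> reads off one matrix entry
    under the indicator substitution of \<open>S\<close>, so it kills identities.\<close>
  have van: "lf (c S) f = 0" if S: "S \<in> ?I" and f: "f \<in> ?W" for S f
  proof -
    obtain \<rho> :: "var \<Rightarrow> 'k ^ 3 ^ 3" where \<rho>: "admissible \<rho>"
      "\<And>i. \<rho> (YP i) $ 1 $ 1 = (if i \<in> S then 1 else 0)"
      "\<And>i. \<rho> (YP i) $ 2 $ 2 = (if i \<in> S then 0 else 1)" "\<And>v. isz v \<Longrightarrow> \<rho> v $ 1 $ 2 = 1"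
      using indicator_substitution[of S, where 'k = 'k] by blast
    have "lf (c S) f = lf (\<lambda>w. eval_word \<rho> w $ 1 $ zcol (n3 + n4)) f"
      unfolding lf_def
    proof (rule sum.cong[OF refl])
      fix w assume "w \<in> Poly_Mapping.keys f"
      then have w: "distinct w" "set w = vars_upto n1 0 n3 n4" using f by (auto simp: multilin_def)
      have len: "length (zlist w) = n3 + n4" using w by (rule length_zlist_multilin)
      have "eval_word \<rho> w $ 1 $ zcol (length (zlist w)) = (if yset True w = S then eps w else 0)"
      proof (rule eval_word_indicator[OF \<rho>(1) \<rho>(2) \<rho>(3) \<rho>(4) w(1)])
        show "S \<subseteq> {i. YP i \<in> set w}" using S w(2) by (auto simp: word_index_def split: if_splits)
        show "S = {i. YP i \<in> set w}" if "zlist w = []"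
          using S w(2) len that by (auto simp: word_index_def)
      qed (use w len n in auto)
      then show "Poly_Mapping.lookup f w * c S w =
          Poly_Mapping.lookup f w * eval_word \<rho> w $ 1 $ zcol (n3 + n4)"
        by (simp add: c_def len)
    qed
    also have "\<dots> = 0" using f \<rho>(1) by (simp add: Id_A_iff)
    finally show ?thesis .
  qed
  \<comment> \<open>Modulo identities a word \<open>w\<close> is \<open>eps w\<close> times
    \<open>p (yset True w)\<close>, by \<open>eval_word_cong\<close>.\<close>
  have expand: "f - (\<Sum>S\<in>?I. pscale (lf (c S) f) (p S)) \<in> ?W" if f: "f \<in> ?U" for f
  proof
    show "f - (\<Sum>S\<in>?I. pscale (lf (c S) f) (p S)) \<in> ?U"
      using p f by (intro pm.subspace_diff[OF U] pm.subspace_sum[OF U] pm.subspace_scale[OF U]) auto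
    have "lf (\<lambda>w. eval_word \<rho> w $ i $ j) (\<Sum>S\<in>?I. pscale (lf (c S) f) (p S)) =
        lf (\<lambda>w. eval_word \<rho> w $ i $ j) f" if \<rho>: "admissible \<rho>" for \<rho> :: "var \<Rightarrow> 'k ^ 3 ^ 3" and i j
    proof -
      let ?e = "\<lambda>w. eval_word \<rho> w $ i $ j"
      have "lf ?e (\<Sum>S\<in>?I. pscale (lf (c S) f) (p S)) =
          (\<Sum>S\<in>?I. lf (c S) f * (eps (wd S) * ?e (wd S)))"
        by (simp add: lf_sum lf_scale p_def mult.assoc)
      also have "\<dots> = (\<Sum>S\<in>?I. \<Sum>w\<in>Poly_Mapping.keys f.
          if yset True w = S then Poly_Mapping.lookup f w * eps w * (eps (wd S) * ?e (wd S)) else 0)"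
        unfolding lf_def sum_distrib_right by (intro sum.cong refl) (simp add: c_def)
      also have "\<dots> = (\<Sum>w\<in>Poly_Mapping.keys f. \<Sum>S\<in>?I.
          if yset True w = S then Poly_Mapping.lookup f w * eps w * (eps (wd S) * ?e (wd S)) else 0)"
        by (rule sum.swap)
      also have "\<dots> = (\<Sum>w\<in>Poly_Mapping.keys f. Poly_Mapping.lookup f w * ?e w)"
      proof (rule sum.cong[OF refl])
        fix w assume "w \<in> Poly_Mapping.keys f"
        then have w: "distinct w" "set w = vars_upto n1 0 n3 n4" using f by (auto simp: multilin_def)
        let ?S = "yset True w"
        have S: "?S \<in> ?I" using w by (rule yset_in_word_index)
        have "mscale (eps (wd ?S)) (eval_word \<rho> (wd ?S)) = mscale (eps w) (eval_word \<rho> w)"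
          using wd[OF S] w length_zlist_multilin[OF w] length_zlist_multilin[OF wd(1,2)[OF S]] n
          by (intro eval_word_cong[OF \<rho>]) auto
        then have "mscale (eps (wd ?S)) (eval_word \<rho> (wd ?S)) $ i $ j = mscale (eps w) (eval_word \<rho> w) $ i $ j"
          by simp
        then have e: "eps (wd ?S) * ?e (wd ?S) = eps w * ?e w" by simp
        have "(\<Sum>S\<in>?I. if ?S = S then Poly_Mapping.lookup f w * eps w * (eps (wd S) * ?e (wd S)) else 0) =
            Poly_Mapping.lookup f w * eps w * (eps (wd ?S) * ?e (wd ?S))"
          using finI S by simp
        also have "\<dots> = Poly_Mapping.lookup f w * (eps w * eps w) * ?e w"
          unfolding e by (simp only: mult.assoc)
        finally show "(\<Sum>S\<in>?I. if ?S = S then Poly_Mapping.lookup f w * eps w * (eps (wd S) * ?e (wd S)) else 0) =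
            Poly_Mapping.lookup f w * ?e w" by (simp add: eps_square)
      qed
      finally show ?thesis by (simp add: lf_def)
    qed
    then show "f - (\<Sum>S\<in>?I. pscale (lf (c S) f) (p S)) \<in> Id_A"
      by (simp add: Id_A_iff lf_diff)
  qed
  have sp: "?U \<subseteq> pm.span (p ` ?I \<union> ?W)"
  proof
    fix f assume f: "f \<in> ?U"
    have "(f - (\<Sum>S\<in>?I. pscale (lf (c S) f) (p S))) + (\<Sum>S\<in>?I. pscale (lf (c S) f) (p S))
        \<in> pm.span (p ` ?I \<union> ?W)"
    proof (rule pm.span_add)
      show "f - (\<Sum>S\<in>?I. pscale (lf (c S) f) (p S)) \<in> pm.span (p ` ?I \<union> ?W)"
        using expand[OF f] by (intro pm.span_base) blast
      show "(\<Sum>S\<in>?I. pscale (lf (c S) f) (p S)) \<in> pm.span (p ` ?I \<union> ?W)"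
        by (intro pm.span_sum pm.span_scale pm.span_base) simp
    qed
    then show "f \<in> pm.span (p ` ?I \<union> ?W)" by simp
  qed
  have pU: "p ` ?I \<subseteq> ?U" using p by blast
  have ex: "\<exists>B. quot_basis ?U ?W B"
    by (rule quot_basis_exists[OF U W Int_lower1 finite_imageI[OF finI] pU sp])
  have TU: "act_free ?g f \<in> ?U" if "f \<in> ?U" for f
    using g that by (rule act_free_multilin)
  have "quot_trace ?U ?W (act_free ?g) = (\<Sum>S\<in>?I. lf (c S) (act_free ?g (p S)))"
  proof (rule quot_trace_factor[OF ex W U TU, where i = "\<lambda>S. lf (c S)"])
    show "act_free ?g (p S) \<in> ?U" if "S \<in> ?I" for S using TU p[OF that] .
    show "lf (c S) f = 0" if "S \<in> ?I" "f \<in> ?U" "f \<in> ?W" for S f using van that by blast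
    fix f assume f: "f \<in> ?U"
    have "act_free ?g (f - (\<Sum>S\<in>?I. pscale (lf (c S) f) (p S))) \<in> ?W"
      using expand[OF f] TU act_free_Id_A by blast
    then show "act_free ?g f - (\<Sum>S\<in>?I. pscale (lf (c S) f) (act_free ?g (p S))) \<in> ?W"
      by (simp add: act_free_eq_pushf pushf.diff pushf.sum pushf.scale)
  qed (simp_all add: lf_add lf_scale)
  also have "\<dots> = (\<Sum>S\<in>?I. if g1 ` S = S then 1 else 0)"
  proof (rule sum.cong[OF refl])
    fix S assume S: "S \<in> ?I"
    have "lf (c S) (act_free ?g (p S)) = eps (wd S) * c S (map (rename_var ?g) (wd S))"
      by (simp add: act_free_eq_pushf p_def)
    also have "\<dots> = (if g1 ` S = S then eps (wd S) * eps (wd S) else 0)"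
      unfolding c_def yset_map_rename eps_map_rename wd(3)[OF S] by simp
    finally show "lf (c S) (act_free ?g (p S)) = (if g1 ` S = S then 1 else 0)"
      by (simp add: eps_square)
  qed
  also have "\<dots> = (\<Sum>S\<in>{S \<in> ?I. g1 ` S = S}. 1)"
    using finI by (intro sum.mono_neutral_cong_right) auto
  finally show ?thesis by (simp add: cochar_def)
qed

subsection \<open>Decomposition and uniqueness of multiplicities\<close>

lemma fixc_complement:
  assumes "\<sigma> \<in> Sym n" "k \<le> n"
  shows "fixc n (n - k) \<sigma> = fixc n k \<sigma>"
proof -
  let ?F = "\<lambda>k. {X \<in> ksub n k. \<sigma> ` X = X}"
  have co: "{..<n} - X \<in> ?F (n - l)" if "X \<in> ?F l" for X l
  proof -
    have X: "X \<subseteq> {..<n}" "finite X" "card X = l" "\<sigma> ` X = X"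
      using that by (auto simp: ksub_def finite_subset)
    then have "\<sigma> ` ({..<n} - X) = {..<n} - X" using Sym_image_Diff[OF assms(1), of X] by simp
    then show ?thesis using X by (simp add: ksub_def card_Diff_subset)
  qed
  have dbl: "\<forall>X\<in>?F l. {..<n} - ({..<n} - X) = X" for l
    by (simp add: ksub_def double_diff)
  have "bij_betw (\<lambda>X. {..<n} - X) (?F k) (?F (n - k))"
  proof (rule bij_betw_byWitness[where f' = "\<lambda>X. {..<n} - X", OF dbl dbl])
    show "(\<lambda>X. {..<n} - X) ` ?F k \<subseteq> ?F (n - k)" by (rule image_subsetI) (rule co)
    show "(\<lambda>X. {..<n} - X) ` ?F (n - k) \<subseteq> ?F k"
    proof (rule image_subsetI)
      fix X assume "X \<in> ?F (n - k)"
      from co[OF this] show "{..<n} - X \<in> ?F k" using assms(2) by simp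
    qed
  qed
  from bij_betw_same_card[OF this] show ?thesis unfolding fixc_def by simp
qed

text \<open>The differences in \<open>irr_char_two_row\<close> telescope.\<close>

lemma fixc_eq_sum_irr_char:
  assumes "\<sigma> \<in> Sym n" "2 * k \<le> n"
  shows "of_nat (fixc n k \<sigma>) = (\<Sum>j\<le>k. irr_char (part [n - j, j]) \<sigma> :: 'k::field_char_0)"
  using assms(2)
proof (induction k)
  case 0
  then show ?case using irr_char_two_row[of 0 n \<sigma>, where 'k = 'k] assms(1) by simp
next
  case (Suc k)
  have "irr_char (part [n - Suc k, Suc k]) \<sigma> = (of_nat (fixc n (Suc k) \<sigma>) - of_nat (fixc n k \<sigma>) :: 'k)"
    using irr_char_two_row[of "Suc k" "n - Suc k" \<sigma>, where 'k = 'k] assms(1) Suc.prems by simp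
  then show ?case using Suc by simp
qed

lemma sum_fixc_decomposition:
  assumes "\<sigma> \<in> Sym n"
  shows "(\<Sum>k\<le>n. of_nat (fixc n k \<sigma>)) =
    (\<Sum>j\<le>n div 2. of_nat (n - 2 * j + 1) * irr_char (part [n - j, j]) \<sigma> :: 'k::field_char_0)"
proof -
  let ?\<chi> = "\<lambda>j. irr_char (part [n - j, j]) \<sigma> :: 'k"
  have "(\<Sum>k\<le>n. of_nat (fixc n k \<sigma>)) = (\<Sum>k\<le>n. \<Sum>j\<le>n div 2. if j \<le> k \<and> k \<le> n - j then ?\<chi> j else 0)"
  proof (rule sum.cong[OF refl])
    fix k assume "k \<in> {..n}"
    then have k: "k \<le> n" by simp
    \<comment> \<open>Complementation reduces to subsets of at most half the size. Moreover
      \<open>j \<le> m\<close> means that \<open>k\<close> lies between \<open>j\<close> and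
      \<open>n - j\<close>; the number of such \<open>k\<close> is the multiplicity of the
      \<open>j\<close>-th character.\<close>
    define m where "m = min k (n - k)"
    have m: "2 * m \<le> n" "m \<le> n div 2" by (auto simp: m_def)
    have "of_nat (fixc n k \<sigma>) = (of_nat (fixc n m \<sigma>) :: 'k)"
      using fixc_complement[OF assms k] by (simp add: m_def min_def)
    also have "\<dots> = (\<Sum>j\<le>m. ?\<chi> j)" by (rule fixc_eq_sum_irr_char[OF assms m(1)])
    also have "\<dots> = (\<Sum>j\<le>n div 2. if j \<le> k \<and> k \<le> n - j then ?\<chi> j else 0)"
      using m k by (intro sum.mono_neutral_cong_left) (auto simp: m_def)
    finally show "of_nat (fixc n k \<sigma>) = (\<Sum>j\<le>n div 2. if j \<le> k \<and> k \<le> n - j then ?\<chi> j else 0)" .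
  qed
  also have "\<dots> = (\<Sum>j\<le>n div 2. \<Sum>k\<le>n. if j \<le> k \<and> k \<le> n - j then ?\<chi> j else 0)"
    by (rule sum.swap)
  also have "\<dots> = (\<Sum>j\<le>n div 2. of_nat (n - 2 * j + 1) * ?\<chi> j)"
  proof (rule sum.cong[OF refl])
    fix j assume "j \<in> {..n div 2}"
    then have j: "2 * j \<le> n" by simp
    have "(\<Sum>k\<le>n. if j \<le> k \<and> k \<le> n - j then ?\<chi> j else 0) = (\<Sum>k\<in>{j..n - j}. ?\<chi> j)"
      by (intro sum.mono_neutral_cong_right) auto
    also have "\<dots> = of_nat (card {j..n - j}) * ?\<chi> j" by (rule sum_constant)
    also have "card {j..n - j} = n - 2 * j + 1" using j by simp
    finally show "(\<Sum>k\<le>n. if j \<le> k \<and> k \<le> n - j then ?\<chi> j else 0) = of_nat (n - 2 * j + 1) * ?\<chi> j" .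
  qed
  finally show ?thesis .
qed

lemma card_fixed_subsets:
  "card {S \<in> Pow {..<n}. \<sigma> ` S = S} = (\<Sum>k\<le>n. fixc n k \<sigma>)"
proof -
  have "{S \<in> Pow {..<n}. \<sigma> ` S = S} = (\<Union>k\<le>n. {X \<in> ksub n k. \<sigma> ` X = X})"
    using card_mono[of "{..<n}"] by (fastforce simp: ksub_def)
  then show ?thesis unfolding fixc_def
    by (simp only:) (rule card_UN_disjoint, auto simp: ksub_def)
qed

lemma irr_char_one_row:
  assumes "\<sigma> \<in> Sym n"
  shows "irr_char (part [n]) \<sigma> = (1 :: 'k::field_char_0)"
proof -
  have "part [n] = part [n, 0]" by (simp add: part_def)
  moreover have "{X \<in> ksub n 0. \<sigma> ` X = X} = {{}}" by (auto simp: ksub_def finite_subset)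
  ultimately show ?thesis
    using irr_char_two_row[of 0 n \<sigma>, where 'k = 'k] assms by (simp add: fixc_def)
qed

section \<open>Independence of the outer characters\<close>

lemma sum_Times: "sum f (A \<times> B) = (\<Sum>a\<in>A. \<Sum>b\<in>B. f (a, b))"
  by (simp add: sum.cartesian_product)

text \<open>Fix the permutations in all factors but the first and apply independence there; the
  vanishing coefficients are again relations, now for the remaining factors.\<close>

lemma outer_char_independent:
  fixes d :: "multipart \<Rightarrow> 'k::field_char_0"
  assumes "\<And>g. g \<in> Sym n1 \<times> Sym n2 \<times> Sym n3 \<times> Sym n4 \<Longrightarrow>
      (\<Sum>\<Lambda>\<in>multipartitions n1 n2 n3 n4. d \<Lambda> * outer_char \<Lambda> g) = 0"
    and "\<Lambda> \<in> multipartitions n1 n2 n3 n4"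
  shows "d \<Lambda> = 0"
proof -
  obtain l1 l2 l3 l4 where \<Lambda>: "\<Lambda> = (l1, l2, l3, l4)" by (cases \<Lambda>) auto
  have l: "l1 \<in> partitions n1" "l2 \<in> partitions n2" "l3 \<in> partitions n3" "l4 \<in> partitions n4"
    using assms(2) by (auto simp: \<Lambda> multipartitions_def)
  have expand: "(\<Sum>\<Lambda>\<in>multipartitions n1 n2 n3 n4. d \<Lambda> * outer_char \<Lambda> (g1, g2, g3, g4)) =
      (\<Sum>k1\<in>partitions n1. (\<Sum>k2\<in>partitions n2. (\<Sum>k3\<in>partitions n3. (\<Sum>k4\<in>partitions n4.
        d (k1, k2, k3, k4) * irr_char k4 g4) * irr_char k3 g3) * irr_char k2 g2) * irr_char k1 g1)"
    for g1 g2 g3 g4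
    unfolding multipartitions_def
    by (simp add: sum_Times sum_distrib_left sum_distrib_right mult_ac)
  have s1: "(\<Sum>k2\<in>partitions n2. (\<Sum>k3\<in>partitions n3. (\<Sum>k4\<in>partitions n4.
        d (l1, k2, k3, k4) * irr_char k4 g4) * irr_char k3 g3) * irr_char k2 g2) = 0"
    if "g2 \<in> Sym n2" "g3 \<in> Sym n3" "g4 \<in> Sym n4" for g2 g3 g4
    by (rule irr_char_independent[OF _ l(1)]) (use assms(1) that in \<open>simp add: expand[symmetric]\<close>)
  have s2: "(\<Sum>k3\<in>partitions n3. (\<Sum>k4\<in>partitions n4.
        d (l1, l2, k3, k4) * irr_char k4 g4) * irr_char k3 g3) = 0"
    if "g3 \<in> Sym n3" "g4 \<in> Sym n4" for g3 g4
    by (rule irr_char_independent[OF _ l(2)]) (use s1 that in simp)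
  have s3: "(\<Sum>k4\<in>partitions n4. d (l1, l2, l3, k4) * irr_char k4 g4) = 0"
    if "g4 \<in> Sym n4" for g4
    by (rule irr_char_independent[OF _ l(3)]) (use s2 that in simp)
  show ?thesis unfolding \<Lambda> by (rule irr_char_independent[OF s3 l(4)])
qed

lemma part_in_partitions: "2 * j \<le> n \<Longrightarrow> part [n - j, j] \<in> partitions n"
  by (auto simp: part_def partitions_def)

lemma part_two_row_inject:
  assumes "2 * i \<le> n" "2 * j \<le> n" "part [n - i, i] = part [n - j, j]"
  shows "i = j"
  using assms by (auto simp: part_def split: if_splits)

section \<open>The explicit multiplicities\<close>

definition mult_rows :: "nat \<Rightarrow> nat \<Rightarrow> nat \<Rightarrow> nat \<Rightarrow> nat set"
  where "mult_rows n1 n2 n3 n4 = (if n2 \<noteq> 0 \<or> n3 + n4 \<ge> 3 then {} else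
    if n3 + n4 = 0 then {0} else {..n1 div 2})"

text \<open>The index \<open>j\<close> is the length of the second row in the first partition.
  Within the range \<open>mult_rows\<close> distinct \<open>j\<close> give distinct partitions, so
  at most one term is nonzero; the form as a sum lets the sum over multipartitions be interchanged
  with it.\<close>

definition cochar_mult :: "nat \<Rightarrow> nat \<Rightarrow> nat \<Rightarrow> nat \<Rightarrow> multipart \<Rightarrow> nat"
  where "cochar_mult n1 n2 n3 n4 \<Lambda> = (\<Sum>j\<in>mult_rows n1 n2 n3 n4.
    if \<Lambda> = (part [n1 - j, j], [], part [n3], part [n4])
    then (if n3 + n4 = 0 then 1 else n1 - 2 * j + 1) else 0)"

lemma finite_mult_rows [simp]: "finite (mult_rows n1 n2 n3 n4)"
  by (simp add: mult_rows_def)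

lemma mult_rows_bound: "j \<in> mult_rows n1 n2 n3 n4 \<Longrightarrow> 2 * j \<le> n1"
  by (auto simp: mult_rows_def split: if_splits)

lemma cochar_mult_eq:
  assumes "j \<in> mult_rows n1 n2 n3 n4"
  shows "cochar_mult n1 n2 n3 n4 (part [n1 - j, j], [], part [n3], part [n4]) =
    (if n3 + n4 = 0 then 1 else n1 - 2 * j + 1)"
proof -
  have "part [n1 - j, j] = part [n1 - i, i] \<longleftrightarrow> i = j" if "i \<in> mult_rows n1 n2 n3 n4" for i
    using part_two_row_inject[of i n1 j] mult_rows_bound[OF that] mult_rows_bound[OF assms] by auto
  then have "cochar_mult n1 n2 n3 n4 (part [n1 - j, j], [], part [n3], part [n4]) =
      (\<Sum>i\<in>mult_rows n1 n2 n3 n4. if i = j then (if n3 + n4 = 0 then 1 else n1 - 2 * i + 1) else 0)"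
    unfolding cochar_mult_def by (intro sum.cong refl) simp
  then show ?thesis using assms by simp
qed

lemma cochar_mult_zero:
  assumes "\<And>j. j \<in> mult_rows n1 n2 n3 n4 \<Longrightarrow> \<Lambda> \<noteq> (part [n1 - j, j], [], part [n3], part [n4])"
  shows "cochar_mult n1 n2 n3 n4 \<Lambda> = 0"
  unfolding cochar_mult_def using assms by (intro sum.neutral) auto

lemma cochar_mults_cochar_mult:
  "cochar_mults TYPE('k::field_char_0) n1 n2 n3 n4 (cochar_mult n1 n2 n3 n4)"
  unfolding cochar_mults_def
proof
  fix g assume gS: "g \<in> Sym n1 \<times> Sym n2 \<times> Sym n3 \<times> Sym n4"
  then obtain g1 g2 g3 g4 where g: "g = (g1, g2, g3, g4)"
    "g1 \<in> Sym n1" "g2 \<in> Sym n2" "g3 \<in> Sym n3" "g4 \<in> Sym n4" by auto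
  let ?J = "mult_rows n1 n2 n3 n4" and ?M = "multipartitions n1 n2 n3 n4"
  let ?\<Lambda> = "\<lambda>j. (part [n1 - j, j], [], part [n3], part [n4])"
  let ?w = "\<lambda>j. if n3 + n4 = 0 then 1 else n1 - 2 * j + 1"
  have finM: "finite ?M" by (simp add: multipartitions_def)
  have mem: "?\<Lambda> j \<in> ?M" if "j \<in> ?J" for j
    using that mult_rows_bound[OF that] part_in_partitions[of j n1] part_in_partitions[of 0 n3] part_in_partitions[of 0 n4]
    by (auto simp: multipartitions_def mult_rows_def partitions_def part_def split: if_splits)
  have "(\<Sum>\<Lambda>\<in>?M. of_nat (cochar_mult n1 n2 n3 n4 \<Lambda>) * outer_char \<Lambda> g) =
      (\<Sum>\<Lambda>\<in>?M. \<Sum>j\<in>?J. if \<Lambda> = ?\<Lambda> j then of_nat (?w j) * outer_char \<Lambda> g else 0 :: 'k)"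
    unfolding cochar_mult_def of_nat_sum sum_distrib_right
    by (intro sum.cong refl) (simp del: of_nat_diff)
  also have "\<dots> = (\<Sum>j\<in>?J. \<Sum>\<Lambda>\<in>?M. if \<Lambda> = ?\<Lambda> j then of_nat (?w j) * outer_char \<Lambda> g else 0)"
    by (rule sum.swap)
  also have "\<dots> = (\<Sum>j\<in>?J. of_nat (?w j) * outer_char (?\<Lambda> j) g)"
  proof (rule sum.cong[OF refl])
    fix j assume j: "j \<in> ?J"
    have "(\<Sum>\<Lambda>\<in>?M. if \<Lambda> = ?\<Lambda> j then of_nat (?w j) * outer_char \<Lambda> g else 0 :: 'k) =
        (if ?\<Lambda> j \<in> ?M then of_nat (?w j) * outer_char (?\<Lambda> j) g else 0)"
      by (rule sum.delta[OF finM])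
    then show "(\<Sum>\<Lambda>\<in>?M. if \<Lambda> = ?\<Lambda> j then of_nat (?w j) * outer_char \<Lambda> g else 0 :: 'k) =
        of_nat (?w j) * outer_char (?\<Lambda> j) g" using mem[OF j] by (simp only: if_True)
  qed
  also have "\<dots> = cochar n1 n2 n3 n4 g"
  proof (cases "n2 \<noteq> 0 \<or> n3 + n4 \<ge> 3")
    case True
    then show ?thesis using cochar_zero[OF gS True, where 'k = 'k] by (simp add: mult_rows_def)
  next
    case False
    then have n: "n2 = 0" "n3 + n4 \<le> 2" by auto
    have "irr_char [] g2 = (1 :: 'k)"
      using irr_char_one_row[of g2 0, where 'k = 'k] g n by (simp add: part_def)
    then have out: "outer_char (?\<Lambda> j) g = (irr_char (part [n1 - j, j]) g1 :: 'k)" for j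
      using g irr_char_one_row[of g3 n3, where 'k = 'k] irr_char_one_row[of g4 n4, where 'k = 'k] by simp
    have val: "cochar n1 n2 n3 n4 g = (of_nat (card {S \<in> word_index n1 n3 n4. g1 ` S = S}) :: 'k)"
      using cochar_value[of g1 n1 g2 g3 n3 g4 n4, where 'k = 'k] g n by simp
    show ?thesis
    proof (cases "n3 + n4 = 0")
      case True
      have "{S \<in> {{..<n1}}. g1 ` S = S} = {{..<n1}}" using Sym_image_lessThan[OF g(2)] by auto
      then have "cochar n1 n2 n3 n4 g = (1 :: 'k)" unfolding val word_index_def using True by simp
      moreover have "part [n1, 0] = part [n1]" by (simp add: part_def)
      ultimately show ?thesis
        using True n irr_char_one_row[OF g(2), where 'k = 'k] out[of 0] by (simp add: mult_rows_def)
    next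
      case False
      have "word_index n1 n3 n4 = Pow {..<n1}" by (simp only: word_index_def False if_False)
      then have "cochar n1 n2 n3 n4 g = (of_nat (\<Sum>k\<le>n1. fixc n1 k g1) :: 'k)"
        by (simp only: val card_fixed_subsets)
      also have "\<dots> = (\<Sum>j\<le>n1 div 2. of_nat (n1 - 2 * j + 1) * irr_char (part [n1 - j, j]) g1)"
        unfolding of_nat_sum by (rule sum_fixc_decomposition[OF g(2)])
      finally have "cochar n1 n2 n3 n4 g =
          (\<Sum>j\<le>n1 div 2. of_nat (n1 - 2 * j + 1) * irr_char (part [n1 - j, j]) g1 :: 'k)" .
      moreover have "?J = {..n1 div 2}" using n False by (auto simp: mult_rows_def)
      ultimately show ?thesis using False by (simp only: out if_False)
    qed
  qed
  finally show "cochar n1 n2 n3 n4 g =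
      (\<Sum>\<Lambda>\<in>?M. of_nat (cochar_mult n1 n2 n3 n4 \<Lambda>) * outer_char \<Lambda> g :: 'k)" by simp
qed

text \<open>The difference of two families is a relation among the outer characters; in
  characteristic zero its vanishing in the field gives equality of natural numbers.\<close>

lemma cochar_mults_unique:
  assumes m: "cochar_mults TYPE('k::field_char_0) n1 n2 n3 n4 m"
    and m': "cochar_mults TYPE('k) n1 n2 n3 n4 m'"
    and \<Lambda>: "\<Lambda> \<in> multipartitions n1 n2 n3 n4"
  shows "m \<Lambda> = m' \<Lambda>"
proof -
  have "of_nat (m \<Lambda>) - of_nat (m' \<Lambda>) = (0 :: 'k)"
  proof (rule outer_char_independent[where d = "\<lambda>\<Lambda>. of_nat (m \<Lambda>) - of_nat (m' \<Lambda>)", OF _ \<Lambda>])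
    fix g assume g: "g \<in> Sym n1 \<times> Sym n2 \<times> Sym n3 \<times> Sym n4"
    show "(\<Sum>\<Lambda>\<in>multipartitions n1 n2 n3 n4. (of_nat (m \<Lambda>) - of_nat (m' \<Lambda>)) * outer_char \<Lambda> g) = (0 :: 'k)"
      using bspec[OF m[unfolded cochar_mults_def] g] bspec[OF m'[unfolded cochar_mults_def] g]
      by (simp add: left_diff_distrib sum_subtractf)
  qed
  then show ?thesis by simp
qed

theorem theorem8:
  fixes n1 n2 n3 n4 :: nat
  assumes "n1 + n2 + n3 + n4 \<ge> 1"
  shows "(\<exists>m. cochar_mults TYPE('k::field_char_0) n1 n2 n3 n4 m) \<and>
    (\<forall>m. cochar_mults TYPE('k) n1 n2 n3 n4 m \<longrightarrow>
      (\<forall>\<Lambda> \<in> multipartitions n1 n2 n3 n4.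
        ((n1 > 0 \<and> \<Lambda> = (part [n1], [], [], [])) \<or>
         (0 < n3 + n4 \<and> n3 + n4 \<le> 2 \<and> \<Lambda> = ([], [], part [n3], part [n4]))
           \<longrightarrow> m \<Lambda> = 1) \<and>
        (\<forall>p q. n3 + n4 = 1 \<and> \<Lambda> = (part [p + q, p], [], part [n3], part [n4])
           \<longrightarrow> m \<Lambda> = q + 1) \<and>
        (\<forall>p q. n3 + n4 = 2 \<and> \<Lambda> = (part [p + q, p], [], part [n3], part [n4])
           \<longrightarrow> m \<Lambda> = q + 1) \<and>
        (\<not> (n1 > 0 \<and> \<Lambda> = (part [n1], [], [], [])) \<and>
         \<not> (0 < n3 + n4 \<and> n3 + n4 \<le> 2 \<and> \<Lambda> = ([], [], part [n3], part [n4])) \<and>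
         \<not> (\<exists>p q. n3 + n4 = 1 \<and> \<Lambda> = (part [p + q, p], [], part [n3], part [n4])) \<and>
         \<not> (\<exists>p q. n3 + n4 = 2 \<and> \<Lambda> = (part [p + q, p], [], part [n3], part [n4]))
           \<longrightarrow> m \<Lambda> = 0)))"
proof (rule conjI, rule exI, rule cochar_mults_cochar_mult, intro allI impI ballI)
  fix m \<Lambda> assume m: "cochar_mults TYPE('k) n1 n2 n3 n4 m" and \<Lambda>: "\<Lambda> \<in> multipartitions n1 n2 n3 n4"
  let ?m = "cochar_mult n1 n2 n3 n4"
  have mm: "m \<Lambda> = ?m \<Lambda>"
    by (rule cochar_mults_unique[OF m cochar_mults_cochar_mult \<Lambda>])
  obtain l1 l2 l3 l4 where L: "\<Lambda> = (l1, l2, l3, l4)" by (cases \<Lambda>) auto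
  have sums: "sum_list l1 = n1" "sum_list l2 = n2" "sum_list l3 = n3" "sum_list l4 = n4"
    using \<Lambda> by (auto simp: L multipartitions_def partitions_def)
  have part0: "part [k, 0] = part [k]" "part [0] = []" for k by (simp_all add: part_def)
  have case1: "m \<Lambda> = 1" if h: "n1 > 0" "\<Lambda> = (part [n1], [], [], [])"
  proof -
    have n: "n2 = 0" "n3 = 0" "n4 = 0" using h sums L by auto
    then have "0 \<in> mult_rows n1 n2 n3 n4" by (simp add: mult_rows_def)
    from cochar_mult_eq[OF this] show ?thesis using n h mm by (simp add: part0)
  qed
  \<comment> \<open>Comparing degrees gives \<open>n1 = 2 * p + q\<close>, so the second row has
    length \<open>p\<close> and \<open>n1 - 2 * p + 1\<close> is \<open>q + 1\<close>.\<close>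
  have case23: "m \<Lambda> = q + 1"
    if h: "n3 + n4 = 1 \<or> n3 + n4 = 2" "\<Lambda> = (part [p + q, p], [], part [n3], part [n4])" for p q
  proof -
    have "l1 = part [p + q, p]" "l2 = []" using h(2) L by simp_all
    then have n: "n2 = 0" "n1 = 2 * p + q" using sums by simp_all
    then have "p \<in> mult_rows n1 n2 n3 n4" using h(1) by (auto simp: mult_rows_def)
    from cochar_mult_eq[OF this] show ?thesis
      using h mm n by (auto simp: mult_2)
  qed
  have case1': "m \<Lambda> = 1" if h: "0 < n3 + n4" "n3 + n4 \<le> 2" "\<Lambda> = ([], [], part [n3], part [n4])"
  proof -
    have "m \<Lambda> = 0 + 1" using h by (intro case23[of 0 0]) (auto simp: part_def)
    then show ?thesis by simp
  qed
  have case4: "m \<Lambda> = 0"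
    if h1: "\<not> (n1 > 0 \<and> \<Lambda> = (part [n1], [], [], []))"
      and h2: "\<And>p q. n3 + n4 = 1 \<or> n3 + n4 = 2 \<Longrightarrow> \<Lambda> \<noteq> (part [p + q, p], [], part [n3], part [n4])"
    unfolding mm
  proof (rule cochar_mult_zero)
    fix j assume j: "j \<in> mult_rows n1 n2 n3 n4"
    show "\<Lambda> \<noteq> (part [n1 - j, j], [], part [n3], part [n4])"
    proof (cases "n3 + n4 = 0")
      case True
      then have "j = 0" "n2 = 0" using j by (auto simp: mult_rows_def split: if_splits)
      \<comment> \<open>The total degree is at least 1 and only symmetric even variables occur, so
        \<open>n1 > 0\<close> and the excluded case applies.\<close>
      then show ?thesis using h1 assms True by (simp add: part0)
    next
      case False
      then have "n3 + n4 = 1 \<or> n3 + n4 = 2" using j by (auto simp: mult_rows_def split: if_splits)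
      moreover have "j + (n1 - 2 * j) = n1 - j" using mult_rows_bound[OF j] by simp
      ultimately show ?thesis using h2[of j "n1 - 2 * j"] by simp
    qed
  qed
  show "((n1 > 0 \<and> \<Lambda> = (part [n1], [], [], [])) \<or>
         (0 < n3 + n4 \<and> n3 + n4 \<le> 2 \<and> \<Lambda> = ([], [], part [n3], part [n4]))
           \<longrightarrow> m \<Lambda> = 1) \<and>
        (\<forall>p q. n3 + n4 = 1 \<and> \<Lambda> = (part [p + q, p], [], part [n3], part [n4])
           \<longrightarrow> m \<Lambda> = q + 1) \<and>
        (\<forall>p q. n3 + n4 = 2 \<and> \<Lambda> = (part [p + q, p], [], part [n3], part [n4])
           \<longrightarrow> m \<Lambda> = q + 1) \<and>
        (\<not> (n1 > 0 \<and> \<Lambda> = (part [n1], [], [], [])) \<and>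
         \<not> (0 < n3 + n4 \<and> n3 + n4 \<le> 2 \<and> \<Lambda> = ([], [], part [n3], part [n4])) \<and>
         \<not> (\<exists>p q. n3 + n4 = 1 \<and> \<Lambda> = (part [p + q, p], [], part [n3], part [n4])) \<and>
         \<not> (\<exists>p q. n3 + n4 = 2 \<and> \<Lambda> = (part [p + q, p], [], part [n3], part [n4]))
           \<longrightarrow> m \<Lambda> = 0)"
  proof (intro conjI allI impI, goal_cases)
    case 1
    then show ?case using case1 case1' by blast
  next
    case (2 p q)
    then show ?case using case23 by blast
  next
    case (3 p q)
    then show ?case using case23 by blast
  next
    case 4
    then show ?case by (intro case4) blast+
  qed
qed

end
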